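(* Let $n\ge 1$, let $1<p<r<\infty$, and let $q$ be defined by $\frac1p+\frac1q=1+\frac1r$. If $k\in L_{q,s}$ (a Lorentz space of measurable functions on $\mathbb{R}^n$), where $q\le s<\infty$, then the operator $K_k: L_p(\mathbb{R}^n)\to L_r(\mathbb{R}^n)$ has a maximizer.
   Context: Write $\|f\|_p$ for $\|f\|_{L_p(\mathbb{R}^n)}$. For a measurable function $f$ on $\mathbb{R}^n$, its distribution function is $d_f(\lambda)=|\{x : |f(x)|>\lambda\}|$ (Lebesgue measure), and its decreasing rearrangement is $f^*(t)=\inf\{\lambda>0 : d_f(\lambda)\le t\}$, defined for $t\in[0,\infty)$. For $0<s<\infty$ put $\|f\|_{q,s}=\left(\int_0^\infty\left(t^{1/q}f^*(t)\right)^s\frac{dt}{t}\right)^{1/s}$, and put $\|f\|_{q,\infty}=\sup_{t>0}t^{1/q}f^*(t)$. The Lorentz space $L_{q,s}$, $0<s\le\infty$, consists of the measurable functions $f$ with $\|f\|_{q,s}<\infty$; one has $L_{q,s}\subset L_{q,\infty}$. Let $\mathcal{S}(\mathbb{R}^n)$ be the Schwartz space. A tempered distribution $k$ on $\mathbb{R}^n$ belongs to $\mathrm{Cnv}(p,r)$ if there is a constant $C$ with $\|k*f\|_r\le C\|f\|_p$ for all $f\in\mathcal{S}(\mathbb{R}^n)$; then $K_k: L_p(\mathbb{R}^n)\to L_r(\mathbb{R}^n)$ denotes the unique continuous extension of $f\mapsto k*f$, with operator norm $\|K_k\|$. For $p,q,r$ as in the claim, every $k\in L_{q,\infty}$ belongs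 to $\mathrm{Cnv}(p,r)$ by the Hardy-Littlewood-Sobolev theorem (weak Young inequality), so $K_k$ is well defined. A maximizer for $K_k$ is a function $f\in L_p(\mathbb{R}^n)$ with $\|f\|_p=1$ and $\|K_kf\|_r=\|K_k\|$. *)

theory Defs
  imports "HOL-Analysis.Analysis"
begin

section \<open>Lorentz spaces\<close>

text \<open>Powers of extended nonnegative numbers, meant for exponents \<open>a > 0\<close>.\<close>

definition ennpowr :: "ennreal \<Rightarrow> real \<Rightarrow> ennreal" where
  "ennpowr x a = (if x = top then top else ennreal (enn2real x powr a))"

definition distribution_fun :: "(real^'n \<Rightarrow> complex) \<Rightarrow> real \<Rightarrow> ennreal" where
  "distribution_fun f u = emeasure lebesgue {x. norm (f x) > u}"

text \<open>The infimum of the empty set is \<open>top\<close>.\<close>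

definition rearrangement :: "(real^'n \<Rightarrow> complex) \<Rightarrow> real \<Rightarrow> ennreal" where
  "rearrangement f t = Inf {ennreal u |u. u > 0 \<and> distribution_fun f u \<le> ennreal t}"

definition lorentz_norm :: "real \<Rightarrow> real \<Rightarrow> (real^'n \<Rightarrow> complex) \<Rightarrow> ennreal" where
  "lorentz_norm q s f =
     ennpowr (\<integral>\<^sup>+t\<in>{0<..}. ennpowr (ennreal (t powr (1/q)) * rearrangement f t) s * ennreal (1/t) \<partial>lborel)
       (1/s)"

definition lorentz :: "real \<Rightarrow> real \<Rightarrow> (real^'n \<Rightarrow> complex) set" where
  "lorentz q s = {f \<in> borel_measurable lebesgue. lorentz_norm q s f < top}"


section \<open>Lebesgue spaces\<close>

text \<open>Elements are functions rather than classes modulo null sets; \<open>Lp_norm p f\<close> is meaningful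
  only for \<open>f \<in> Lp p\<close>, since the Bochner integral of a non-integrable function is \<open>0\<close>.\<close>

definition Lp :: "real \<Rightarrow> (real^'n \<Rightarrow> complex) set" where
  "Lp p = {f \<in> borel_measurable lebesgue. integrable lebesgue (\<lambda>x. norm (f x) powr p)}"

definition Lp_norm :: "real \<Rightarrow> (real^'n \<Rightarrow> complex) \<Rightarrow> real" where
  "Lp_norm p f = (LINT x|lebesgue. norm (f x) powr p) powr (1/p)"


section \<open>Schwartz functions and tempered distributions\<close>

definition partial_deriv :: "'n \<Rightarrow> (real^'n \<Rightarrow> complex) \<Rightarrow> real^'n \<Rightarrow> complex" where
  "partial_deriv i f x = frechet_derivative f (at x) (axis i 1)"

definition partial_derivs :: "'n list \<Rightarrow> (real^'n \<Rightarrow> complex) \<Rightarrow> real^'n \<Rightarrow> complex" where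
  "partial_derivs is = foldr partial_deriv is"

text \<open>Differentiability of all iterated partial derivatives amounts to \<open>C\<^sup>\<infinity>\<close>.\<close>

definition schwartz :: "(real^'n \<Rightarrow> complex) set" where
  "schwartz = {f. \<forall>is. (\<forall>x. partial_derivs is f differentiable (at x)) \<and>
                  (\<forall>m::nat. bounded (range (\<lambda>x. norm x ^ m *\<^sub>R partial_derivs is f x)))}"

definition schwartz_tendsto_zero :: "(nat \<Rightarrow> real^'n \<Rightarrow> complex) \<Rightarrow> bool" where
  "schwartz_tendsto_zero \<phi> \<longleftrightarrow>
     (\<forall>is. \<forall>m::nat. uniform_limit UNIV (\<lambda>j x. norm x ^ m *\<^sub>R partial_derivs is (\<phi> j) x)
        (\<lambda>x. 0) sequentially)"

text \<open>The Schwartz space is metrizable, so sequential continuity at \<open>0\<close> characterizes the continuous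
  linear functionals. Only the values on \<open>schwartz\<close> matter.\<close>

definition tempered_distribution :: "((real^'n \<Rightarrow> complex) \<Rightarrow> complex) \<Rightarrow> bool" where
  "tempered_distribution T \<longleftrightarrow>
     (\<forall>\<phi>\<in>schwartz. \<forall>\<psi>\<in>schwartz. \<forall>a b. T (\<lambda>x. a * \<phi> x + b * \<psi> x) = a * T \<phi> + b * T \<psi>) \<and>
     (\<forall>\<phi>. (\<forall>j. \<phi> j \<in> schwartz) \<and> schwartz_tendsto_zero \<phi> \<longrightarrow> (\<lambda>j. T (\<phi> j)) \<longlonglongrightarrow> 0)"

definition distr_of_fun :: "(real^'n \<Rightarrow> complex) \<Rightarrow> (real^'n \<Rightarrow> complex) \<Rightarrow> complex" where
  "distr_of_fun k \<phi> = (LINT y|lebesgue. k y * \<phi> y)"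

text \<open>For a function \<open>k\<close>, \<open>distr_conv (distr_of_fun k) f x\<close> is the integral of \<open>k y * f (x - y)\<close> over \<open>y\<close>.\<close>

definition distr_conv ::
    "((real^'n \<Rightarrow> complex) \<Rightarrow> complex) \<Rightarrow> (real^'n \<Rightarrow> complex) \<Rightarrow> real^'n \<Rightarrow> complex" where
  "distr_conv T f x = T (\<lambda>y. f (x - y))"


section \<open>Convolution operators and maximizers\<close>

definition Cnv :: "real \<Rightarrow> real \<Rightarrow> ((real^'n \<Rightarrow> complex) \<Rightarrow> complex) set" where
  "Cnv p r = {T. tempered_distribution T \<and>
     (\<exists>C. \<forall>f\<in>schwartz. distr_conv T f \<in> Lp r \<and> Lp_norm r (distr_conv T f) \<le> C * Lp_norm p f)}"

definition continuous_Lp ::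
    "real \<Rightarrow> real \<Rightarrow> ((real^'n \<Rightarrow> complex) \<Rightarrow> real^'n \<Rightarrow> complex) \<Rightarrow> bool" where
  "continuous_Lp p r K \<longleftrightarrow>
     (\<forall>f\<in>Lp p. K f \<in> Lp r) \<and>
     (\<forall>f\<in>Lp p. \<forall>e>0. \<exists>d>0. \<forall>g\<in>Lp p.
        Lp_norm p (\<lambda>x. g x - f x) < d \<longrightarrow> Lp_norm r (\<lambda>x. K g x - K f x) < e)"

text \<open>The continuous extension is unique up to null sets, by density of the Schwartz functions;
  \<open>SOME\<close> picks a representative. Linearity follows from continuity and density.\<close>

definition conv_op ::
    "real \<Rightarrow> real \<Rightarrow> ((real^'n \<Rightarrow> complex) \<Rightarrow> complex) \<Rightarrow> (real^'n \<Rightarrow> complex) \<Rightarrow> real^'n \<Rightarrow> complex" where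
  "conv_op p r T = (SOME K. continuous_Lp p r K \<and>
     (\<forall>f\<in>schwartz. AE x in lebesgue. K f x = distr_conv T f x))"

definition op_norm ::
    "real \<Rightarrow> real \<Rightarrow> ((real^'n \<Rightarrow> complex) \<Rightarrow> real^'n \<Rightarrow> complex) \<Rightarrow> real" where
  "op_norm p r K = (SUP f\<in>{f \<in> Lp p. Lp_norm p f \<le> 1}. Lp_norm r (K f))"

text \<open>Membership in \<open>Cnv p r\<close> ensures that \<open>conv_op p r T\<close> is well defined.\<close>

definition is_maximizer ::
    "real \<Rightarrow> real \<Rightarrow> ((real^'n \<Rightarrow> complex) \<Rightarrow> complex) \<Rightarrow> (real^'n \<Rightarrow> complex) \<Rightarrow> bool" where
  "is_maximizer p r T f \<longleftrightarrow> T \<in> Cnv p r \<and> f \<in> Lp p \<and> Lp_norm p f = 1 \<and>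
     Lp_norm r (conv_op p r T f) = op_norm p r (conv_op p r T)"

end

theory Submission
  imports Defs "HOL-Complex_Analysis.Great_Picard"
begin

text \<open>Write \<open>T f = k * f\<close> and let \<open>M\<close> be the \<open>r\<close>-th power of the norm of \<open>T\<close>, so that
  \<open>\<integral>|T f|\<^sup>r \<le> M (\<integral>|f|\<^sup>p)\<^bsup>r/p\<^esup>\<close>. The exponent \<open>r/p\<close> exceeds \<open>1\<close>; for this reason splitting the mass of \<open>f\<close>
  into distant or otherwise unrelated pieces is wasteful, and a maximizing sequence can lose
  compactness only through translations and dilations.

  Dilations are excluded by the finiteness of \<open>s\<close>. The integral that defines the Lorentz norm converges
  at \<open>0\<close> and at infinity, so that \<open>u\<^sup>q |{|k| > u}|\<close> tends to \<open>0\<close> for small and for large \<open>u\<close>, and \<open>k\<close> is a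
  limit, in weak \<open>L\<^sub>q\<close>, of its truncations \<open>k'\<close> to the set where \<open>a < |k| \<le> U\<close>
  (\<open>lorentz_approximable\<close>). By the weak Young inequality (\<open>hls_conv\<close>) the operators \<open>T'\<close> then approximate
  \<open>T\<close> in norm, while \<open>k'\<close> is bounded and lives on a set of finite measure, hence is in every \<open>L\<^sub>a\<close>.

  Translations are used up as follows. For \<open>p < b < r\<close> the integral of \<open>|T' f|\<^sup>r\<close> is at most
  \<open>sup |T' f|\<^bsup>r-b\<^esup>\<close> times the integral of \<open>|T' f|\<^sup>b\<close>, and the latter is bounded by weak Young for other
  exponents. So \<open>|T' f|\<close> is bounded below at some point along a maximizing sequence, and this point may be
  moved to the origin (\<open>nonvanishing_maximizing_sequence\<close>). Since \<open>T' f\<close> at the origin is a pairing of \<open>f\<close>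
  with a fixed function, a weak limit of the translated sequence cannot vanish.

  It remains to turn weak into almost everywhere convergence, which the Brezis-Lieb lemma requires.
  If \<open>f\<^sub>n\<close> is bounded and weakly convergent then \<open>T' f\<^sub>n\<close> converges pointwise and, after passing to a
  subsequence, \<open>T f\<^sub>n\<close> converges almost everywhere. The functions \<open>f\<^sub>n\<close> need not do so, but one may replace
  them: if \<open>D\<close> sends a function in \<open>L\<^sub>a\<close> to the function in the dual space that realizes equality in
  Hoelder's inequality, then \<open>D T\<^sup>t D T f\<^sub>n\<close> has at least as large a quotient of norms (\<open>dual_step\<close>).
  The transposed operator \<open>T\<^sup>t\<close> is the convolution with \<open>k (-x)\<close>, so the same convergence result applies
  to it, and the new sequence \<open>F\<^sub>n\<close> and its images \<open>T F\<^sub>n\<close> converge almost everywhere, say to \<open>F\<close> and \<open>T F\<close>.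
  Let \<open>\<integral>|F\<^sub>n|\<^sup>p\<close> tend to \<open>\<alpha>\<close>, and \<open>\<beta> = \<integral>|F|\<^sup>p > 0\<close>. Brezis-Lieb in \<open>L\<^sub>p\<close> and in \<open>L\<^sub>r\<close> gives
  \<open>M \<alpha>\<^bsup>r/p\<^esup> \<le> M (\<alpha> - \<beta>)\<^bsup>r/p\<^esup> + \<integral>|T F|\<^sup>r\<close>, where the last term is at most \<open>M \<beta>\<^bsup>r/p\<^esup>\<close>. As \<open>r/p > 1\<close> this forces
  \<open>\<alpha> = \<beta>\<close> and equality, that is, \<open>F\<close> divided by its norm is a maximizer (\<open>conv_has_maximizer\<close>).

  All of this is done for Borel functions, with integrals of powers in place of norms. At the end
  Lebesgue measurable functions are replaced by Borel representatives, and the continuous extension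
  from Schwartz functions is identified with the convolution integral, by means of explicit
  smooth functions of compact support that are dense in \<open>L\<^sub>p\<close> (\<open>smooth_bump_dense\<close>).\<close>

section \<open>Weak Lebesgue spaces and the layer cake formula\<close>

lemma distr_lborel_reflect:
  fixes x :: "'a::euclidean_space"
  shows "distr lborel borel (\<lambda>y. x - y) = lborel"
  by (subst (2) lborel_affine[of "-1" x]) (auto simp: density_1 one_ennreal_def[symmetric])

lemma nn_integral_lborel_reflect:
  fixes x :: "'a::euclidean_space" and F :: "'a \<Rightarrow> ennreal"
  assumes [measurable]: "F \<in> borel_measurable borel"
  shows "(\<integral>\<^sup>+y. F (x - y) \<partial>lborel) = (\<integral>\<^sup>+y. F y \<partial>lborel)"
  by (subst (2) distr_lborel_reflect[of x, symmetric]) (simp add: nn_integral_distr)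

lemma nn_integral_lborel_translate:
  fixes x :: "'a::euclidean_space" and F :: "'a \<Rightarrow> ennreal"
  assumes [measurable]: "F \<in> borel_measurable borel"
  shows "(\<integral>\<^sup>+y. F (x + y) \<partial>lborel) = (\<integral>\<^sup>+y. F y \<partial>lborel)"
  by (subst (2) lborel_distr_plus[of x, symmetric]) (simp add: nn_integral_distr)

text \<open>The constant \<open>A\<close> bounds the \<open>q\<close>-th power of the weak \<open>L\<^sub>q\<close> quasinorm. Keeping it as a parameter makes
  the smallness of a remainder in weak \<open>L\<^sub>q\<close> directly usable.\<close>

definition weak_Lq :: "real \<Rightarrow> real \<Rightarrow> ('a::euclidean_space \<Rightarrow> complex) \<Rightarrow> bool" where
  "weak_Lq q A k \<longleftrightarrow> k \<in> borel_measurable borel \<and>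
     (\<forall>u>0. emeasure lborel {x. u < norm (k x)} \<le> ennreal (A * u powr (-q)))"

lemma weak_Lq_measurable[measurable_dest]: "weak_Lq q A k \<Longrightarrow> k \<in> borel_measurable borel"
  by (simp add: weak_Lq_def)

lemma ennreal_layer_cake:
  assumes "0 \<le> v"
  shows "ennreal v = (\<integral>\<^sup>+c. indicator {0<..<v} (c::real) \<partial>lborel)"
  using assms by simp

lemma nn_integral_powr_from_0:
  assumes "a > -1" "0 \<le> c"
  shows "(\<integral>\<^sup>+x. ennreal (x powr a) * indicator {0<..c} (x::real) \<partial>lborel) = ennreal (c powr (a+1) / (a+1))"
proof -
  have "(\<integral>\<^sup>+x. ennreal (x powr a) * indicator {0<..c} (x::real) \<partial>lborel)
     = (\<integral>\<^sup>+x\<in>{0..c}. ennreal (x powr a) \<partial>lborel)"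
    by (intro nn_integral_cong_AE AE_I[where N="{0}"]) (auto simp: indicator_def split: if_splits)
  also have "\<dots> = ennreal (c powr (a+1) / (a+1))"
    using nn_integral_has_integral_lebesgue'[OF _ has_integral_powr_from_0[OF assms]]
    by (simp add: nn_integral_completion)
  finally show ?thesis .
qed

lemma nn_integral_powr_to_inf:
  assumes "e < -1" "0 < c"
  shows "(\<integral>\<^sup>+x. ennreal (x powr e) * indicator {c<..} (x::real) \<partial>lborel) = ennreal (c powr (e+1) / -(e+1))"
proof -
  have "(\<integral>\<^sup>+x. ennreal (x powr e) * indicator {c<..} (x::real) \<partial>lborel)
     = (\<integral>\<^sup>+x\<in>{c..}. ennreal (x powr e) \<partial>lborel)"
    by (intro nn_integral_cong_AE AE_I[where N="{c}"]) (auto simp: indicator_def split: if_splits)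
  also have "\<dots> = ennreal (c powr (e+1) / -(e+1))"
    using nn_integral_has_integral_lebesgue'[OF _ has_integral_powr_to_inf[OF assms]]
    by (simp add: nn_integral_completion minus_divide_right)
  finally show ?thesis .
qed

text \<open>The part of \<open>E\<close> on which \<open>|k| > c\<close> has measure at most \<open>min e (A c\<^bsup>-q\<^esup>)\<close>. Integrate this over \<open>c\<close>; the
  integral at infinity converges because \<open>q > 1\<close>.\<close>

lemma weak_Lq_nn_integral_set_le:
  fixes k :: "'a::euclidean_space \<Rightarrow> complex"
  assumes k: "weak_Lq q A k" and "A > 0" "q > 1" and [measurable]: "E \<in> sets borel"
    and e: "emeasure lborel E \<le> ennreal e" "0 \<le> e"
  shows "(\<integral>\<^sup>+y. ennreal (norm (k y)) * indicator E y \<partial>lborel)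
     \<le> ennreal (q/(q-1) * A powr (1/q) * e powr (1 - 1/q))"
proof (cases "e = 0")
  case True
  then have "emeasure lborel E = 0" using e by simp
  then have "(\<integral>\<^sup>+y. ennreal (norm (k y)) * indicator E y \<partial>lborel) = 0"
    by (simp add: nn_integral_null_set null_setsI)
  then show ?thesis by simp
next
  case False
  with e have e0: "e > 0" by simp
  note [measurable] = weak_Lq_measurable[OF k]
  \<comment> \<open>the level at which the two bounds \<open>e\<close> and \<open>A c\<^bsup>-q\<^esup>\<close> agree\<close>
  define c0 where "c0 = (A/e) powr (1/q)"
  have c0: "c0 > 0" using e0 assms by (simp add: c0_def)
  have "(\<integral>\<^sup>+y. ennreal (norm (k y)) * indicator E y \<partial>lborel)
      = (\<integral>\<^sup>+y. (\<integral>\<^sup>+c. indicator {0<..<norm (k y)} c * indicator E y \<partial>lborel) \<partial>lborel)"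
    by (subst ennreal_layer_cake) (auto simp: nn_integral_multc)
  also have "\<dots> = (\<integral>\<^sup>+y. (\<integral>\<^sup>+c. indicator {(c,y). 0 < c \<and> c < norm (k y) \<and> y \<in> E} (c::real,y) \<partial>lborel) \<partial>lborel)"
    by (intro nn_integral_cong) (auto simp: indicator_def)
  also have "\<dots> = (\<integral>\<^sup>+c. (\<integral>\<^sup>+y. indicator {(c,y). 0 < c \<and> c < norm (k y) \<and> y \<in> E} (c::real,y) \<partial>lborel) \<partial>lborel)"
    by (rule lborel_pair.Fubini') measurable
  also have "\<dots> \<le> (\<integral>\<^sup>+c. ennreal e * indicator {0<..c0} c + ennreal A * (ennreal (c powr (-q)) * indicator {c0<..} c) \<partial>lborel)"
  proof (intro nn_integral_mono)
    fix c :: real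
    have eq: "(\<integral>\<^sup>+y. indicator {(c,y). 0 < c \<and> c < norm (k y) \<and> y \<in> E} (c,y) \<partial>lborel)
       = emeasure lborel (if 0 < c then {y. c < norm (k y)} \<inter> E else {})"
    proof (cases "0 < c")
      case True
      then show ?thesis
        by (subst nn_integral_indicator[symmetric])
          (auto intro!: nn_integral_cong simp: indicator_def simp del: nn_integral_indicator)
    qed simp
    show "(\<integral>\<^sup>+y. indicator {(c,y). 0 < c \<and> c < norm (k y) \<and> y \<in> E} (c,y) \<partial>lborel)
       \<le> ennreal e * indicator {0<..c0} c + ennreal A * (ennreal (c powr (-q)) * indicator {c0<..} c)"
    proof (cases "0 < c")
      case True
      have 1: "emeasure lborel ({y. c < norm (k y)} \<inter> E) \<le> ennreal e"
        by (rule order.trans[OF emeasure_mono e(1)]) auto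
      have "emeasure lborel ({y. c < norm (k y)} \<inter> E) \<le> emeasure lborel {y. c < norm (k y)}"
        by (rule emeasure_mono) auto
      also have "\<dots> \<le> ennreal A * ennreal (c powr (-q))"
        using k True \<open>A > 0\<close> by (simp add: weak_Lq_def flip: ennreal_mult)
      finally show ?thesis using 1 True c0 unfolding eq by (auto simp: indicator_def not_le)
    qed (simp add: eq)
  qed
  also have "\<dots> = ennreal e * ennreal c0 + ennreal A * ennreal (c0 powr (-q+1) / -(-q+1))"
    using c0 assms
    by (subst nn_integral_add) (auto simp: nn_integral_cmult nn_integral_cmult_indicator nn_integral_powr_to_inf)
  also have "\<dots> = ennreal (e * c0 + A * (c0 powr (1-q) / (q-1)))"
    using c0 assms by (simp add: ennreal_mult ennreal_plus add.commute del: times_divide_eq_right)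
  also have "e * c0 + A * (c0 powr (1-q) / (q-1)) = q/(q-1) * A powr (1/q) * e powr (1 - 1/q)"
  proof -
    have a: "e * c0 = A powr (1/q) * e powr (1 - 1/q)"
      using e0 assms by (simp add: c0_def powr_divide powr_diff)
    have "c0 powr (1-q) = (A/e) powr (1/q - 1)" using assms
      by (simp add: c0_def powr_powr field_simps)
    also have "A * \<dots> = (A * A powr (1/q - 1)) * (1 / e powr (1/q - 1))"
      using e0 assms by (simp add: powr_divide)
    also have "A * A powr (1/q - 1) = A powr (1/q)"
      using assms by (simp add: powr_mult_base)
    also have "1 / e powr (1/q - 1) = e powr (1 - 1/q)"
      using powr_minus_divide[of e "1/q - 1"] by simp
    finally have "A * c0 powr (1-q) = A powr (1/q) * e powr (1 - 1/q)" .
    with a show ?thesis using assms by (simp add: field_simps)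
  qed
  finally show ?thesis .
qed

section \<open>The weak Young inequality\<close>

lemma measurable_indicator_moving_interval [measurable (raw)]:
  fixes f g :: "'a \<Rightarrow> real"
  assumes [measurable]: "f \<in> borel_measurable M" "g \<in> borel_measurable M"
  shows "(\<lambda>z. indicator {0<..<f z} (g z) :: ennreal) \<in> borel_measurable M"
    and "(\<lambda>z. indicator {0<..f z} (g z) :: ennreal) \<in> borel_measurable M"
proof -
  have "(\<lambda>z. if 0 < g z \<and> g z < f z then 1 else 0 :: ennreal) \<in> borel_measurable M"
    "(\<lambda>z. if 0 < g z \<and> g z \<le> f z then 1 else 0 :: ennreal) \<in> borel_measurable M"
    by measurable
  then show "(\<lambda>z. indicator {0<..<f z} (g z) :: ennreal) \<in> borel_measurable M"
    "(\<lambda>z. indicator {0<..f z} (g z) :: ennreal) \<in> borel_measurable M"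
    by (auto simp: indicator_def of_bool_def)
qed

lemma nn_integral_superlevel_powr_le:
  fixes f :: "'a::euclidean_space \<Rightarrow> real"
  assumes [measurable]: "f \<in> borel_measurable borel" and "\<And>x. 0 \<le> f x" and "p > 0"
  shows "(\<integral>\<^sup>+a. ennreal (a powr (p - 1)) * indicator {0<..} a * emeasure lborel {y. a < f y} \<partial>lborel)
     \<le> ennreal (1/p) * (\<integral>\<^sup>+y. ennreal (f y powr p) \<partial>lborel)"
proof -
  have "(\<integral>\<^sup>+a. ennreal (a powr (p - 1)) * indicator {0<..} a * emeasure lborel {y. a < f y} \<partial>lborel)
    = (\<integral>\<^sup>+a. (\<integral>\<^sup>+y. ennreal (a powr (p - 1)) * indicator {(a,y). 0 < a \<and> a < f y} (a, y) \<partial>lborel) \<partial>lborel)"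
  proof (intro nn_integral_cong)
    fix a :: real
    have "emeasure lborel {y. a < f y} = (\<integral>\<^sup>+y. indicator {y. a < f y} y \<partial>lborel)" by simp
    then show "ennreal (a powr (p - 1)) * indicator {0<..} a * emeasure lborel {y. a < f y}
       = (\<integral>\<^sup>+y. ennreal (a powr (p - 1)) * indicator {(a,y). 0 < a \<and> a < f y} (a, y) \<partial>lborel)"
      by (simp only:) (subst nn_integral_cmult[symmetric], measurable, intro nn_integral_cong, auto simp: indicator_def)
  qed
  also have "\<dots> = (\<integral>\<^sup>+y. (\<integral>\<^sup>+a. ennreal (a powr (p - 1)) * indicator {(a,y). 0 < a \<and> a < f y} (a, y) \<partial>lborel) \<partial>lborel)"
    by (rule lborel_pair.Fubini') measurable
  also have "\<dots> \<le> (\<integral>\<^sup>+y. ennreal (1/p) * ennreal (f y powr p) \<partial>lborel)"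
  proof (intro nn_integral_mono)
    fix y
    have "(\<integral>\<^sup>+a. ennreal (a powr (p - 1)) * indicator {(a,y). 0 < a \<and> a < f y} (a, y) \<partial>lborel)
      \<le> (\<integral>\<^sup>+a. ennreal (a powr (p - 1)) * indicator {0<..f y} a \<partial>lborel)"
      by (intro nn_integral_mono) (auto simp: indicator_def)
    also have "\<dots> = ennreal (f y powr p / p)"
      using nn_integral_powr_from_0[of "p - 1" "f y"] assms by simp
    finally show "(\<integral>\<^sup>+a. ennreal (a powr (p - 1)) * indicator {(a,y). 0 < a \<and> a < f y} (a, y) \<partial>lborel)
      \<le> ennreal (1/p) * ennreal (f y powr p)"
      using assms by (simp flip: ennreal_mult)
  qed
  also have "\<dots> = ennreal (1/p) * (\<integral>\<^sup>+y. ennreal (f y powr p) \<partial>lborel)"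
    by (rule nn_integral_cmult) measurable
  finally show ?thesis .
qed

lemma superlevel_powr_le:
  fixes f :: "'a::euclidean_space \<Rightarrow> real"
  assumes [measurable]: "f \<in> borel_measurable borel" and nn: "\<And>x. 0 \<le> f x" and "p > 0"
    and 1: "(\<integral>\<^sup>+y. ennreal (f y powr p) \<partial>lborel) \<le> 1" and "a > 0"
  shows "emeasure lborel {y. a < f y} \<le> ennreal (a powr (-p))"
proof -
  have "emeasure lborel {y. a < f y} = (\<integral>\<^sup>+y. indicator {y. a < f y} y \<partial>lborel)" by simp
  also have "\<dots> \<le> (\<integral>\<^sup>+y. ennreal (a powr (-p)) * ennreal (f y powr p) \<partial>lborel)"
  proof (intro nn_integral_mono)
    fix y
    show "indicator {y. a < f y} y \<le> ennreal (a powr (-p)) * ennreal (f y powr p)"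
    proof (cases "a < f y")
      case True
      have "1 = a powr (-p) * a powr p" using \<open>a > 0\<close> by (simp add: powr_minus)
      also have "\<dots> \<le> a powr (-p) * f y powr p"
        using True assms by (intro mult_left_mono powr_mono2) auto
      finally show ?thesis using True by (simp add: ennreal_leI flip: ennreal_mult)
    qed simp
  qed
  also have "\<dots> = ennreal (a powr (-p)) * (\<integral>\<^sup>+y. ennreal (f y powr p) \<partial>lborel)"
    by (rule nn_integral_cmult) measurable
  also have "\<dots> \<le> ennreal (a powr (-p)) * 1"
    by (intro mult_left_mono 1) auto
  finally show ?thesis by simp
qed

lemma ennreal_mult_add_mult:
  assumes "0 \<le> a" "0 \<le> b" "0 \<le> c" "0 \<le> d"
  shows "ennreal a * ennreal b + ennreal c * ennreal d = ennreal (a * b + c * d)"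
  using assms by (simp add: ennreal_mult ennreal_plus)

text \<open>Below, \<open>r'\<close> is the exponent conjugate to \<open>r\<close>. In terms of it the relation reads
  \<open>1/p + 1/r' = 2 - 1/q\<close> and is symmetric in \<open>p\<close> and \<open>r'\<close>, as is the bilinear form that is estimated.\<close>

locale hls_exponents =
  fixes p q r :: real
  assumes p_gt1: "1 < p" and p_less_r: "p < r" and pqr: "1/p + 1/q = 1 + 1/r"
begin

lemma r_gt1: "1 < r" using p_gt1 p_less_r by simp

lemma inv_q: "1/q = 1 + 1/r - 1/p" using pqr by simp

lemma inv_q_bounds: "0 < 1/q" "1/q < 1"
proof -
  have "1/r < 1/p" "1/p < 1" using p_gt1 p_less_r by (auto simp: field_simps)
  moreover have "1/r > 0" using r_gt1 by simp
  ultimately show "0 < 1/q" "1/q < 1" using inv_q by linarith+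
qed

lemma q_gt1: "1 < q" using inv_q_bounds by (auto simp: field_simps zero_less_divide_iff split: if_splits)

definition r' where "r' = r / (r - 1)"

lemma r'_gt1: "1 < r'" using r_gt1 by (simp add: r'_def field_simps)

lemma inv_r': "1/r' = 1 - 1/r" using r_gt1 by (simp add: r'_def field_simps)

text \<open>The four facts that make the elementary integrals in \<open>hls_bilinear_normalized\<close> converge and
  produce the powers \<open>p - 1\<close> and \<open>r' - 1\<close>.\<close>

lemma theta_p: "p * (1 - 1/q) < 1"
proof -
  have "1 - 1/q < 1/p" using inv_q p_gt1 r_gt1 by (simp add: inv_q)
  then show ?thesis using p_gt1 by (simp add: field_simps)
qed

lemma theta_r': "r' * (1 - 1/q) < 1"
proof -
  have "1 - 1/q < 1/r'" using inv_q inv_r' p_gt1 by (simp add: inv_q inv_r')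
  then show ?thesis using r'_gt1 by (simp add: field_simps)
qed

lemma expo_p: "p/r' * (1 - r' * (1 - 1/q)) = p - 1"
proof -
  have "p/r' * (1 - r' * (1 - 1/q)) = p * (1/r' - (1 - 1/q))" using r'_gt1 by (simp add: field_simps)
  also have "1/r' - (1 - 1/q) = 1 - 1/p" using inv_r' inv_q by simp
  finally show ?thesis using p_gt1 by (simp add: right_diff_distrib)
qed

lemma expo_r': "r'/p * (1 - p * (1 - 1/q)) = r' - 1"
proof -
  have "r'/p * (1 - p * (1 - 1/q)) = r' * (1/p - (1 - 1/q))" using p_gt1 by (simp add: field_simps)
  also have "1/p - (1 - 1/q) = 1 - 1/r'" using inv_r' inv_q by simp
  finally show ?thesis using r'_gt1 by (simp add: right_diff_distrib)
qed

definition hls_const where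
  "hls_const = q/(q-1) * (1 / ((1 - r' * (1 - 1/q)) * p) + 1 / ((1 - p * (1 - 1/q)) * r'))"

lemma hls_const_pos: "hls_const > 0"
  unfolding hls_const_def using q_gt1 theta_p theta_r' p_gt1 r'_gt1
  by (intro mult_pos_pos add_pos_pos divide_pos_pos) auto

text \<open>Expand \<open>f\<close> and \<open>g\<close> by the layer cake formula. For superlevel sets \<open>{f > a}\<close> and \<open>{g > b}\<close> of measure \<open>v\<close>
  and \<open>w\<close>, the integral \<open>\<Phi> a b\<close> of \<open>|k (x - y)|\<close> over their product is at most a constant times
  \<open>min (v w\<^sup>\<theta>) (w v\<^sup>\<theta>)\<close> with \<open>\<theta> = 1 - 1/q\<close>. Use the first bound where \<open>b \<le> a\<^bsup>p/r'\<^esup>\<close> and the second one elsewhere,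
  and replace the factor with exponent \<open>\<theta>\<close> by Chebyshev's bound \<open>w \<le> b\<^bsup>-r'\<^esup>\<close> or \<open>v \<le> a\<^bsup>-p\<^esup>\<close>. The inner
  integral is then a power of the outer variable, namely the one for which the outer
  integral is a multiple of \<open>\<integral>f\<^sup>p\<close> or \<open>\<integral>g\<^bsup>r'\<^esup>\<close>.\<close>

lemma hls_bilinear_normalized:
  fixes f g :: "'a::euclidean_space \<Rightarrow> real"
  assumes k: "weak_Lq q A k" and A: "A > 0"
    and [measurable]: "f \<in> borel_measurable borel" "g \<in> borel_measurable borel"
    and f0: "\<And>x. 0 \<le> f x" and g0: "\<And>x. 0 \<le> g x"
    and f1: "(\<integral>\<^sup>+y. ennreal (f y powr p) \<partial>lborel) \<le> 1"
    and g1: "(\<integral>\<^sup>+x. ennreal (g x powr r') \<partial>lborel) \<le> 1"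
  shows "(\<integral>\<^sup>+x. (\<integral>\<^sup>+y. ennreal (norm (k (x - y)) * f y) \<partial>lborel) * ennreal (g x) \<partial>lborel)
    \<le> ennreal (hls_const * A powr (1/q))"
proof -
  note [measurable] = weak_Lq_measurable[OF k]
  define \<theta> where "\<theta> = 1 - 1/q"
  define D where "D = q/(q-1) * A powr (1/q)"
  have D0: "D \<ge> 0" using q_gt1 by (simp add: D_def)
  define v w where "v a = emeasure lborel {y. a < f y}" and "w b = emeasure lborel {x. b < g x}" for a b
  have [measurable]: "v \<in> borel_measurable borel" "w \<in> borel_measurable borel"
  proof -
    have "(\<lambda>a. \<integral>\<^sup>+y. indicator {(a,y). a < f y} (a,y) \<partial>lborel) \<in> borel_measurable borel"
      by measurable
    also have "(\<lambda>a. \<integral>\<^sup>+y. indicator {(a,y). a < f y} (a,y) \<partial>lborel) = v"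
      unfolding v_def by (intro ext, subst nn_integral_indicator[symmetric])
        (auto intro!: nn_integral_cong simp: indicator_def simp del: nn_integral_indicator)
    finally show "v \<in> borel_measurable borel" .
    have "(\<lambda>a. \<integral>\<^sup>+y. indicator {(a,y). a < g y} (a,y) \<partial>lborel) \<in> borel_measurable borel"
      by measurable
    also have "(\<lambda>a. \<integral>\<^sup>+y. indicator {(a,y). a < g y} (a,y) \<partial>lborel) = w"
      unfolding w_def by (intro ext, subst nn_integral_indicator[symmetric])
        (auto intro!: nn_integral_cong simp: indicator_def simp del: nn_integral_indicator)
    finally show "w \<in> borel_measurable borel" .
  qed
  define \<Phi> :: "real \<Rightarrow> real \<Rightarrow> ennreal" where
    "\<Phi> a b = (\<integral>\<^sup>+x. (\<integral>\<^sup>+y. ennreal (norm (k (x - y))) * indicator {0<..<f y} a * indicator {0<..<g x} b \<partial>lborel) \<partial>lborel)" for a b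
  have total: "(\<integral>\<^sup>+x. (\<integral>\<^sup>+y. ennreal (norm (k (x - y)) * f y) \<partial>lborel) * ennreal (g x) \<partial>lborel)
     = (\<integral>\<^sup>+a. (\<integral>\<^sup>+b. \<Phi> a b \<partial>lborel) \<partial>lborel)" (is "?L = _")
  proof -
    have "?L = (\<integral>\<^sup>+x. (\<integral>\<^sup>+y. (\<integral>\<^sup>+a. (\<integral>\<^sup>+b. ennreal (norm (k (x - y))) * indicator {0<..<f y} a * indicator {0<..<g x} b
        \<partial>lborel) \<partial>lborel) \<partial>lborel) \<partial>lborel)"
    proof (intro nn_integral_cong)
      fix x
      have "(\<integral>\<^sup>+y. (\<integral>\<^sup>+a. (\<integral>\<^sup>+b. ennreal (norm (k (x - y))) * indicator {0<..<f y} a * indicator {0<..<g x} b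
        \<partial>lborel) \<partial>lborel) \<partial>lborel) = (\<integral>\<^sup>+y. ennreal (norm (k (x - y)) * f y) * ennreal (g x) \<partial>lborel)"
        using f0 g0
        by (simp add: nn_integral_multc nn_integral_cmult ennreal_mult nn_integral_cmult_indicator)
      also have "\<dots> = (\<integral>\<^sup>+y. ennreal (norm (k (x - y)) * f y) \<partial>lborel) * ennreal (g x)"
        by (rule nn_integral_multc) measurable
      finally show "(\<integral>\<^sup>+y. ennreal (norm (k (x - y)) * f y) \<partial>lborel) * ennreal (g x) =
        (\<integral>\<^sup>+y. (\<integral>\<^sup>+a. (\<integral>\<^sup>+b. ennreal (norm (k (x - y))) * indicator {0<..<f y} a * indicator {0<..<g x} b
        \<partial>lborel) \<partial>lborel) \<partial>lborel)" by simp
    qed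
    also have "\<dots> = (\<integral>\<^sup>+x. (\<integral>\<^sup>+a. (\<integral>\<^sup>+y. (\<integral>\<^sup>+b. ennreal (norm (k (x - y))) * indicator {0<..<f y} a * indicator {0<..<g x} b
        \<partial>lborel) \<partial>lborel) \<partial>lborel) \<partial>lborel)"
      by (intro nn_integral_cong lborel_pair.Fubini') measurable
    also have "\<dots> = (\<integral>\<^sup>+a. (\<integral>\<^sup>+x. (\<integral>\<^sup>+y. (\<integral>\<^sup>+b. ennreal (norm (k (x - y))) * indicator {0<..<f y} a * indicator {0<..<g x} b
        \<partial>lborel) \<partial>lborel) \<partial>lborel) \<partial>lborel)"
      by (intro lborel_pair.Fubini') measurable
    also have "\<dots> = (\<integral>\<^sup>+a. (\<integral>\<^sup>+x. (\<integral>\<^sup>+b. (\<integral>\<^sup>+y. ennreal (norm (k (x - y))) * indicator {0<..<f y} a * indicator {0<..<g x} b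
        \<partial>lborel) \<partial>lborel) \<partial>lborel) \<partial>lborel)"
      by (intro nn_integral_cong lborel_pair.Fubini') measurable
    also have "\<dots> = (\<integral>\<^sup>+a. (\<integral>\<^sup>+b. (\<integral>\<^sup>+x. (\<integral>\<^sup>+y. ennreal (norm (k (x - y))) * indicator {0<..<f y} a * indicator {0<..<g x} b
        \<partial>lborel) \<partial>lborel) \<partial>lborel) \<partial>lborel)"
      by (intro nn_integral_cong lborel_pair.Fubini') measurable
    finally show ?thesis unfolding \<Phi>_def .
  qed
  have kernel_y: "(\<integral>\<^sup>+y. ennreal (norm (k (x - y))) * indicator {y. a < f y} y \<partial>lborel)
      \<le> ennreal (D * e powr \<theta>)" if "a > 0" "v a \<le> ennreal e" "0 \<le> e" for x a e
  proof -
    have "(\<integral>\<^sup>+y. ennreal (norm (k (x - y))) * indicator {y. a < f y} y \<partial>lborel)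
      = (\<integral>\<^sup>+y. (\<lambda>y. ennreal (norm (k y)) * indicator {y. a < f (x - y)} y) (x - y) \<partial>lborel)"
      by (simp add: indicator_def)
    also have "\<dots> = (\<integral>\<^sup>+y. ennreal (norm (k y)) * indicator {y. a < f (x - y)} y \<partial>lborel)"
      by (rule nn_integral_lborel_reflect) measurable
    also have "\<dots> \<le> ennreal (D * e powr \<theta>)" unfolding D_def \<theta>_def
    proof (rule weak_Lq_nn_integral_set_le[OF k A q_gt1])
      have "emeasure lborel {y. a < f (x - y)} = (\<integral>\<^sup>+y. (\<lambda>y. indicator {y. a < f y} y) (x - y) \<partial>lborel)"
        by (subst nn_integral_indicator[symmetric]) (auto intro!: nn_integral_cong simp: indicator_def simp del: nn_integral_indicator)
      also have "\<dots> = v a" unfolding v_def by (subst nn_integral_lborel_reflect) auto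
      finally show "emeasure lborel {y. a < f (x - y)} \<le> ennreal e" using that by simp
    qed (use that in auto)
    finally show ?thesis .
  qed
  have kernel_x: "(\<integral>\<^sup>+x. ennreal (norm (k (x - y))) * indicator {x. b < g x} x \<partial>lborel)
      \<le> ennreal (D * e powr \<theta>)" if "b > 0" "w b \<le> ennreal e" "0 \<le> e" for y b e
  proof -
    have "(\<integral>\<^sup>+x. ennreal (norm (k (x - y))) * indicator {x. b < g x} x \<partial>lborel)
      = (\<integral>\<^sup>+x. (\<lambda>x. ennreal (norm (k x)) * indicator {x. b < g (y + x)} x) (- y + x) \<partial>lborel)"
      by (simp add: indicator_def)
    also have "\<dots> = (\<integral>\<^sup>+x. ennreal (norm (k x)) * indicator {x. b < g (y + x)} x \<partial>lborel)"
      by (rule nn_integral_lborel_translate) measurable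
    also have "\<dots> \<le> ennreal (D * e powr \<theta>)" unfolding D_def \<theta>_def
    proof (rule weak_Lq_nn_integral_set_le[OF k A q_gt1])
      have "emeasure lborel {x. b < g (y + x)} = (\<integral>\<^sup>+x. (\<lambda>x. indicator {x. b < g x} x) (y + x) \<partial>lborel)"
        by (subst nn_integral_indicator[symmetric]) (auto intro!: nn_integral_cong simp: indicator_def simp del: nn_integral_indicator)
      also have "\<dots> = w b" unfolding w_def by (subst nn_integral_lborel_translate) auto
      finally show "emeasure lborel {x. b < g (y + x)} \<le> ennreal e" using that by simp
    qed (use that in auto)
    finally show ?thesis .
  qed
  have va: "v a \<le> ennreal (a powr (-p))" if "a > 0" for a
    unfolding v_def by (rule superlevel_powr_le) (use that p_gt1 f0 f1 in auto)
  have wb: "w b \<le> ennreal (b powr (-r'))" if "b > 0" for b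
    unfolding w_def by (rule superlevel_powr_le) (use that r'_gt1 g0 g1 in auto)
  have \<Phi>v: "\<Phi> a b \<le> v a * ennreal (D * b powr (- r' * \<theta>))" if "a > 0" "b > 0" for a b
  proof -
    have "\<Phi> a b = (\<integral>\<^sup>+y. (\<integral>\<^sup>+x. ennreal (norm (k (x - y))) * indicator {0<..<f y} a * indicator {0<..<g x} b \<partial>lborel) \<partial>lborel)"
      unfolding \<Phi>_def by (intro lborel_pair.Fubini') measurable
    also have "\<dots> = (\<integral>\<^sup>+y. (\<integral>\<^sup>+x. ennreal (norm (k (x - y))) * indicator {x. b < g x} x \<partial>lborel) * indicator {y. a < f y} y \<partial>lborel)"
      by (subst nn_integral_multc[symmetric], measurable, intro nn_integral_cong) (use that in \<open>auto simp: indicator_def\<close>)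
    also have "\<dots> \<le> (\<integral>\<^sup>+y. ennreal (D * (b powr (-r')) powr \<theta>) * indicator {y. a < f y} y \<partial>lborel)"
      using wb that by (intro nn_integral_mono mult_right_mono kernel_x) auto
    also have "\<dots> = v a * ennreal (D * b powr (- r' * \<theta>))"
      by (subst nn_integral_cmult_indicator, measurable) (simp add: v_def powr_powr mult.commute)
    finally show ?thesis .
  qed
  have \<Phi>w: "\<Phi> a b \<le> w b * ennreal (D * a powr (- p * \<theta>))" if "a > 0" "b > 0" for a b
  proof -
    have "\<Phi> a b = (\<integral>\<^sup>+x. (\<integral>\<^sup>+y. ennreal (norm (k (x - y))) * indicator {y. a < f y} y \<partial>lborel) * indicator {x. b < g x} x \<partial>lborel)"
      unfolding \<Phi>_def
      by (subst nn_integral_multc[symmetric], measurable, intro nn_integral_cong) (use that in \<open>auto simp: indicator_def\<close>)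
    also have "\<dots> \<le> (\<integral>\<^sup>+x. ennreal (D * (a powr (-p)) powr \<theta>) * indicator {x. b < g x} x \<partial>lborel)"
      using va that by (intro nn_integral_mono mult_right_mono kernel_y) auto
    also have "\<dots> = w b * ennreal (D * a powr (- p * \<theta>))"
      by (subst nn_integral_cmult_indicator, measurable) (simp add: w_def powr_powr mult.commute)
    finally show ?thesis .
  qed
  \<comment> \<open>the two bounds for \<open>\<Phi> a b\<close>, each cut off to its region, with the factors sorted by inner and outer variable\<close>
  define X where "X a b = (ennreal (b powr (- r' * \<theta>)) * indicator {0<..a powr (p/r')} b) * (ennreal D * v a * indicator {0<..} a)" for a b
  define Y where "Y a b = (ennreal (a powr (- p * \<theta>)) * indicator {0<..b powr (r'/p)} a) * (ennreal D * w b * indicator {0<..} b)" for a b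
  have "(\<integral>\<^sup>+a. (\<integral>\<^sup>+b. \<Phi> a b \<partial>lborel) \<partial>lborel) \<le> (\<integral>\<^sup>+a. (\<integral>\<^sup>+b. X a b + Y a b \<partial>lborel) \<partial>lborel)"
  proof (intro nn_integral_mono)
    fix a b :: real
    show "\<Phi> a b \<le> X a b + Y a b"
    proof (cases "a > 0 \<and> b > 0")
      case False
      then have "\<Phi> a b = 0" by (auto simp: \<Phi>_def)
      then show ?thesis by simp
    next
      case True
      show ?thesis
      proof (cases "b \<le> a powr (p/r')")
        case le: True
        then have "X a b = v a * ennreal (D * b powr (- r' * \<theta>))"
          using True D0 by (simp add: X_def ennreal_mult mult_ac)
        then show ?thesis using \<Phi>v[of a b] True by (simp add: add_increasing2)
      next
        case False
        then have "(a powr (p/r')) powr (r'/p) \<le> b powr (r'/p)"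
          using p_gt1 r'_gt1 True by (intro powr_mono2) auto
        then have "a \<le> b powr (r'/p)" using p_gt1 r'_gt1 True by (simp add: powr_powr)
        then have "Y a b = w b * ennreal (D * a powr (- p * \<theta>))"
          using True D0 by (simp add: Y_def ennreal_mult mult_ac)
        then show ?thesis using \<Phi>w[of a b] True by (simp add: add_increasing)
      qed
    qed
  qed
  also have "\<dots> = (\<integral>\<^sup>+a. (\<integral>\<^sup>+b. X a b \<partial>lborel) \<partial>lborel) + (\<integral>\<^sup>+a. (\<integral>\<^sup>+b. Y a b \<partial>lborel) \<partial>lborel)"
  proof -
    have [measurable]: "(\<lambda>(a,b). X a b) \<in> borel_measurable (lborel \<Otimes>\<^sub>M lborel)"
      "(\<lambda>(a,b). Y a b) \<in> borel_measurable (lborel \<Otimes>\<^sub>M lborel)"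
      unfolding X_def Y_def by measurable
    show ?thesis by (simp add: nn_integral_add)
  qed
  also have "(\<integral>\<^sup>+a. (\<integral>\<^sup>+b. Y a b \<partial>lborel) \<partial>lborel) = (\<integral>\<^sup>+b. (\<integral>\<^sup>+a. Y a b \<partial>lborel) \<partial>lborel)"
    unfolding Y_def by (intro lborel_pair.Fubini') measurable
  also have "(\<integral>\<^sup>+a. (\<integral>\<^sup>+b. X a b \<partial>lborel) \<partial>lborel)
     = (\<integral>\<^sup>+a. ennreal (D / (1 - r' * \<theta>)) * (ennreal (a powr (p - 1)) * indicator {0<..} a * v a) \<partial>lborel)"
  proof (intro nn_integral_cong)
    fix a :: real
    have "(\<integral>\<^sup>+b. X a b \<partial>lborel) = ennreal ((a powr (p/r')) powr (- r' * \<theta> + 1) / (- r' * \<theta> + 1)) * (ennreal D * v a * indicator {0<..} a)"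
      unfolding X_def using theta_r'
      by (subst nn_integral_multc) (auto simp: nn_integral_powr_from_0 \<theta>_def)
    also have "(a powr (p/r')) powr (- r' * \<theta> + 1) = a powr (p - 1)"
      using expo_p by (simp add: powr_powr \<theta>_def)
    finally show "(\<integral>\<^sup>+b. X a b \<partial>lborel) = ennreal (D / (1 - r' * \<theta>)) * (ennreal (a powr (p - 1)) * indicator {0<..} a * v a)"
      using theta_r' D0 by (simp add: \<theta>_def divide_inverse ennreal_mult' mult_ac)
  qed
  also have "\<dots> = ennreal (D / (1 - r' * \<theta>)) * (\<integral>\<^sup>+a. ennreal (a powr (p - 1)) * indicator {0<..} a * v a \<partial>lborel)"
    by (rule nn_integral_cmult) measurable
  also have "(\<integral>\<^sup>+b. (\<integral>\<^sup>+a. Y a b \<partial>lborel) \<partial>lborel)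
     = (\<integral>\<^sup>+b. ennreal (D / (1 - p * \<theta>)) * (ennreal (b powr (r' - 1)) * indicator {0<..} b * w b) \<partial>lborel)"
  proof (intro nn_integral_cong)
    fix b :: real
    have "(\<integral>\<^sup>+a. Y a b \<partial>lborel) = ennreal ((b powr (r'/p)) powr (- p * \<theta> + 1) / (- p * \<theta> + 1)) * (ennreal D * w b * indicator {0<..} b)"
      unfolding Y_def using theta_p
      by (subst nn_integral_multc) (auto simp: nn_integral_powr_from_0 \<theta>_def)
    also have "(b powr (r'/p)) powr (- p * \<theta> + 1) = b powr (r' - 1)"
      using expo_r' by (simp add: powr_powr \<theta>_def)
    finally show "(\<integral>\<^sup>+a. Y a b \<partial>lborel) = ennreal (D / (1 - p * \<theta>)) * (ennreal (b powr (r' - 1)) * indicator {0<..} b * w b)"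
      using theta_p D0 by (simp add: \<theta>_def divide_inverse ennreal_mult' mult_ac)
  qed
  also have "\<dots> = ennreal (D / (1 - p * \<theta>)) * (\<integral>\<^sup>+b. ennreal (b powr (r' - 1)) * indicator {0<..} b * w b \<partial>lborel)"
    by (rule nn_integral_cmult) measurable
  also have "ennreal (D / (1 - r' * \<theta>)) * (\<integral>\<^sup>+a. ennreal (a powr (p - 1)) * indicator {0<..} a * v a \<partial>lborel)
      + ennreal (D / (1 - p * \<theta>)) * (\<integral>\<^sup>+b. ennreal (b powr (r' - 1)) * indicator {0<..} b * w b \<partial>lborel)
     \<le> ennreal (D / (1 - r' * \<theta>)) * ennreal (1/p) + ennreal (D / (1 - p * \<theta>)) * ennreal (1/r')"
  proof (intro add_mono mult_left_mono)
    show "(\<integral>\<^sup>+a. ennreal (a powr (p - 1)) * indicator {0<..} a * v a \<partial>lborel) \<le> ennreal (1/p)"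
  proof -
    have "(\<integral>\<^sup>+a. ennreal (a powr (p - 1)) * indicator {0<..} a * v a \<partial>lborel) \<le> ennreal (1/p) * (\<integral>\<^sup>+y. ennreal (f y powr p) \<partial>lborel)"
      unfolding v_def by (rule nn_integral_superlevel_powr_le) (use f0 p_gt1 in auto)
    also have "\<dots> \<le> ennreal (1/p) * 1" by (intro mult_left_mono f1) auto
    finally show ?thesis by simp
  qed
    show "(\<integral>\<^sup>+b. ennreal (b powr (r' - 1)) * indicator {0<..} b * w b \<partial>lborel) \<le> ennreal (1/r')"
  proof -
    have "(\<integral>\<^sup>+b. ennreal (b powr (r' - 1)) * indicator {0<..} b * w b \<partial>lborel) \<le> ennreal (1/r') * (\<integral>\<^sup>+y. ennreal (g y powr r') \<partial>lborel)"
      unfolding w_def by (rule nn_integral_superlevel_powr_le) (use g0 r'_gt1 in auto)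
    also have "\<dots> \<le> ennreal (1/r') * 1" by (intro mult_left_mono g1) auto
    finally show ?thesis by simp
  qed
  qed auto
  also have "ennreal (D / (1 - r' * \<theta>)) * ennreal (1/p) + ennreal (D / (1 - p * \<theta>)) * ennreal (1/r')
     = ennreal (D / (1 - r' * \<theta>) * (1/p) + D / (1 - p * \<theta>) * (1/r'))"
    using D0 theta_p theta_r' p_gt1 r'_gt1
    by (intro ennreal_mult_add_mult) (auto simp: \<theta>_def)
  also have "D / (1 - r' * \<theta>) * (1/p) + D / (1 - p * \<theta>) * (1/r') = hls_const * A powr (1/q)"
    by (simp add: hls_const_def D_def \<theta>_def algebra_simps)
  finally show ?thesis using total by simp
qed

end

section \<open>Convolution operators on Borel functions\<close>

text \<open>Only powers of norms occur below: \<open>Lp_pow p f\<close> is the \<open>p\<close>-th power of the \<open>L\<^sub>p\<close> norm of \<open>f \<in> bLp p\<close>.\<close>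

definition bLp :: "real \<Rightarrow> ('a::euclidean_space \<Rightarrow> complex) set" where
  "bLp p = {f \<in> borel_measurable borel. integrable lborel (\<lambda>x. norm (f x) powr p)}"

definition Lp_pow :: "real \<Rightarrow> ('a::euclidean_space \<Rightarrow> complex) \<Rightarrow> real" where
  "Lp_pow p f = (LINT x|lborel. norm (f x) powr p)"

definition conv :: "('a::euclidean_space \<Rightarrow> complex) \<Rightarrow> ('a \<Rightarrow> complex) \<Rightarrow> 'a \<Rightarrow> complex" where
  "conv k f x = (LINT y|lborel. k (x - y) * f y)"

lemma bLp_measurable[measurable_dest]: "f \<in> bLp p \<Longrightarrow> f \<in> borel_measurable borel"
  by (simp add: bLp_def)

lemma bLp_integrable: "f \<in> bLp p \<Longrightarrow> integrable lborel (\<lambda>x. norm (f x) powr p)"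
  by (simp add: bLp_def)

lemma Lp_pow_nonneg: "0 \<le> Lp_pow p f"
  by (simp add: Lp_pow_def)

lemma nn_integral_Lp_pow: "f \<in> bLp p \<Longrightarrow> (\<integral>\<^sup>+x. ennreal (norm (f x) powr p) \<partial>lborel) = ennreal (Lp_pow p f)"
  unfolding Lp_pow_def by (rule nn_integral_eq_integral) (auto simp: bLp_def)

lemma bLp_I:
  assumes [measurable]: "f \<in> borel_measurable borel"
    and le: "(\<integral>\<^sup>+x. ennreal (norm (f x) powr p) \<partial>lborel) \<le> ennreal c"
  shows "f \<in> bLp p"
proof -
  have "integrable lborel (\<lambda>x. norm (f x) powr p)"
    by (rule integrableI_nonneg) (use le_less_trans[OF le] in auto)
  then show ?thesis by (simp add: bLp_def)
qed

lemma Lp_pow_le_I: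
  assumes "f \<in> borel_measurable borel" "0 \<le> c"
    and le: "(\<integral>\<^sup>+x. ennreal (norm (f x) powr p) \<partial>lborel) \<le> ennreal c"
  shows "Lp_pow p f \<le> c"
  using nn_integral_Lp_pow[OF bLp_I[OF assms(1,3)]] le assms(2) by (simp add: ennreal_le_iff)

lemma conv_measurable[measurable]:
  assumes [measurable]: "k \<in> borel_measurable borel" "f \<in> borel_measurable borel"
  shows "conv k f \<in> borel_measurable borel"
  unfolding conv_def[abs_def] by measurable

context hls_exponents
begin

lemma expo_dual: "(r - 1) * r' = r" using r_gt1 by (simp add: r'_def)

text \<open>Duality: test the bilinear inequality with \<open>g = u\<^bsup>r-1\<^esup>\<close>. Cutting \<open>u\<close> off at height \<open>N\<close> and restricting to a
  ball makes the integral \<open>\<xi>\<close> of \<open>u\<^sup>r\<close> finite, so that one may divide by a power of \<open>\<xi>\<close>; then let \<open>N\<close> tend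
  to infinity.\<close>

lemma hls_strong_normalized:
  fixes f :: "'a::euclidean_space \<Rightarrow> real"
  assumes k: "weak_Lq q A k" and A: "A > 0"
    and [measurable]: "f \<in> borel_measurable borel"
    and f0: "\<And>x. 0 \<le> f x"
    and f1: "(\<integral>\<^sup>+y. ennreal (f y powr p) \<partial>lborel) \<le> 1"
  defines "u \<equiv> \<lambda>x. \<integral>\<^sup>+y. ennreal (norm (k (x - y)) * f y) \<partial>lborel"
  shows "AE x in lborel. u x < \<infinity>"
    and "(\<integral>\<^sup>+x. ennreal (enn2real (u x) powr r) \<partial>lborel) \<le> ennreal ((hls_const * A powr (1/q)) powr r)"
proof -
  note [measurable] = weak_Lq_measurable[OF k]
  define C where "C = hls_const * A powr (1/q)"
  have C0: "C > 0" using hls_const_pos A by (simp add: C_def)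
  have [measurable]: "cball (0::'a) c \<in> sets borel" for c by simp
  have u_meas[measurable]: "u \<in> borel_measurable borel" unfolding u_def by measurable
  define m where "m N x = enn2real (min (u x) (ennreal (real N)))" for N x
  have m_meas[measurable]: "m N \<in> borel_measurable borel" for N unfolding m_def by measurable
  have m0: "0 \<le> m N x" for N x by (simp add: m_def)
  have mN: "m N x \<le> N" for N x unfolding m_def by (rule enn2real_leI) auto
  have mu: "ennreal (m N x) \<le> u x" for N x
    unfolding m_def by (subst ennreal_enn2real) (auto simp: min_less_iff_disj)
  define F where "F N x = ennreal (m N x powr r) * indicator (cball 0 (real N)) x" for N x
  have F_meas[measurable]: "F N \<in> borel_measurable borel" for N unfolding F_def by measurable
  have bound: "(\<integral>\<^sup>+x. F N x \<partial>lborel) \<le> ennreal (C powr r)" for N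
  proof -
    have "(\<integral>\<^sup>+x. F N x \<partial>lborel) \<le> (\<integral>\<^sup>+x. ennreal (real N powr r) * indicator (cball 0 (real N)) (x::'a) \<partial>lborel)"
      unfolding F_def by (intro nn_integral_mono mult_right_mono ennreal_leI powr_mono2) (use m0 mN r_gt1 in auto)
    also have "\<dots> = ennreal (real N powr r) * emeasure lborel (cball 0 (real N) :: 'a set)"
      by (rule nn_integral_cmult_indicator) simp
    also have "\<dots> < \<infinity>" using emeasure_lborel_cball_finite[of "0::'a" "real N"] by (simp add: ennreal_mult_less_top)
    finally obtain \<xi> where \<xi>: "0 \<le> \<xi>" "(\<integral>\<^sup>+x. F N x \<partial>lborel) = ennreal \<xi>"
      by (metis ennreal_cases infinity_ennreal_def less_irrefl)
    show ?thesis
    proof (cases "\<xi> = 0")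
      case False
      with \<xi> have xi0: "\<xi> > 0" by simp
      define g where "g x = m N x powr (r - 1) * \<xi> powr (-1/r') * indicat_real (cball 0 (real N)) x" for x
      have [measurable]: "g \<in> borel_measurable borel" unfolding g_def by measurable
      have g0: "0 \<le> g x" for x by (simp add: g_def)
      have "(\<integral>\<^sup>+x. ennreal (g x powr r') \<partial>lborel) = (\<integral>\<^sup>+x. ennreal (1/\<xi>) * F N x \<partial>lborel)"
      proof (intro nn_integral_cong)
        fix x
        show "ennreal (g x powr r') = ennreal (1/\<xi>) * F N x"
          using m0[of N x] xi0 r'_gt1 expo_dual
          by (auto simp: g_def F_def indicator_def powr_mult powr_divide powr_powr powr_minus_divide simp flip: ennreal_mult)
      qed
      also have "\<dots> = ennreal (1/\<xi>) * ennreal \<xi>" by (subst nn_integral_cmult) (auto simp: \<xi>)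
      also have "\<dots> = 1" using xi0 by (simp flip: ennreal_mult)
      finally have g1: "(\<integral>\<^sup>+x. ennreal (g x powr r') \<partial>lborel) \<le> 1" by simp
      have "ennreal (\<xi> powr (-1/r')) * ennreal \<xi> = (\<integral>\<^sup>+x. ennreal (\<xi> powr (-1/r')) * F N x \<partial>lborel)"
        by (subst nn_integral_cmult) (auto simp: \<xi>)
      also have "\<dots> \<le> (\<integral>\<^sup>+x. u x * ennreal (g x) \<partial>lborel)"
      proof (intro nn_integral_mono)
        fix x
        have "ennreal (\<xi> powr (-1/r')) * F N x = ennreal (m N x) * ennreal (g x)"
        proof -
          have "m N x powr r = m N x * m N x powr (r - 1)"
            using m0[of N x] by (simp add: powr_mult_base)
          then show ?thesis using m0[of N x]
            by (auto simp: F_def g_def indicator_def mult_ac simp flip: ennreal_mult)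
        qed
        also have "\<dots> \<le> u x * ennreal (g x)" by (intro mult_right_mono mu) auto
        finally show "ennreal (\<xi> powr (-1/r')) * F N x \<le> u x * ennreal (g x)" .
      qed
      also have "\<dots> \<le> ennreal C" unfolding C_def u_def
        by (rule hls_bilinear_normalized) (use k A f0 f1 g0 g1 in auto)
      finally have "\<xi> powr (-1/r') * \<xi> \<le> C" using xi0 C0 by (simp add: ennreal_le_iff flip: ennreal_mult)
      moreover have "\<xi> powr (-1/r') * \<xi> = \<xi> powr (1/r)"
        using powr_mult_base[of \<xi> "-1/r'"] xi0 inv_r' by (simp add: mult.commute)
      ultimately have "(\<xi> powr (1/r)) powr r \<le> C powr r" using r_gt1 by (intro powr_mono2) auto
      then have "\<xi> \<le> C powr r" using xi0 r_gt1 by (simp add: powr_powr)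
      then show ?thesis using \<xi> by (simp add: ennreal_leI)
    qed (use \<xi> in simp)
  qed
  have "incseq F"
  proof (intro incseq_SucI le_funI)
    fix N x
    have "m N x \<le> m (Suc N) x"
      unfolding m_def by (intro enn2real_mono min.mono ennreal_leI) (auto simp: min_less_iff_disj)
    then show "F N x \<le> F (Suc N) x" unfolding F_def
      by (intro mult_mono ennreal_leI powr_mono2) (use m0 r_gt1 in \<open>auto simp: indicator_def\<close>)
  qed
  then have "(\<integral>\<^sup>+x. (SUP N. F N x) \<partial>lborel) = (SUP N. \<integral>\<^sup>+x. F N x \<partial>lborel)"
    by (intro nn_integral_monotone_convergence_SUP) auto
  also have "\<dots> \<le> ennreal (C powr r)" using bound by (simp add: SUP_le_iff)
  finally have SUP: "(\<integral>\<^sup>+x. (SUP N. F N x) \<partial>lborel) \<le> ennreal (C powr r)" .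
  have "AE x in lborel. (SUP N. F N x) \<noteq> \<infinity>"
    using SUP by (intro nn_integral_PInf_AE) (auto simp: top_unique)
  moreover have SUP_inf: "(SUP N. F N x) = \<infinity>" if "u x = \<infinity>" for x
  proof -
    have "ennreal c \<le> (SUP N. F N x)" if "0 \<le> c" for c
    proof -
      obtain N where N: "norm x \<le> real N" "c \<le> real N" "1 \<le> real N"
        using real_arch_simple[of "max (max (norm x) c) 1"] by auto
      have "real N powr 1 \<le> real N powr r" using N r_gt1 by (intro powr_mono) auto
      then have "c \<le> real N powr r" using N by simp
      then have "ennreal c \<le> F N x" using N \<open>u x = \<infinity>\<close> by (simp add: F_def m_def ennreal_leI)
      also have "\<dots> \<le> (SUP N. F N x)" by (rule SUP_upper) auto
      finally show ?thesis .
    qed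
    then have "\<And>c. 0 \<le> c \<Longrightarrow> ennreal c < (SUP N. F N x)"
      by (metis add_increasing2 ennreal_less_iff less_add_one less_le_trans zero_le_one)
    then show ?thesis by (metis ennreal_cases infinity_ennreal_def less_irrefl)
  qed
  ultimately show "AE x in lborel. u x < \<infinity>"
    by (elim eventually_mono) (metis infinity_ennreal_def less_top)
  have "ennreal (enn2real (u x) powr r) \<le> (SUP N. F N x)" for x
  proof (cases "u x = \<infinity>")
    case True
    then show ?thesis by (simp only: SUP_inf) simp
  next
    case False
    obtain N where N: "norm x \<le> real N" "enn2real (u x) \<le> real N"
      using real_arch_simple[of "max (norm x) (enn2real (u x))"] by auto
    have "u x \<le> ennreal (real N)"
      using False N by (simp add: le_ennreal_iff less_top)
        (metis enn2real_nonneg ennreal_enn2real infinity_ennreal_def less_top)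
    then have "ennreal (enn2real (u x) powr r) = F N x" using N by (simp add: F_def m_def min_absorb1)
    also have "\<dots> \<le> (SUP N. F N x)" by (rule SUP_upper) auto
    finally show ?thesis .
  qed
  then have "(\<integral>\<^sup>+x. ennreal (enn2real (u x) powr r) \<partial>lborel) \<le> (\<integral>\<^sup>+x. (SUP N. F N x) \<partial>lborel)"
    by (rule nn_integral_mono)
  also note SUP
  finally show "(\<integral>\<^sup>+x. ennreal (enn2real (u x) powr r) \<partial>lborel) \<le> ennreal ((hls_const * A powr (1/q)) powr r)"
    by (simp add: C_def)
qed

lemma bLp_normalize:
  assumes f: "f \<in> bLp p'" and "p' > 0" "\<sigma> > 0" "Lp_pow p' f \<le> \<sigma> powr p'"
  shows "(\<integral>\<^sup>+y. ennreal ((norm (f y) / \<sigma>) powr p') \<partial>lborel) \<le> 1"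
proof -
  note [measurable] = bLp_measurable[OF f]
  have "(\<integral>\<^sup>+y. ennreal ((norm (f y) / \<sigma>) powr p') \<partial>lborel)
     = (\<integral>\<^sup>+y. ennreal (1 / \<sigma> powr p') * ennreal (norm (f y) powr p') \<partial>lborel)"
    using assms by (intro nn_integral_cong) (simp add: powr_divide flip: ennreal_mult)
  also have "\<dots> = ennreal (1 / \<sigma> powr p' * Lp_pow p' f)"
    using Lp_pow_nonneg[of p' f] by (subst nn_integral_cmult) (auto simp: nn_integral_Lp_pow[OF f] simp flip: ennreal_mult)
  also have "\<dots> \<le> ennreal 1" using assms by (intro ennreal_leI) (simp add: field_simps)
  finally show ?thesis by simp
qed

text \<open>The scale \<open>\<sigma>\<close> is any positive upper bound of the norm of \<open>f\<close>, which avoids a separate treatment of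
  functions of norm \<open>0\<close>.\<close>

lemma hls_scaled:
  assumes k: "weak_Lq q A k" and A: "A > 0" and f: "f \<in> bLp p" and l: "\<sigma> > 0" "Lp_pow p f \<le> \<sigma> powr p"
  shows "AE x in lborel. integrable lborel (\<lambda>y. k (x - y) * f y)"
    and "(\<integral>\<^sup>+x. ennreal (norm (conv k f x) powr r) \<partial>lborel) \<le> ennreal ((\<sigma> * (hls_const * A powr (1/q))) powr r)"
proof -
  note [measurable] = weak_Lq_measurable[OF k] bLp_measurable[OF f]
  define C where "C = hls_const * A powr (1/q)"
  have C0: "C > 0" using hls_const_pos A by (simp add: C_def)
  define u where "u = (\<lambda>x. \<integral>\<^sup>+y. ennreal (norm (k (x - y)) * (norm (f y) / \<sigma>)) \<partial>lborel)"
  have [measurable]: "u \<in> borel_measurable borel" unfolding u_def by measurable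
  have fm: "(\<lambda>y. norm (f y) / \<sigma>) \<in> borel_measurable borel" by measurable
  have f1: "(\<integral>\<^sup>+y. ennreal ((norm (f y) / \<sigma>) powr p) \<partial>lborel) \<le> 1"
    using bLp_normalize[OF f _ l] p_gt1 by simp
  have 1: "AE x in lborel. u x < \<infinity>" and 2: "(\<integral>\<^sup>+x. ennreal (enn2real (u x) powr r) \<partial>lborel) \<le> ennreal (C powr r)"
    using hls_strong_normalized[OF k A fm _ f1] l by (auto simp: u_def C_def)
  have u: "(\<integral>\<^sup>+y. ennreal (norm (k (x - y) * f y)) \<partial>lborel) = ennreal \<sigma> * u x" for x
    unfolding u_def using l
    by (subst nn_integral_cmult[symmetric]) (auto intro!: nn_integral_cong simp: norm_mult simp flip: ennreal_mult)
  have int: "integrable lborel (\<lambda>y. k (x - y) * f y)" if "u x < \<infinity>" for x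
    using u[of x] that by (intro integrableI_bounded) (auto simp: ennreal_mult_less_top)
  then show "AE x in lborel. integrable lborel (\<lambda>y. k (x - y) * f y)" using 1 by auto
  have "norm (conv k f x) \<le> \<sigma> * enn2real (u x)" if "u x < \<infinity>" for x
  proof -
    have "norm (conv k f x) \<le> (LINT y|lborel. norm (k (x - y) * f y))"
      unfolding conv_def by (rule integral_norm_bound)
    also have "\<dots> = enn2real (\<integral>\<^sup>+y. ennreal (norm (k (x - y) * f y)) \<partial>lborel)"
      by (rule integral_eq_nn_integral) auto
    also have "\<dots> = \<sigma> * enn2real (u x)" unfolding u using l by (simp add: enn2real_mult)
    finally show ?thesis .
  qed
  then have "(\<integral>\<^sup>+x. ennreal (norm (conv k f x) powr r) \<partial>lborel)
     \<le> (\<integral>\<^sup>+x. ennreal (\<sigma> powr r) * ennreal (enn2real (u x) powr r) \<partial>lborel)"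
    using 1 l r_gt1
    by (intro nn_integral_mono_AE)
      (auto elim!: eventually_mono simp flip: ennreal_mult powr_mult intro!: ennreal_leI powr_mono2)
  also have "\<dots> = ennreal (\<sigma> powr r) * (\<integral>\<^sup>+x. ennreal (enn2real (u x) powr r) \<partial>lborel)"
    by (rule nn_integral_cmult) measurable
  also have "\<dots> \<le> ennreal (\<sigma> powr r) * ennreal (C powr r)"
    by (intro mult_left_mono 2) auto
  also have "\<dots> = ennreal ((\<sigma> * C) powr r)" using l C0 by (simp add: powr_mult ennreal_mult)
  finally show "(\<integral>\<^sup>+x. ennreal (norm (conv k f x) powr r) \<partial>lborel) \<le> ennreal ((\<sigma> * (hls_const * A powr (1/q))) powr r)"
    by (simp add: C_def)
qed

lemma conv_integrable_AE:
  assumes "weak_Lq q A k" "A > 0" "f \<in> bLp p"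
  shows "AE x in lborel. integrable lborel (\<lambda>y. k (x - y) * f y)"
proof (rule hls_scaled(1)[OF assms])
  show "Lp_pow p f \<le> ((Lp_pow p f + 1) powr (1/p)) powr p"
    using Lp_pow_nonneg[of p f] p_gt1 by (simp add: powr_powr)
qed (use Lp_pow_nonneg[of p f] in auto)

lemma hls_conv:
  assumes k: "weak_Lq q A k" and A: "A > 0" and f: "f \<in> bLp p"
  shows "conv k f \<in> bLp r"
    and "Lp_pow r (conv k f) \<le> (hls_const * A powr (1/q)) powr r * Lp_pow p f powr (r/p)"
proof -
  note [measurable] = weak_Lq_measurable[OF k] bLp_measurable[OF f]
  define C where "C = hls_const * A powr (1/q)"
  have C0: "C > 0" using hls_const_pos A by (simp add: C_def)
  define P where "P = Lp_pow p f"
  have P0: "0 \<le> P" by (simp add: P_def Lp_pow_nonneg)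
  have m: "conv k f \<in> borel_measurable borel" by measurable
  have *: "(\<integral>\<^sup>+x. ennreal (norm (conv k f x) powr r) \<partial>lborel) \<le> ennreal (C powr r * \<mu> powr (r/p))"
    if "\<mu> > 0" "P \<le> \<mu>" for \<mu>
    using hls_scaled(2)[OF k A f, of "\<mu> powr (1/p)"] that p_gt1 C0
    by (simp add: powr_powr powr_mult P_def C_def mult.commute)
  show "conv k f \<in> bLp r" by (rule bLp_I[OF m *[of "P + 1"]]) (use P0 in auto)
  have **: "Lp_pow r (conv k f) \<le> C powr r * \<mu> powr (r/p)" if "\<mu> > 0" "P \<le> \<mu>" for \<mu>
    by (rule Lp_pow_le_I[OF m _ *]) (use that in auto)
  have "Lp_pow r (conv k f) \<le> C powr r * P powr (r/p)"
  proof (cases "P = 0")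
    case False then show ?thesis using **[of P] P0 by simp
  next
    case True
    have "((\<lambda>\<mu>. C powr r * \<mu> powr (r/p)) \<longlongrightarrow> C powr r * 0 powr (r/p)) (at_right 0)"
      using p_gt1 r_gt1 by (intro tendsto_intros) (auto simp: eventually_at_filter)
    then have "Lp_pow r (conv k f) \<le> C powr r * 0 powr (r/p)"
      by (rule tendsto_lowerbound) (use ** True in \<open>auto simp: eventually_at_filter\<close>)
    then show ?thesis using True by simp
  qed
  then show "Lp_pow r (conv k f) \<le> (hls_const * A powr (1/q)) powr r * Lp_pow p f powr (r/p)"
    by (simp add: C_def P_def)
qed

lemma hls_bilinear_finite:
  assumes k: "weak_Lq q A k" and A: "A > 0" and f: "f \<in> bLp p" and g: "g \<in> bLp r'"
  shows "(\<integral>\<^sup>+x. (\<integral>\<^sup>+y. ennreal (norm (k (x - y) * f y * g x)) \<partial>lborel) \<partial>lborel) < \<infinity>"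
proof -
  note [measurable] = weak_Lq_measurable[OF k] bLp_measurable[OF f] bLp_measurable[OF g]
  define \<sigma> \<mu> where "\<sigma> = (Lp_pow p f + 1) powr (1/p)" and "\<mu> = (Lp_pow r' g + 1) powr (1/r')"
  have pos: "\<sigma> > 0" "\<mu> > 0" using Lp_pow_nonneg[of p f] Lp_pow_nonneg[of r' g] by (auto simp: \<sigma>_def \<mu>_def)
  have f1: "(\<integral>\<^sup>+y. ennreal ((norm (f y) / \<sigma>) powr p) \<partial>lborel) \<le> 1"
    by (rule bLp_normalize[OF f]) (use Lp_pow_nonneg[of p f] p_gt1 pos in \<open>auto simp: \<sigma>_def powr_powr\<close>)
  have g1: "(\<integral>\<^sup>+y. ennreal ((norm (g y) / \<mu>) powr r') \<partial>lborel) \<le> 1"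
    by (rule bLp_normalize[OF g]) (use Lp_pow_nonneg[of r' g] r'_gt1 pos in \<open>auto simp: \<mu>_def powr_powr\<close>)
  have "(\<integral>\<^sup>+x. (\<integral>\<^sup>+y. ennreal (norm (k (x - y) * f y * g x)) \<partial>lborel) \<partial>lborel)
    = (\<integral>\<^sup>+x. ennreal (\<sigma> * \<mu>) * ((\<integral>\<^sup>+y. ennreal (norm (k (x - y)) * (norm (f y) / \<sigma>)) \<partial>lborel) * ennreal (norm (g x) / \<mu>)) \<partial>lborel)"
  proof (intro nn_integral_cong)
    fix x
    have "(\<integral>\<^sup>+y. ennreal (norm (k (x - y) * f y * g x)) \<partial>lborel)
      = (\<integral>\<^sup>+y. ennreal (norm (k (x - y)) * (norm (f y) / \<sigma>)) * (ennreal (\<sigma> * \<mu>) * ennreal (norm (g x) / \<mu>)) \<partial>lborel)"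
      using pos by (intro nn_integral_cong) (simp add: norm_mult flip: ennreal_mult)
    also have "\<dots> = (\<integral>\<^sup>+y. ennreal (norm (k (x - y)) * (norm (f y) / \<sigma>)) \<partial>lborel) * (ennreal (\<sigma> * \<mu>) * ennreal (norm (g x) / \<mu>))"
      by (rule nn_integral_multc) measurable
    finally show "(\<integral>\<^sup>+y. ennreal (norm (k (x - y) * f y * g x)) \<partial>lborel)
      = ennreal (\<sigma> * \<mu>) * ((\<integral>\<^sup>+y. ennreal (norm (k (x - y)) * (norm (f y) / \<sigma>)) \<partial>lborel) * ennreal (norm (g x) / \<mu>))"
      by (simp add: mult_ac)
  qed
  also have "\<dots> = ennreal (\<sigma> * \<mu>) * (\<integral>\<^sup>+x. (\<integral>\<^sup>+y. ennreal (norm (k (x - y)) * (norm (f y) / \<sigma>)) \<partial>lborel) * ennreal (norm (g x) / \<mu>) \<partial>lborel)"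
    by (rule nn_integral_cmult) measurable
  also have "\<dots> \<le> ennreal (\<sigma> * \<mu>) * ennreal (hls_const * A powr (1/q))"
    by (intro mult_left_mono hls_bilinear_normalized[OF k A _ _ _ _ f1 g1]) (use pos in auto)
  also have "\<dots> < \<infinity>" by (simp add: ennreal_mult_less_top)
  finally show ?thesis .
qed

definition reflect :: "('a::euclidean_space \<Rightarrow> complex) \<Rightarrow> 'a \<Rightarrow> complex" where "reflect k x = k (- x)"

text \<open>Convolution with the reflected kernel is the transposed operator. Fubini's theorem applies since the
  weak Young inequality for \<open>|k|\<close>, \<open>|f|\<close>, \<open>|g|\<close> gives absolute integrability.\<close>

lemma conv_pairing:
  assumes k: "weak_Lq q A k" and A: "A > 0" and f: "f \<in> bLp p" and g: "g \<in> bLp r'"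
  shows "(LINT x|lborel. conv k f x * g x) = (LINT y|lborel. f y * conv (reflect k) g y)"
proof -
  note [measurable] = weak_Lq_measurable[OF k] bLp_measurable[OF f] bLp_measurable[OF g]
  have int: "integrable (lborel \<Otimes>\<^sub>M lborel) (\<lambda>(x, y). k (x - y) * f y * g x)"
  proof (rule integrableI_bounded)
    have "(\<integral>\<^sup>+z. ennreal (norm (case z of (x, y) \<Rightarrow> k (x - y) * f y * g x)) \<partial>(lborel \<Otimes>\<^sub>M lborel))
      = (\<integral>\<^sup>+x. (\<integral>\<^sup>+y. ennreal (norm (k (x - y) * f y * g x)) \<partial>lborel) \<partial>lborel)"
      by (subst lborel.nn_integral_fst[symmetric]) auto
    then show "(\<integral>\<^sup>+z. ennreal (norm (case z of (x, y) \<Rightarrow> k (x - y) * f y * g x)) \<partial>(lborel \<Otimes>\<^sub>M lborel)) < \<infinity>"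
      using hls_bilinear_finite[OF assms] by simp
  qed measurable
  have "(LINT x|lborel. conv k f x * g x) = (LINT x|lborel. (LINT y|lborel. k (x - y) * f y * g x))"
    by (simp add: conv_def)
  also have "\<dots> = (LINT y|lborel. (LINT x|lborel. k (x - y) * f y * g x))"
    using lborel_pair.Fubini_integral[OF int] by simp
  also have "\<dots> = (LINT y|lborel. (LINT x|lborel. f y * (k (x - y) * g x)))"
    by (simp add: mult_ac)
  also have "\<dots> = (LINT y|lborel. f y * conv (reflect k) g y)"
    by (simp add: conv_def reflect_def)
  finally show ?thesis .
qed

end

section \<open>Inequalities and convergence theorems for p-th powers\<close>

lemma powr_add_le:
  fixes a b p :: real
  assumes "0 \<le> a" "0 \<le> b" "0 \<le> p"
  shows "(a + b) powr p \<le> 2 powr p * (a powr p + b powr p)"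
proof -
  have "(a + b) powr p \<le> (2 * max a b) powr p"
    using assms by (intro powr_mono2) auto
  also have "\<dots> = 2 powr p * max a b powr p" using assms by (simp add: powr_mult)
  also have "max a b powr p \<le> a powr p + b powr p" by (simp add: max_def)
  finally show ?thesis by simp
qed

lemma norm_add_powr_le:
  fixes a b :: complex
  assumes "0 \<le> p"
  shows "norm (a + b) powr p \<le> 2 powr p * (norm a powr p + norm b powr p)"
    and "norm (a - b) powr p \<le> 2 powr p * (norm a powr p + norm b powr p)"
proof -
  have "norm (a + b) powr p \<le> (norm a + norm b) powr p"
    using assms by (intro powr_mono2 norm_triangle_ineq) auto
  also note powr_add_le[OF norm_ge_zero norm_ge_zero assms]
  finally show "norm (a + b) powr p \<le> 2 powr p * (norm a powr p + norm b powr p)" .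
  have "norm (a - b) powr p \<le> (norm a + norm b) powr p"
    using assms by (intro powr_mono2 norm_triangle_ineq4) auto
  also note powr_add_le[OF norm_ge_zero norm_ge_zero assms]
  finally show "norm (a - b) powr p \<le> 2 powr p * (norm a powr p + norm b powr p)" .
qed

lemma bLp_dominated:
  assumes "f \<in> borel_measurable borel" "integrable lborel h" "AE x in lborel. norm (f x) powr p \<le> h x"
  shows "f \<in> bLp p" "Lp_pow p f \<le> integral\<^sup>L lborel h"
proof -
  have "integrable lborel (\<lambda>x. norm (f x) powr p)"
    using assms by (intro Bochner_Integration.integrable_bound[OF assms(2)]) auto
  then show "f \<in> bLp p" "Lp_pow p f \<le> integral\<^sup>L lborel h"
    using assms by (auto simp: bLp_def Lp_pow_def intro!: integral_mono_AE)
qed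

lemma
  assumes "f \<in> bLp p" "g \<in> bLp p" "0 \<le> p"
  shows bLp_add: "(\<lambda>x. f x + g x) \<in> bLp p"
    and bLp_diff: "(\<lambda>x. f x - g x) \<in> bLp p"
    and Lp_pow_add_le: "Lp_pow p (\<lambda>x. f x + g x) \<le> 2 powr p * (Lp_pow p f + Lp_pow p g)"
    and Lp_pow_diff_le: "Lp_pow p (\<lambda>x. f x - g x) \<le> 2 powr p * (Lp_pow p f + Lp_pow p g)"
proof -
  note [measurable] = bLp_measurable[OF assms(1)] bLp_measurable[OF assms(2)]
  have i: "integrable lborel (\<lambda>x. 2 powr p * (norm (f x) powr p + norm (g x) powr p))"
    using assms by (intro Bochner_Integration.integrable_add integrable_mult_right bLp_integrable)
  have e: "(LINT x|lborel. 2 powr p * (norm (f x) powr p + norm (g x) powr p)) = 2 powr p * (Lp_pow p f + Lp_pow p g)"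
    using assms by (simp add: Lp_pow_def bLp_integrable)
  show "(\<lambda>x. f x + g x) \<in> bLp p" "Lp_pow p (\<lambda>x. f x + g x) \<le> 2 powr p * (Lp_pow p f + Lp_pow p g)"
    using bLp_dominated[OF _ i, of "\<lambda>x. f x + g x" p] norm_add_powr_le[OF assms(3)] e by auto
  show "(\<lambda>x. f x - g x) \<in> bLp p" "Lp_pow p (\<lambda>x. f x - g x) \<le> 2 powr p * (Lp_pow p f + Lp_pow p g)"
    using bLp_dominated[OF _ i, of "\<lambda>x. f x - g x" p] norm_add_powr_le[OF assms(3)] e by auto
qed

lemma Lp_pow_cmult: "Lp_pow p (\<lambda>x. c * f x) = norm c powr p * Lp_pow p f"
  by (simp add: Lp_pow_def norm_mult powr_mult)

lemma bLp_cmult: "f \<in> bLp p \<Longrightarrow> (\<lambda>x. c * f x) \<in> bLp p"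
  by (auto simp: bLp_def norm_mult powr_mult)

lemma bLp_zero: "(\<lambda>x. 0) \<in> bLp p"
  by (simp add: bLp_def)

lemma Lp_pow_cong_AE:
  assumes [measurable]: "f \<in> borel_measurable borel" "g \<in> borel_measurable borel"
    and "AE x in lborel. f x = g x"
  shows "Lp_pow p f = Lp_pow p g"
  unfolding Lp_pow_def by (intro integral_cong_AE) (use assms in auto)

lemma bLp_Fatou:
  assumes f: "\<And>n. f n \<in> bLp p" and [measurable]: "g \<in> borel_measurable borel"
    and lim: "AE x in lborel. (\<lambda>n. f n x) \<longlonglongrightarrow> g x"
    and B: "\<And>n. Lp_pow p (f n) \<le> B" and p: "p > 0"
  shows "g \<in> bLp p" "Lp_pow p g \<le> B"
proof -
  have [measurable]: "f n \<in> borel_measurable borel" for n using f by (rule bLp_measurable)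
  have B0: "0 \<le> B" using B[of 0] Lp_pow_nonneg[of p "f 0"] by simp
  have "(\<integral>\<^sup>+x. ennreal (norm (g x) powr p) \<partial>lborel) = (\<integral>\<^sup>+x. liminf (\<lambda>n. ennreal (norm (f n x) powr p)) \<partial>lborel)"
  proof (rule nn_integral_cong_AE, use lim in eventually_elim)
    case (elim x)
    have "(\<lambda>n. ennreal (norm (f n x) powr p)) \<longlonglongrightarrow> ennreal (norm (g x) powr p)"
      using p by (intro tendsto_ennrealI tendsto_powr' tendsto_norm elim tendsto_const) auto
    then show ?case by (metis lim_imp_Liminf sequentially_bot)
  qed
  also have "\<dots> \<le> liminf (\<lambda>n. \<integral>\<^sup>+x. ennreal (norm (f n x) powr p) \<partial>lborel)"
    by (rule nn_integral_liminf) measurable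
  also have "\<dots> = liminf (\<lambda>n. ennreal (Lp_pow p (f n)))"
    by (simp add: nn_integral_Lp_pow[OF f])
  also have "\<dots> \<le> liminf (\<lambda>n. ennreal B)"
    by (intro Liminf_mono) (auto intro!: always_eventually ennreal_leI B)
  finally have *: "(\<integral>\<^sup>+x. ennreal (norm (g x) powr p) \<partial>lborel) \<le> ennreal B"
    by (simp add: Liminf_const)
  show "g \<in> bLp p" by (rule bLp_I[OF _ *]) simp
  show "Lp_pow p g \<le> B" by (rule Lp_pow_le_I[OF _ B0 *]) simp
qed

lemma Lp_pow_dominated_convergence:
  fixes f :: "'a::euclidean_space \<Rightarrow> complex"
  assumes [measurable]: "\<And>n. F n \<in> borel_measurable borel" "f \<in> borel_measurable borel"
    and G: "G \<in> bLp p" and le: "\<And>n x. norm (F n x) \<le> norm (G x)"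
    and lim: "\<And>x. (\<lambda>n. F n x) \<longlonglongrightarrow> f x" and p: "p > 0"
  shows "(\<lambda>n. Lp_pow p (\<lambda>x. F n x - f x)) \<longlonglongrightarrow> 0"
proof -
  have lef: "norm (f x) \<le> norm (G x)" for x
    by (rule tendsto_upperbound[OF tendsto_norm[OF lim]]) (use le in auto)
  have "(\<lambda>n. LINT x|lborel. norm (F n x - f x) powr p) \<longlonglongrightarrow> (LINT x|(lborel :: 'a measure). 0)"
  proof (rule integral_dominated_convergence)
    show "integrable lborel (\<lambda>x. 2 powr p * norm (G x) powr p)"
      by (intro integrable_mult_right bLp_integrable G)
    show "AE x in lborel. (\<lambda>n. norm (F n x - f x) powr p) \<longlonglongrightarrow> 0"
    proof (intro AE_I2)
      fix x
      have "(\<lambda>n. norm (F n x - f x) powr p) \<longlonglongrightarrow> norm (f x - f x) powr p"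
        using p by (intro tendsto_powr' tendsto_norm tendsto_diff lim tendsto_const) auto
      then show "(\<lambda>n. norm (F n x - f x) powr p) \<longlonglongrightarrow> 0" by simp
    qed
    fix n
    show "AE x in lborel. norm (norm (F n x - f x) powr p) \<le> 2 powr p * norm (G x) powr p"
    proof (intro AE_I2)
      fix x
      have "norm (F n x - f x) \<le> 2 * norm (G x)"
        using norm_triangle_ineq4[of "F n x" "f x"] le[of n x] lef[of x] by simp
      then have "norm (F n x - f x) powr p \<le> (2 * norm (G x)) powr p"
        using p by (intro powr_mono2) auto
      then show "norm (norm (F n x - f x) powr p) \<le> 2 powr p * norm (G x) powr p"
        by (simp add: powr_mult)
    qed
  qed measurable
  then show ?thesis by (simp add: Lp_pow_def)
qed

lemma bLp_Young_integrable:
  assumes f: "f \<in> bLp p" and g: "g \<in> bLp p'" and "p > 1" "p' > 1" "1/p + 1/p' = 1"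
  shows "integrable lborel (\<lambda>x. f x * g x)"
    and "norm (LINT x|lborel. f x * g x) \<le> Lp_pow p f / p + Lp_pow p' g / p'"
proof -
  note [measurable] = bLp_measurable[OF f] bLp_measurable[OF g]
  have i: "integrable lborel (\<lambda>x. norm (f x) powr p / p + norm (g x) powr p' / p')"
    using f g by (intro Bochner_Integration.integrable_add integrable_divide_zero bLp_integrable)
  have le: "norm (f x * g x) \<le> norm (f x) powr p / p + norm (g x) powr p' / p'" for x
    using Youngs_inequality[of p p' "norm (f x)" "norm (g x)"] assms by (simp add: norm_mult)
  show int: "integrable lborel (\<lambda>x. f x * g x)"
    by (rule Bochner_Integration.integrable_bound[OF i]) (use le in \<open>auto intro: order.trans[OF _ abs_ge_self]\<close>)
  have "norm (LINT x|lborel. f x * g x) \<le> (LINT x|lborel. norm (f x * g x))"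
    by (rule integral_norm_bound)
  also have "\<dots> \<le> (LINT x|lborel. norm (f x) powr p / p + norm (g x) powr p' / p')"
    by (intro integral_mono le integrable_norm int i)
  also have "\<dots> = Lp_pow p f / p + Lp_pow p' g / p'"
    using f g by (simp add: Lp_pow_def bLp_integrable)
  finally show "norm (LINT x|lborel. f x * g x) \<le> Lp_pow p f / p + Lp_pow p' g / p'" .
qed

text \<open>Young's inequality applied to \<open>f/u\<close> and \<open>g/v\<close>, for \<open>u\<close> and \<open>v\<close> slightly larger than the norms so that
  they are positive.\<close>

lemma bLp_Hoelder:
  assumes f: "f \<in> bLp p" and g: "g \<in> bLp p'" and p: "p > 1" "p' > 1" "1/p + 1/p' = 1"
  shows "norm (LINT x|lborel. f x * g x) \<le> Lp_pow p f powr (1/p) * Lp_pow p' g powr (1/p')"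
proof -
  define a b where "a = Lp_pow p f powr (1/p)" and "b = Lp_pow p' g powr (1/p')"
  have ab: "0 \<le> a" "0 \<le> b" by (auto simp: a_def b_def)
  have fa: "Lp_pow p f = a powr p" "Lp_pow p' g = b powr p'"
    using p Lp_pow_nonneg[of p f] Lp_pow_nonneg[of p' g] by (auto simp: a_def b_def powr_powr)
  have *: "norm (LINT x|lborel. f x * g x) \<le> u * v" if uv: "u > 0" "v > 0" "a \<le> u" "b \<le> v" for u v
  proof -
    have "norm (LINT x|lborel. (of_real (1/u) * f x) * (of_real (1/v) * g x))
      \<le> Lp_pow p (\<lambda>x. of_real (1/u) * f x) / p + Lp_pow p' (\<lambda>x. of_real (1/v) * g x) / p'"
      by (intro bLp_Young_integrable bLp_cmult f g p)
    also have "(LINT x|lborel. (of_real (1/u) * f x) * (of_real (1/v) * g x))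
       = of_real (1/(u * v)) * (LINT x|lborel. f x * g x)"
      by (subst integral_mult_right_zero[symmetric]) (simp add: mult_ac)
    also have "Lp_pow p (\<lambda>x. of_real (1/u) * f x) \<le> 1"
      unfolding Lp_pow_cmult fa using uv p ab by (auto simp: norm_divide powr_divide divide_simps intro!: powr_mono2)
    also have "Lp_pow p' (\<lambda>x. of_real (1/v) * g x) \<le> 1"
      unfolding Lp_pow_cmult fa using uv p ab by (auto simp: norm_divide powr_divide divide_simps intro!: powr_mono2)
    finally have "norm (LINT x|lborel. f x * g x) / (u * v) \<le> 1/p + 1/p'"
      using p uv by (simp add: norm_mult norm_divide divide_right_mono)
    then show ?thesis using p uv by (simp add: field_simps)
  qed
  have "((\<lambda>e. (a + e) * (b + e)) \<longlongrightarrow> (a + 0) * (b + 0)) (at_right 0)"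
    by (intro tendsto_intros)
  then have "norm (LINT x|lborel. f x * g x) \<le> (a + 0) * (b + 0)"
    by (rule tendsto_lowerbound) (use ab * in \<open>auto simp: eventually_at_filter\<close>)
  then show ?thesis by (simp add: a_def b_def)
qed

text \<open>If \<open>|b|\<close> is small compared with \<open>|a|\<close>, the left-hand side is a small multiple of \<open>|a|\<^sup>p\<close> by continuity of
  the power at \<open>1\<close>; otherwise all terms are comparable with \<open>|b|\<^sup>p\<close>.\<close>

lemma powr_brezis_lieb:
  assumes p: "p > 0" and e: "\<epsilon> > 0"
  obtains C where "C \<ge> 0" "\<And>a b :: complex. \<bar>norm (a + b) powr p - norm a powr p\<bar> \<le> \<epsilon> * norm a powr p + C * norm b powr p"
proof -
  have "((\<lambda>d. (1 + d) powr p - 1) \<longlongrightarrow> (1 + 0) powr p - 1) (at_right (0::real))"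
    "((\<lambda>d. 1 - (1 - d) powr p) \<longlongrightarrow> 1 - (1 - 0) powr p) (at_right (0::real))"
    by (intro tendsto_intros; simp)+
  then have "\<forall>\<^sub>F d in at_right (0::real). (1 + d) powr p - 1 < \<epsilon>" "\<forall>\<^sub>F d in at_right (0::real). 1 - (1 - d) powr p < \<epsilon>"
    using e by (auto dest: order_tendstoD(2))
  moreover have "\<forall>\<^sub>F d in at_right (0::real). 0 < d \<and> d < 1"
    by (auto simp: eventually_at_right_field intro!: exI[of _ 1])
  ultimately have "\<forall>\<^sub>F d in at_right (0::real). 0 < d \<and> d < 1 \<and> (1 + d) powr p - 1 < \<epsilon> \<and> 1 - (1 - d) powr p < \<epsilon>"
    by eventually_elim auto
  then obtain d :: real where d: "0 < d" "d < 1" "(1 + d) powr p - 1 < \<epsilon>" "1 - (1 - d) powr p < \<epsilon>"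
    using eventually_happens'[OF trivial_limit_at_right_real] by blast
  define C where "C = (1/d + 1) powr p"
  show thesis
  proof (rule that[of C])
    show "C \<ge> 0" by (simp add: C_def)
    fix a b :: complex
    show "\<bar>norm (a + b) powr p - norm a powr p\<bar> \<le> \<epsilon> * norm a powr p + C * norm b powr p"
    proof (cases "norm b \<le> d * norm a")
      case True
      have "norm (a + b) \<le> (1 + d) * norm a"
        using True norm_triangle_ineq[of a b] by (simp add: algebra_simps)
      then have "norm (a + b) powr p \<le> ((1 + d) * norm a) powr p" using p by (intro powr_mono2) auto
      then have 1: "norm (a + b) powr p \<le> (1 + d) powr p * norm a powr p" using d by (simp add: powr_mult)
      have "(1 - d) * norm a \<le> norm (a + b)"
        using True norm_diff_ineq[of a b] by (simp add: algebra_simps)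
      then have "((1 - d) * norm a) powr p \<le> norm (a + b) powr p" using p d by (intro powr_mono2) auto
      then have 2: "(1 - d) powr p * norm a powr p \<le> norm (a + b) powr p" using d by (simp add: powr_mult)
      have "((1 + d) powr p - 1) * norm a powr p \<le> \<epsilon> * norm a powr p"
        "(1 - (1 - d) powr p) * norm a powr p \<le> \<epsilon> * norm a powr p"
        using d by (auto intro!: mult_right_mono)
      with 1 2 have "\<bar>norm (a + b) powr p - norm a powr p\<bar> \<le> \<epsilon> * norm a powr p"
        by (auto simp: algebra_simps abs_le_iff)
      then show ?thesis by (simp add: C_def add_increasing2)
    next
      case False
      then have a: "norm a \<le> (1/d) * norm b" using d by (simp add: field_simps)
      then have "norm (a + b) \<le> (1/d + 1) * norm b"
        using norm_triangle_ineq[of a b] by (simp add: algebra_simps)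
      then have "norm (a + b) powr p \<le> ((1/d + 1) * norm b) powr p" using p by (intro powr_mono2) auto
      moreover have "norm a powr p \<le> ((1/d + 1) * norm b) powr p"
        using p a by (intro powr_mono2) (auto simp: algebra_simps intro: add_increasing)
      moreover have "((1/d + 1) * norm b) powr p = C * norm b powr p" using d by (simp add: powr_mult C_def)
      ultimately have "\<bar>norm (a + b) powr p - norm a powr p\<bar> \<le> C * norm b powr p"
        by (smt (verit) powr_ge_zero)
      then show ?thesis using e by (simp add: add_increasing)
    qed
  qed
qed

text \<open>The common core of the next two results. The part \<open>(|h\<^sub>n| - \<epsilon> F\<^sub>n)\<^sup>+\<close> is dominated by \<open>G\<close> and tends to \<open>0\<close>;
  what is left has integral at most \<open>\<epsilon> B\<close>.\<close>

lemma integral_tendsto_0_by_splitting: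
  fixes h F :: "nat \<Rightarrow> 'a \<Rightarrow> real"
  assumes h: "\<And>n. integrable M (h n)" and lim: "AE x in M. (\<lambda>n. h n x) \<longlonglongrightarrow> 0"
    and F: "\<And>n. integrable M (F n)" "\<And>n. (LINT x|M. F n x) \<le> B" "\<And>n x. 0 \<le> F n x"
    and split: "\<And>\<epsilon>. \<epsilon> > 0 \<Longrightarrow>
      \<exists>G. integrable M G \<and> (\<forall>x. 0 \<le> G x) \<and> (\<forall>n x. \<bar>h n x\<bar> \<le> \<epsilon> * F n x + G x)"
  shows "(\<lambda>n. LINT x|M. \<bar>h n x\<bar>) \<longlonglongrightarrow> 0"
proof (rule LIMSEQ_I)
  fix e :: real assume e: "0 < e"
  have B0: "B \<ge> 0" by (rule order.trans[OF _ F(2)[of 0]]) (simp add: F(3))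
  define \<epsilon> where "\<epsilon> = e / (2 * (B + 1))"
  have eps: "\<epsilon> > 0" "\<epsilon> * (B + 1) = e / 2" using e B0 by (auto simp: \<epsilon>_def field_simps)
  obtain G where G: "integrable M G" "\<And>x. 0 \<le> G x" "\<And>n x. \<bar>h n x\<bar> \<le> \<epsilon> * F n x + G x"
    using split[OF eps(1)] by blast
  define W where "W n x = max 0 (\<bar>h n x\<bar> - \<epsilon> * F n x)" for n x
  have Wint: "integrable M (W n)" for n unfolding W_def using h F(1) by simp
  have Wh: "0 \<le> W n x" "W n x \<le> \<bar>h n x\<bar>" for n x using F(3)[of n x] eps by (auto simp: W_def)
  have "(\<lambda>n. LINT x|M. W n x) \<longlonglongrightarrow> (LINT x|M. 0)"
  proof (rule integral_dominated_convergence[OF _ _ G(1)])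
    show "AE x in M. (\<lambda>n. W n x) \<longlonglongrightarrow> 0"
      using lim
    proof eventually_elim
      case (elim x)
      show ?case
        by (rule tendsto_sandwich[OF _ _ tendsto_const tendsto_rabs_zero[OF elim]])
          (auto intro!: always_eventually Wh)
    qed
    show "AE x in M. norm (W n x) \<le> G x" for n
      using G(2,3) by (intro AE_I2) (auto simp: W_def algebra_simps)
  qed (use Wint in auto)
  then have "\<forall>\<^sub>F n in sequentially. (LINT x|M. W n x) < e/2"
    using e by (intro order_tendstoD(2)) auto
  then obtain N where N: "\<And>n. n \<ge> N \<Longrightarrow> (LINT x|M. W n x) < e/2"
    by (auto simp: eventually_sequentially)
  show "\<exists>N. \<forall>n\<ge>N. norm ((LINT x|M. \<bar>h n x\<bar>) - 0) < e"
  proof (intro exI allI impI)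
    fix n assume n: "n \<ge> N"
    have "(LINT x|M. \<bar>h n x\<bar>) \<le> (LINT x|M. W n x + \<epsilon> * F n x)"
      using h Wint F(1) by (intro integral_mono) (auto simp: W_def)
    also have "\<dots> = (LINT x|M. W n x) + \<epsilon> * (LINT x|M. F n x)" using Wint F(1) by simp
    also have "\<dots> < e/2 + \<epsilon> * (B + 1)"
      using N[OF n] F(2)[of n] eps(1) by (intro add_less_le_mono mult_left_mono) auto
    finally show "norm ((LINT x|M. \<bar>h n x\<bar>) - 0) < e" using eps(2) by simp
  qed
qed

text \<open>This quantifies what is lost in Fatou's lemma: the missing mass is exactly that of \<open>f\<^sub>n - g\<close>.\<close>

lemma brezis_lieb:
  fixes f :: "nat \<Rightarrow> 'a::euclidean_space \<Rightarrow> complex"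
  assumes f: "\<And>n. f n \<in> bLp p" and g: "g \<in> bLp p" and p: "p > 0"
    and lim: "AE x in lborel. (\<lambda>n. f n x) \<longlonglongrightarrow> g x" and B: "\<And>n. Lp_pow p (f n) \<le> B"
  shows "(\<lambda>n. Lp_pow p (f n) - Lp_pow p (\<lambda>x. f n x - g x)) \<longlonglongrightarrow> Lp_pow p g"
proof -
  have fg: "(\<lambda>x. f n x - g x) \<in> bLp p" for n using p by (intro bLp_diff f g) auto
  have B': "Lp_pow p (\<lambda>x. f n x - g x) \<le> 2 powr p * (B + Lp_pow p g)" for n
  proof -
    have "Lp_pow p (\<lambda>x. f n x - g x) \<le> 2 powr p * (Lp_pow p (f n) + Lp_pow p g)"
      using p by (intro Lp_pow_diff_le f g) auto
    also have "\<dots> \<le> 2 powr p * (B + Lp_pow p g)" using B[of n] by (intro mult_left_mono) auto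
    finally show ?thesis .
  qed
  define h where "h n x = norm (f n x) powr p - norm (f n x - g x) powr p - norm (g x) powr p" for n x
  have hint: "integrable lborel (h n)" for n unfolding h_def
    by (intro Bochner_Integration.integrable_diff bLp_integrable f g fg)
  have "(\<lambda>n. LINT x|lborel. \<bar>h n x\<bar>) \<longlonglongrightarrow> 0"
  proof (rule integral_tendsto_0_by_splitting[where F = "\<lambda>n x. norm (f n x - g x) powr p"])
    show "AE x in lborel. (\<lambda>n. h n x) \<longlonglongrightarrow> 0"
      using lim
    proof eventually_elim
      case (elim x)
      have "(\<lambda>n. h n x) \<longlonglongrightarrow> norm (g x) powr p - norm (g x - g x) powr p - norm (g x) powr p"
        unfolding h_def using p by (intro tendsto_intros elim tendsto_powr') auto
      then show ?case by simp
    qed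
    show "(LINT x|lborel. norm (f n x - g x) powr p) \<le> 2 powr p * (B + Lp_pow p g)" for n
      using B' by (simp add: Lp_pow_def)
    fix \<epsilon> :: real assume eps: "\<epsilon> > 0"
    obtain C where C: "C \<ge> 0" "\<And>a b :: complex. \<bar>norm (a + b) powr p - norm a powr p\<bar> \<le> \<epsilon> * norm a powr p + C * norm b powr p"
      using powr_brezis_lieb[OF p eps] by metis
    have "\<bar>h n x\<bar> \<le> \<epsilon> * norm (f n x - g x) powr p + (C + 1) * norm (g x) powr p" for n x
      using C(2)[of "f n x - g x" "g x"]
        abs_triangle_ineq4[of "norm (f n x) powr p - norm (f n x - g x) powr p" "norm (g x) powr p"]
      by (auto simp: h_def algebra_simps)
    then show "\<exists>G. integrable lborel G \<and> (\<forall>x. 0 \<le> G x) \<and> (\<forall>n x. \<bar>h n x\<bar> \<le> \<epsilon> * norm (f n x - g x) powr p + G x)"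
      using C(1) by (intro exI[of _ "\<lambda>x. (C + 1) * norm (g x) powr p"] conjI integrable_mult_right bLp_integrable g) auto
  qed (use hint fg in \<open>auto intro: bLp_integrable\<close>)
  then have "(\<lambda>n. LINT x|lborel. h n x) \<longlonglongrightarrow> 0"
    by (rule Lim_null_comparison[rotated]) (auto intro!: always_eventually integral_abs_bound)
  moreover have "(LINT x|lborel. h n x) = Lp_pow p (f n) - Lp_pow p (\<lambda>x. f n x - g x) - Lp_pow p g" for n
    unfolding h_def Lp_pow_def using f g fg by (simp add: bLp_integrable)
  ultimately show ?thesis by (simp add: LIM_zero_iff)
qed

lemma AE_lim_imp_weak_null:
  fixes f :: "nat \<Rightarrow> 'a::euclidean_space \<Rightarrow> complex"
  assumes f: "\<And>n. f n \<in> bLp p" and g: "g \<in> bLp p'" and p: "p > 1" "p' > 1" "1/p + 1/p' = 1"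
    and lim: "AE x in lborel. (\<lambda>n. f n x) \<longlonglongrightarrow> 0" and B: "\<And>n. Lp_pow p (f n) \<le> B"
  shows "(\<lambda>n. LINT x|lborel. f n x * g x) \<longlonglongrightarrow> 0"
proof -
  have "(\<lambda>n. LINT x|lborel. \<bar>norm (f n x * g x)\<bar>) \<longlonglongrightarrow> 0"
  proof (rule integral_tendsto_0_by_splitting[where F = "\<lambda>n x. norm (f n x) powr p"])
    show "integrable lborel (\<lambda>x. norm (f n x * g x))" for n
      by (intro integrable_norm bLp_Young_integrable[OF f g p])
    show "AE x in lborel. (\<lambda>n. norm (f n x * g x)) \<longlonglongrightarrow> 0"
      using lim by eventually_elim (intro tendsto_norm_zero tendsto_mult_left_zero)
    show "(LINT x|lborel. norm (f n x) powr p) \<le> B" for n using B by (simp add: Lp_pow_def)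
    fix \<epsilon> :: real assume eps: "\<epsilon> > 0"
    define \<eta> where "\<eta> = \<epsilon> powr (1/p)"
    have eta: "\<eta> > 0" "\<eta> powr p = \<epsilon>" using eps p by (auto simp: \<eta>_def powr_powr)
    have "norm (f n x * g x) \<le> \<epsilon> * norm (f n x) powr p + (1/\<eta>) powr p' * norm (g x) powr p'" for n x
    proof -
      have "norm (f n x * g x) = (\<eta> * norm (f n x)) * ((1/\<eta>) * norm (g x))" using eta by (simp add: norm_mult)
      also have "\<dots> \<le> (\<eta> * norm (f n x)) powr p / p + ((1/\<eta>) * norm (g x)) powr p' / p'"
        using eta p by (intro Youngs_inequality) auto
      also have "\<dots> \<le> (\<eta> * norm (f n x)) powr p + ((1/\<eta>) * norm (g x)) powr p'"
        using p by (intro add_mono) (auto simp: divide_le_eq intro: order.trans[OF _ mult_left_mono[of 1]])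
      finally show ?thesis using eta by (simp add: powr_mult powr_divide)
    qed
    then show "\<exists>G. integrable lborel G \<and> (\<forall>x. 0 \<le> G x) \<and> (\<forall>n x. \<bar>norm (f n x * g x)\<bar> \<le> \<epsilon> * norm (f n x) powr p + G x)"
      by (intro exI[of _ "\<lambda>x. (1/\<eta>) powr p' * norm (g x) powr p'"] conjI integrable_mult_right bLp_integrable g) auto
  qed (use f in \<open>auto intro: bLp_integrable\<close>)
  then show ?thesis
    by (rule Lim_null_comparison[rotated]) (auto intro!: always_eventually integral_norm_bound)
qed

section \<open>Density of step functions\<close>

text \<open>Open boxes with rational corners: countably many, so that a diagonal argument can run over them.\<close>

definition ratbox :: "'a::euclidean_space set set" where
  "ratbox = {box a b |a b. \<forall>i\<in>Basis. a \<bullet> i \<in> \<rat> \<and> b \<bullet> i \<in> \<rat>}"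

lemma countable_rational_vectors: "countable {a::'a::euclidean_space. \<forall>i\<in>Basis. a \<bullet> i \<in> \<rat>}"
proof (rule countable_image_inj_on)
  show "countable ((\<lambda>a::'a. restrict ((\<bullet>) a) Basis) ` {a. \<forall>i\<in>Basis. a \<bullet> i \<in> \<rat>})"
    by (rule countable_subset[where B = "Basis \<rightarrow>\<^sub>E \<rat>"]) (auto intro!: countable_PiE countable_rat)
  show "inj_on (\<lambda>a::'a. restrict ((\<bullet>) a) Basis) {a. \<forall>i\<in>Basis. a \<bullet> i \<in> \<rat>}"
    by (rule inj_onI, rule euclidean_eqI) (metis restrict_apply')
qed

lemma countable_ratbox: "countable (ratbox :: 'a::euclidean_space set set)"
proof -
  have "(ratbox :: 'a set set) \<subseteq> (\<lambda>(a,b). box a b) ` ({a. \<forall>i\<in>Basis. a \<bullet> i \<in> \<rat>} \<times> {a. \<forall>i\<in>Basis. a \<bullet> i \<in> \<rat>})"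
    by (auto simp: ratbox_def)
  then show ?thesis
    by (rule countable_subset) (intro countable_image countable_SIGMA countable_rational_vectors)
qed

lemma ratbox_Int: "A \<in> ratbox \<Longrightarrow> B \<in> ratbox \<Longrightarrow> A \<inter> B \<in> (ratbox :: 'a::euclidean_space set set)"
proof -
  assume "A \<in> ratbox" "B \<in> ratbox"
  then obtain a b c d where *: "A = box a b" "B = box c d"
    "\<forall>i\<in>Basis. a \<bullet> i \<in> \<rat> \<and> b \<bullet> i \<in> \<rat> \<and> c \<bullet> i \<in> \<rat> \<and> d \<bullet> i \<in> \<rat>"
    by (auto simp: ratbox_def)
  define e f where "e = (\<Sum>i\<in>Basis. max (a \<bullet> i) (c \<bullet> i) *\<^sub>R i)" and "f = (\<Sum>i\<in>Basis. min (b \<bullet> i) (d \<bullet> i) *\<^sub>R i)"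
  have "A \<inter> B = box e f" unfolding * e_def f_def by (auto simp: box_def)
  moreover have "\<forall>i\<in>Basis. e \<bullet> i \<in> \<rat> \<and> f \<bullet> i \<in> \<rat>" using * by (auto simp: e_def f_def max_def min_def)
  ultimately show ?thesis unfolding ratbox_def by blast
qed

lemma sigma_sets_ratbox: "sigma_sets UNIV ratbox = sets (borel :: 'a::euclidean_space measure)"
proof (rule antisym)
  show "sigma_sets UNIV ratbox \<subseteq> sets (borel :: 'a measure)"
    by (rule sets.sigma_sets_subset[of _ borel, simplified]) (auto simp: ratbox_def)
  show "sets borel \<subseteq> sigma_sets UNIV (ratbox :: 'a set set)"
    unfolding borel_def
  proof (subst sets_measure_of, simp, rule sigma_sets_mono, safe)
    fix M :: "'a set" assume "open M"
    have "M = \<Union>{B \<in> ratbox. B \<subseteq> M}"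
    proof safe
      fix x assume "x \<in> M"
      then obtain e where e: "e > 0" "ball x e \<subseteq> M" using openE[OF \<open>open M\<close>] by auto
      obtain a b where "x \<in> box a b" "\<forall>i\<in>Basis. a \<bullet> i \<in> \<rat>" "\<forall>i\<in>Basis. b \<bullet> i \<in> \<rat>" "box a b \<subseteq> ball x e"
        using rational_boxes[OF e(1)] by metis
      then show "x \<in> \<Union>{B \<in> ratbox. B \<subseteq> M}" using e by (intro UnionI[of "box a b"]) (auto simp: ratbox_def)
    qed auto
    moreover have "\<Union>{B \<in> ratbox. B \<subseteq> M} \<in> sigma_sets UNIV (ratbox :: 'a set set)"
      by (rule sigma_sets_UNION) (auto intro: countable_subset[OF _ countable_ratbox])
    ultimately show "M \<in> sigma_sets UNIV ratbox" by simp
  qed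
qed

lemma bLp_indicator:
  assumes [measurable]: "A \<in> sets borel" and "emeasure lborel A < \<infinity>"
  shows "indicator A \<in> bLp p"
proof (rule bLp_dominated(1))
  show "integrable lborel (indicat_real A)" using assms by simp
qed (auto simp: indicator_def)

text \<open>A property stable under linear combinations and \<open>L\<^sub>p\<close> limits holds on all of \<open>L\<^sub>p\<close> once it holds for
  indicators of rational boxes. Inside a fixed large box a Dynkin argument gives all Borel sets (the large
  box makes complements and countable unions have finite measure). Exhaustion gives all sets of finite
  measure, hence simple functions, and every function is a dominated limit of simple ones.\<close>

lemma bLp_density_induct:
  fixes f :: "'a::euclidean_space \<Rightarrow> complex"
  assumes f: "f \<in> bLp p" and p: "p > 0"
    and box: "\<And>B. B \<in> ratbox \<Longrightarrow> P (indicator B)"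
    and scale: "\<And>c f. f \<in> bLp p \<Longrightarrow> P f \<Longrightarrow> P (\<lambda>x. c * f x)"
    and add: "\<And>f g. f \<in> bLp p \<Longrightarrow> g \<in> bLp p \<Longrightarrow> P f \<Longrightarrow> P g \<Longrightarrow> P (\<lambda>x. f x + g x)"
    and lim: "\<And>f F. (\<And>n. F n \<in> bLp p) \<Longrightarrow> (\<And>n. P (F n)) \<Longrightarrow> f \<in> bLp p \<Longrightarrow>
       (\<lambda>n. Lp_pow p (\<lambda>x. F n x - f x)) \<longlonglongrightarrow> 0 \<Longrightarrow> P f"
  shows "P f"
proof -
  define c :: "nat \<Rightarrow> 'a set" where "c N = box (- (real N *\<^sub>R One)) (real N *\<^sub>R One)" for N
  have c: "c N \<in> ratbox" for N
    unfolding ratbox_def c_def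
    by (rule CollectI, rule exI[of _ "- (real N *\<^sub>R One)"], rule exI[of _ "real N *\<^sub>R One"]) simp
  have boxfin: "A \<in> sets borel \<and> emeasure lborel A < \<infinity>" if "A \<in> ratbox" for A :: "'a set"
    using that emeasure_lborel_box_finite by (auto simp: ratbox_def less_top)
  note cfin = boxfin[OF c]
  have cm[measurable]: "c N \<in> sets borel" for N using cfin by simp
  have zero: "P (\<lambda>x. 0)"
    using scale[OF bLp_indicator box[OF c[of 0]], of 0] cfin by simp
  have lim_dom: "P g" if "\<And>n. F n \<in> bLp p" "\<And>n. P (F n)" "g \<in> borel_measurable borel" "G \<in> bLp p"
     "\<And>n x. norm (F n x) \<le> norm (G x)" "\<And>x. (\<lambda>n. F n x) \<longlonglongrightarrow> g x" for F g G
  proof (rule lim[of F])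
    show "(\<lambda>n. Lp_pow p (\<lambda>x. F n x - g x)) \<longlonglongrightarrow> 0"
      by (rule Lp_pow_dominated_convergence[OF bLp_measurable[OF that(1)] that(3,4,5,6) p])
    have "norm (g x) \<le> norm (G x)" for x
      by (rule tendsto_upperbound[OF tendsto_norm[OF that(6)]]) (use that in auto)
    then show "g \<in> bLp p"
      by (intro bLp_dominated(1)[OF that(3) bLp_integrable[OF that(4)]] AE_I2 powr_mono2) (use p in auto)
  qed (use that in auto)
  have stable: "Int_stable (ratbox :: 'a set set)" and sub: "(ratbox :: 'a set set) \<subseteq> Pow UNIV"
    by (auto simp: Int_stable_def intro: ratbox_Int)
  have bounded_set: "P (indicator (A \<inter> c N))" if "A \<in> sigma_sets UNIV ratbox" for A N
    using stable sub that
  proof (induction rule: sigma_sets_induct_disjoint)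
    case (basic A)
    then show ?case by (intro box ratbox_Int c)
  next
    case empty
    then show ?case using zero by (simp add: indicator_def[abs_def])
  next
    case (compl A)
    have A[measurable]: "A \<in> sets borel" using compl(1) by (simp add: sigma_sets_ratbox)
    have fin: "emeasure lborel (A \<inter> c N) < \<infinity>"
      by (rule le_less_trans[OF emeasure_mono]) (use cfin[of N] in auto)
    have "P (\<lambda>x. indicator (c N) x + (-1) * indicator (A \<inter> c N) x)"
      by (intro add scale bLp_cmult bLp_indicator box c compl(2)) (use fin cfin in auto)
    also have "(\<lambda>x. indicator (c N) x + (-1) * indicator (A \<inter> c N) x) = (indicator ((UNIV - A) \<inter> c N) :: 'a \<Rightarrow> complex)"
      by (auto simp: indicator_def)
    finally show ?case .
  next
    case (union A)
    have A[measurable]: "A i \<in> sets borel" for i using union(2) by (auto simp: sigma_sets_ratbox)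
    have fin: "emeasure lborel (B \<inter> c N) < \<infinity>" if "B \<in> sets borel" for B
      by (rule le_less_trans[OF emeasure_mono]) (use cfin[of N] that in auto)
    have part: "P (indicator ((\<Union>i<n. A i) \<inter> c N))" for n
    proof (induction n)
      case 0 then show ?case using zero by (simp add: indicator_def[abs_def])
    next
      case (Suc n)
      have "P (\<lambda>x. indicator ((\<Union>i<n. A i) \<inter> c N) x + indicator (A n \<inter> c N) x)"
        by (intro add bLp_indicator Suc union(3)) (use fin in auto)
      also have "(\<lambda>x. indicator ((\<Union>i<n. A i) \<inter> c N) x + indicator (A n \<inter> c N) x) = (indicator ((\<Union>i<Suc n. A i) \<inter> c N) :: 'a \<Rightarrow> complex)"
      proof
        fix x
        have "x \<notin> A n" if "x \<in> A i" "i < n" for i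
          using disjoint_family_onD[OF union(1), of i n] that by auto
        then show "indicator ((\<Union>i<n. A i) \<inter> c N) x + indicator (A n \<inter> c N) x = (indicator ((\<Union>i<Suc n. A i) \<inter> c N) x :: complex)"
          by (auto simp: indicator_def less_Suc_eq)
      qed
      finally show ?case .
    qed
    show ?case
    proof (rule lim_dom[OF _ part _ bLp_indicator])
      show "indicator ((\<Union>i<n. A i) \<inter> c N) \<in> bLp p" for n by (rule bLp_indicator) (use fin in auto)
      show "c N \<in> sets borel" "emeasure lborel (c N) < \<infinity>" using cfin by auto
      show "(\<lambda>n. indicator ((\<Union>i<n. A i) \<inter> c N) x :: complex) \<longlonglongrightarrow> indicator ((\<Union>i. A i) \<inter> c N) x" for x
      proof (cases "x \<in> (\<Union>i. A i) \<inter> c N")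
        case True
        then obtain i where i: "x \<in> A i" "x \<in> c N" by auto
        have "\<forall>\<^sub>F n in sequentially. (indicator ((\<Union>i<n. A i) \<inter> c N) x :: complex) = 1"
          using eventually_gt_at_top[of i] by eventually_elim (use i in \<open>auto simp: indicator_def\<close>)
        then show ?thesis using True by (simp add: tendsto_eventually)
      next
        case False
        then have "(indicator ((\<Union>i<n. A i) \<inter> c N) x :: complex) = 0" for n by (auto simp: indicator_def)
        then show ?thesis using False by simp
      qed
    qed (auto simp: indicator_def)
  qed
  have set: "P (indicator A)" if A[measurable]: "A \<in> sets borel" and fin: "emeasure lborel A < \<infinity>" for A
  proof (rule lim_dom[OF _ _ _ bLp_indicator[OF that]])
    show "P (indicator (A \<inter> c N))" for N by (rule bounded_set) (simp add: sigma_sets_ratbox)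
    show "indicator (A \<inter> c N) \<in> bLp p" for N
      by (rule bLp_indicator, simp, rule le_less_trans[OF emeasure_mono fin]) auto
    show "(\<lambda>n. indicator (A \<inter> c n) x :: complex) \<longlonglongrightarrow> indicator A x" for x
    proof -
      obtain N :: nat where N: "norm x < real N" using reals_Archimedean2 by blast
      have "x \<in> c n" if "n \<ge> N" for n
      proof -
        have "\<bar>x \<bullet> i\<bar> < real n" if "i \<in> Basis" for i
          using Basis_le_norm[OF that, of x] N \<open>n \<ge> N\<close> by simp
        then show ?thesis by (force simp: c_def box_def abs_less_iff)
      qed
      then have "\<forall>\<^sub>F n in sequentially. (indicator (A \<inter> c n) x :: complex) = indicator A x"
        by (intro eventually_sequentiallyI[of N]) (auto simp: indicator_def)
      then show ?thesis by (simp add: tendsto_eventually)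
    qed
  qed (auto simp: indicator_def)
  have simple: "P s" if s: "simple_function lborel s" "s \<in> bLp p" for s
  proof -
    have fin: "finite (range s)" using simple_functionD(1)[OF s(1)] by simp
    note [measurable] = bLp_measurable[OF s(2)]
    define T where "T S x = (\<Sum>y\<in>S. y * indicator (s -` {y}) x)" for S x
    have "T S \<in> bLp p \<and> P (T S)" if "finite S" "S \<subseteq> range s" for S
      using that
    proof (induction S rule: finite_induct)
      case empty
      then show ?case using zero bLp_zero by (simp add: T_def[abs_def])
    next
      case (insert y S)
      have "(\<lambda>x. y * indicator (s -` {y}) x) \<in> bLp p \<and> P (\<lambda>x. y * indicator (s -` {y}) x)"
      proof (cases "y = 0")
        case True then show ?thesis using zero bLp_zero by simp
      next
        case False
        have m[measurable]: "s -` {y} \<in> sets borel" using measurable_sets[OF bLp_measurable[OF s(2)], of "{y}"] by simp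
        have "emeasure lborel (s -` {y}) = (\<integral>\<^sup>+x. indicator (s -` {y}) x \<partial>lborel)" by simp
        also have "\<dots> \<le> (\<integral>\<^sup>+x. ennreal (1 / norm y powr p) * ennreal (norm (s x) powr p) \<partial>lborel)"
          using False by (intro nn_integral_mono) (auto simp: indicator_def simp flip: ennreal_mult)
        also have "\<dots> = ennreal (1 / norm y powr p) * ennreal (Lp_pow p s)"
          by (subst nn_integral_cmult) (auto simp: nn_integral_Lp_pow[OF s(2)])
        also have "\<dots> < \<infinity>" by (simp add: ennreal_mult_less_top)
        finally have "emeasure lborel (s -` {y}) < \<infinity>" .
        then show ?thesis by (intro conjI scale bLp_cmult set bLp_indicator m)
      qed
      moreover have "T (insert y S) = (\<lambda>x. y * indicator (s -` {y}) x + T S x)"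
        by (intro ext) (simp only: T_def sum.insert[OF insert(1,2)])
      ultimately show ?case using insert p by (auto intro!: add bLp_add)
    qed
    from this[OF fin order.refl] have "P (T (range s))" ..
    also have "T (range s) = s"
    proof
      fix x
      have "T (range s) x = (\<Sum>y\<in>range s. if y = s x then y else 0)"
        unfolding T_def by (intro sum.cong) (auto simp: indicator_def)
      then show "T (range s) x = s x" using fin by simp
    qed
    finally show ?thesis .
  qed
  obtain F where F: "\<And>i. simple_function lborel (F i)" "\<And>x. (\<lambda>i. F i x) \<longlonglongrightarrow> f x" "\<And>i x. norm (F i x) \<le> 2 * norm (f x)"
    using borel_measurable_implies_sequence_metric[of f lborel 0] bLp_measurable[OF f] by auto
  have Fm: "F i \<in> borel_measurable borel" for i using borel_measurable_simple_function[OF F(1)] by simp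
  have Fb: "F i \<in> bLp p" for i
  proof (rule bLp_dominated(1)[OF Fm bLp_integrable[OF bLp_cmult[OF f, of 2]]])
    show "AE x in lborel. norm (F i x) powr p \<le> norm (2 * f x) powr p"
      using F(3) p by (intro AE_I2 powr_mono2) (auto simp: norm_mult)
  qed
  show "P f"
    by (rule lim_dom[OF Fb simple[OF F(1) Fb] bLp_measurable[OF f] bLp_cmult[OF f, of 2] _ F(2)])
      (use F(3) in \<open>auto simp: norm_mult\<close>)
qed

section \<open>Duality maps and approximable kernels\<close>

text \<open>The function \<open>dual_map s \<circ> f\<close> realizes equality in Hoelder's inequality with \<open>f\<close> in \<open>L\<^sub>s\<close>. The factor \<open>sgn u\<close>
  is \<open>0\<close> at \<open>u = 0\<close>, which makes the map continuous for \<open>s > 1\<close>.\<close>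

definition dual_map :: "real \<Rightarrow> complex \<Rightarrow> complex" where
  "dual_map s u = cnj (sgn u) * of_real (norm u powr (s - 1))"

lemma norm_dual_map: "s > 1 \<Longrightarrow> norm (dual_map s u) = norm u powr (s - 1)"
  by (cases "u = 0") (auto simp: dual_map_def norm_mult norm_sgn)

lemma mult_dual_map: "u * dual_map s u = of_real (norm u powr s)"
proof (cases "u = 0")
  case False
  have "u * dual_map s u = (u * cnj u) / of_real (norm u) * of_real (norm u powr (s - 1))"
    by (simp add: dual_map_def sgn_eq)
  also have "u * cnj u = of_real (norm u * norm u)"
    by (simp add: complex_norm_square[symmetric] power2_eq_square)
  also have "of_real (norm u * norm u) / of_real (norm u) = (of_real (norm u) :: complex)" using False by simp
  also have "of_real (norm u) * of_real (norm u powr (s - 1)) = (of_real (norm u powr s) :: complex)"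
    using powr_mult_base[of "norm u" "s - 1"] by (simp flip: of_real_mult)
  finally show ?thesis .
qed (simp add: dual_map_def)

lemma isCont_dual_map:
  assumes s: "s > 1"
  shows "isCont (dual_map s) u"
proof (cases "u = 0")
  case True
  have "((\<lambda>u::complex. norm u powr (s - 1)) \<longlongrightarrow> norm (0::complex) powr (s - 1)) (at 0)"
    using s by (intro tendsto_powr' tendsto_norm tendsto_const tendsto_ident_at) auto
  then have "((\<lambda>u. norm (dual_map s u)) \<longlongrightarrow> 0) (at 0)"
    using s by (simp add: norm_dual_map)
  then show ?thesis using True by (simp add: isCont_def tendsto_norm_zero_iff dual_map_def[abs_def])
next
  case False
  have "isCont (\<lambda>u. cnj (sgn u) * of_real (norm u powr (s - 1))) u"
    using False by (intro continuous_intros) auto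
  then show ?thesis by (simp add: dual_map_def[abs_def])
qed

lemma tendsto_dual_map:
  assumes "s > 1" "(f \<longlongrightarrow> l) F"
  shows "((\<lambda>x. dual_map s (f x)) \<longlongrightarrow> dual_map s l) F"
  by (rule isCont_tendsto_compose[OF isCont_dual_map[OF assms(1)] assms(2)])

lemma measurable_dual_map[measurable]:
  "s > 1 \<Longrightarrow> dual_map s \<in> borel_measurable borel"
  by (intro borel_measurable_continuous_onI continuous_at_imp_continuous_on ballI isCont_dual_map)

lemma
  assumes f: "f \<in> bLp s" and s: "s > 1" "(s - 1) * s' = s"
  shows bLp_dual_map: "(\<lambda>x. dual_map s (f x)) \<in> bLp s'"
    and Lp_pow_dual_map: "Lp_pow s' (\<lambda>x. dual_map s (f x)) = Lp_pow s f"
proof -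
  note [measurable] = bLp_measurable[OF f] measurable_dual_map[OF s(1)]
  have "norm (dual_map s (f x)) powr s' = norm (f x) powr s" for x
    using s by (simp add: norm_dual_map powr_powr)
  then show "(\<lambda>x. dual_map s (f x)) \<in> bLp s'" "Lp_pow s' (\<lambda>x. dual_map s (f x)) = Lp_pow s f"
    using f by (auto simp: bLp_def Lp_pow_def)
qed

text \<open>A weight of finite total mass with the same null sets as Lebesgue measure: bounded functions become
  integrable, and a limit with respect to the weight is an almost everywhere limit for a subsequence.\<close>

lemma ex_integrable_weight:
  obtains w :: "'a::euclidean_space \<Rightarrow> real"
  where "integrable lborel w" "\<And>x. 0 < w x" "\<And>x. w x \<le> 1"
proof -
  obtain h :: "'a \<Rightarrow> ennreal" where h[measurable]: "h \<in> borel_measurable borel" "integral\<^sup>N lborel h \<noteq> \<infinity>" "\<And>x. 0 < h x \<and> h x < \<infinity>"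
    using sigma_finite_measure.Ex_finite_integrable_function[OF lborel.sigma_finite_measure_axioms] by auto
  define w where "w x = min 1 (enn2real (h x))" for x
  have pos: "0 < w x" for x using h(3)[of x] by (simp add: w_def enn2real_positive_iff)
  have "integrable lborel w"
  proof (rule integrableI_nonneg)
    have "(\<integral>\<^sup>+x. ennreal (w x) \<partial>lborel) \<le> integral\<^sup>N lborel h"
    proof (intro nn_integral_mono)
      fix x
      have "ennreal (w x) \<le> ennreal (enn2real (h x))" by (intro ennreal_leI) (simp add: w_def)
      also have "ennreal (enn2real (h x)) = h x" using h(3)[of x] by (intro ennreal_enn2real) auto
      finally show "ennreal (w x) \<le> h x" .
    qed
    also have "\<dots> < \<infinity>" using h(2) by (simp add: less_top)
    finally show "(\<integral>\<^sup>+x. ennreal (w x) \<partial>lborel) < \<infinity>" .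
  qed (use pos in \<open>auto simp: w_def[abs_def] less_imp_le\<close>)
  then show thesis by (rule that) (use pos in \<open>auto simp: w_def\<close>)
qed

definition tame :: "('a::euclidean_space \<Rightarrow> complex) \<Rightarrow> bool" where
  "tame k \<longleftrightarrow> k \<in> borel_measurable borel \<and> (\<exists>b. \<forall>x. norm (k x) \<le> b) \<and> emeasure lborel {x. k x \<noteq> 0} < \<infinity>"

text \<open>Kernels in the weak \<open>L\<^sub>q\<close> closure of the tame ones. These are the kernels for which the convolution
  operator is a norm limit of operators that map weakly convergent sequences to pointwise convergent ones.\<close>

definition approximable :: "real \<Rightarrow> ('a::euclidean_space \<Rightarrow> complex) \<Rightarrow> bool" where
  "approximable q k \<longleftrightarrow> (\<exists>A>0. weak_Lq q A k) \<and> (\<forall>\<epsilon>>0. \<exists>k'. tame k' \<and> weak_Lq q \<epsilon> (\<lambda>x. k x - k' x))"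

lemma tame_bLp:
  assumes k: "tame k" and a: "a > 0"
  shows "k \<in> bLp a"
proof -
  have km[measurable]: "k \<in> borel_measurable borel" using k by (simp add: tame_def)
  obtain b where b: "\<And>x. norm (k x) \<le> b" using k by (auto simp: tame_def)
  have [measurable]: "{x. k x \<noteq> 0} \<in> sets borel" by measurable
  show ?thesis
  proof (rule bLp_dominated(1)[OF km])
    show "integrable lborel (\<lambda>x. b powr a * indicator {x. k x \<noteq> 0} x)"
      using k by (intro integrable_mult_right) (simp add: tame_def)
    show "AE x in lborel. norm (k x) powr a \<le> b powr a * indicator {x. k x \<noteq> 0} x"
      using b a by (intro AE_I2) (auto simp: indicator_def intro: powr_mono2)
  qed
qed

text \<open>The exponent is arbitrary here. This allows convolution with a tame kernel to be
  estimated from \<open>L\<^sub>p\<close> to \<open>L\<^sub>b\<close> for exponents \<open>b\<close> other than \<open>r\<close>.\<close>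

lemma tame_weak_Lq:
  assumes k: "tame k" and a: "a > 0"
  obtains A where "A > 0" "weak_Lq a A k"
proof -
  have km[measurable]: "k \<in> borel_measurable borel" using k by (simp add: tame_def)
  obtain b where b: "\<And>x. norm (k x) \<le> b" using k by (auto simp: tame_def)
  have b0: "b \<ge> 0" using b[of undefined] norm_ge_zero order.trans by blast
  have [measurable]: "{x. k x \<noteq> 0} \<in> sets borel" by measurable
  define m where "m = measure lborel {x. k x \<noteq> 0}"
  have m: "emeasure lborel {x. k x \<noteq> 0} = ennreal m"
    using k unfolding m_def by (intro emeasure_eq_ennreal_measure) (auto simp: tame_def)
  show thesis
  proof (rule that[of "(m + 1) * (b + 1) powr a"])
    show "(m + 1) * (b + 1) powr a > 0" using b0 by (auto simp: m_def intro!: mult_pos_pos add_nonneg_pos)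
    show "weak_Lq a ((m + 1) * (b + 1) powr a) k"
      unfolding weak_Lq_def
    proof (intro conjI km allI impI)
      fix u :: real assume u: "u > 0"
      show "emeasure lborel {x. u < norm (k x)} \<le> ennreal ((m + 1) * (b + 1) powr a * u powr - a)"
      proof (cases "u < b + 1")
        case True
        have "emeasure lborel {x. u < norm (k x)} \<le> ennreal m"
          unfolding m[symmetric] by (rule emeasure_mono) (use u in auto)
        also have "m * 1 \<le> (m + 1) * ((b + 1) powr a * u powr - a)"
        proof (rule mult_mono)
          have "u powr a \<le> (b + 1) powr a" using True u a by (intro powr_mono2) auto
          then show "1 \<le> (b + 1) powr a * u powr - a" using u by (simp add: powr_minus field_simps)
        qed (auto simp: m_def)
        then have "ennreal m \<le> ennreal ((m + 1) * (b + 1) powr a * u powr - a)" by (intro ennreal_leI) (simp add: mult_ac)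
        finally show ?thesis .
      next
        case False
        then have "norm (k x) \<le> u" for x using b[of x] by linarith
        then have "{x. u < norm (k x)} = {}" by (auto simp: not_less)
        then show ?thesis by simp
      qed
    qed
  qed
qed

lemma emeasure_reflect:
  fixes S :: "'a::euclidean_space set"
  assumes [measurable]: "S \<in> sets borel"
  shows "emeasure lborel {x. - x \<in> S} = emeasure lborel S"
proof -
  have "emeasure lborel {x. - x \<in> S} = (\<integral>\<^sup>+x. indicator S (0 - x) \<partial>lborel)"
    by (subst nn_integral_indicator[symmetric]) (auto intro!: nn_integral_cong simp: indicator_def simp del: nn_integral_indicator)
  also have "\<dots> = emeasure lborel S" by (subst nn_integral_lborel_reflect) auto
  finally show ?thesis .
qed

lemma weak_Lq_reflect: "weak_Lq q A k \<Longrightarrow> weak_Lq q A (\<lambda>x. k (- x))"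
proof -
  assume k: "weak_Lq q A k"
  note [measurable] = weak_Lq_measurable[OF k]
  have "emeasure lborel {x. u < norm (k (- x))} = emeasure lborel {x. u < norm (k x)}" for u
    using emeasure_reflect[of "{x. u < norm (k x)}"] by simp
  with k show ?thesis by (auto simp: weak_Lq_def)
qed

lemma tame_reflect: "tame k \<Longrightarrow> tame (\<lambda>x. k (- x))"
proof -
  assume k: "tame k"
  have [measurable]: "k \<in> borel_measurable borel" using k by (simp add: tame_def)
  have "emeasure lborel {x. k (- x) \<noteq> 0} = emeasure lborel {x. k x \<noteq> 0}"
    using emeasure_reflect[of "{x. k x \<noteq> 0}"] by simp
  with k show ?thesis by (auto simp: tame_def)
qed

lemma approximable_reflect: "approximable q k \<Longrightarrow> approximable q (\<lambda>x. k (- x))"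
  unfolding approximable_def using weak_Lq_reflect tame_reflect by blast

lemma
  fixes f :: "'a::euclidean_space \<Rightarrow> complex"
  assumes f: "f \<in> bLp p"
  shows bLp_reflect_shift: "(\<lambda>y. f (x - y)) \<in> bLp p" and Lp_pow_reflect_shift: "Lp_pow p (\<lambda>y. f (x - y)) = Lp_pow p f"
proof -
  note [measurable] = bLp_measurable[OF f]
  have m: "(\<lambda>y. f (x - y)) \<in> borel_measurable borel" by measurable
  have e: "(\<integral>\<^sup>+y. ennreal (norm (f (x - y)) powr p) \<partial>lborel) = ennreal (Lp_pow p f)"
    using nn_integral_lborel_reflect[of "\<lambda>y. ennreal (norm (f y) powr p)" x] nn_integral_Lp_pow[OF f] by simp
  show b: "(\<lambda>y. f (x - y)) \<in> bLp p" by (rule bLp_I[OF m]) (use e in auto)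
  show "Lp_pow p (\<lambda>y. f (x - y)) = Lp_pow p f"
    using nn_integral_Lp_pow[OF b] e by (simp add: Lp_pow_nonneg)
qed

lemma
  fixes f :: "'a::euclidean_space \<Rightarrow> complex"
  assumes f: "f \<in> bLp p"
  shows bLp_shift: "(\<lambda>y. f (y + x)) \<in> bLp p" and Lp_pow_shift: "Lp_pow p (\<lambda>y. f (y + x)) = Lp_pow p f"
proof -
  note [measurable] = bLp_measurable[OF f]
  have m: "(\<lambda>y. f (y + x)) \<in> borel_measurable borel" by measurable
  have e: "(\<integral>\<^sup>+y. ennreal (norm (f (y + x)) powr p) \<partial>lborel) = ennreal (Lp_pow p f)"
    using nn_integral_lborel_translate[of "\<lambda>y. ennreal (norm (f y) powr p)" x] nn_integral_Lp_pow[OF f]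
    by (simp add: add.commute)
  show b: "(\<lambda>y. f (y + x)) \<in> bLp p" by (rule bLp_I[OF m]) (use e in auto)
  show "Lp_pow p (\<lambda>y. f (y + x)) = Lp_pow p f"
    using nn_integral_Lp_pow[OF b] e by (simp add: Lp_pow_nonneg)
qed

lemma integral_lborel_translate:
  fixes F :: "'a::euclidean_space \<Rightarrow> complex"
  assumes [measurable]: "F \<in> borel_measurable borel"
  shows "(LINT y|lborel. F (x + y)) = (LINT y|lborel. F y)"
  by (subst (2) lborel_distr_plus[of x, symmetric]) (simp add: integral_distr)

lemma conv_shift:
  assumes [measurable]: "k \<in> borel_measurable borel" "f \<in> borel_measurable borel"
  shows "conv k (\<lambda>y. f (y + z)) x = conv k f (x + z)"
  using integral_lborel_translate[of "\<lambda>y. k (x + z - y) * f y" z]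
  by (simp add: conv_def algebra_simps)

lemma conv_tame_bound:
  assumes k: "tame k" and f: "f \<in> bLp p" and p: "p > 1" "p' > 1" "1/p + 1/p' = 1"
  shows "norm (conv k f x) \<le> Lp_pow p' k powr (1/p') * Lp_pow p f powr (1/p)"
proof -
  have kb: "(\<lambda>y. k (x - y)) \<in> bLp p'" "Lp_pow p' (\<lambda>y. k (x - y)) = Lp_pow p' k"
    using bLp_reflect_shift Lp_pow_reflect_shift tame_bLp[OF k, of p'] p by auto
  show ?thesis unfolding conv_def
    using bLp_Hoelder[OF kb(1) f p(2,1)] p kb(2) by simp
qed

lemma conv_decompose_AE:
  assumes "AE x in lborel. integrable lborel (\<lambda>y. k1 (x - y) * f y)" "AE x in lborel. integrable lborel (\<lambda>y. k2 (x - y) * f y)"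
  shows "AE x in lborel. conv (\<lambda>x. k1 x + k2 x) f x = conv k1 f x + conv k2 f x"
  using assms by eventually_elim (simp add: conv_def distrib_right)

lemma conv_diff_AE:
  assumes "AE x in lborel. integrable lborel (\<lambda>y. k (x - y) * f y)" "AE x in lborel. integrable lborel (\<lambda>y. k (x - y) * g y)"
  shows "AE x in lborel. conv k (\<lambda>y. f y - g y) x = conv k f x - conv k g x"
  using assms by eventually_elim (simp add: conv_def right_diff_distrib)

section \<open>From weak to almost everywhere convergence\<close>

context hls_exponents
begin

definition p' where "p' = p / (p - 1)"

lemma p'_gt1: "p' > 1" and conj_p: "1/p + 1/p' = 1"
  using p_gt1 by (auto simp: p'_def field_simps)

lemma conj_r: "1/r + 1/r' = 1" using inv_r' by simp

text \<open>For a tame kernel \<open>k'\<close> the value of \<open>k' * h\<^sub>n\<close> at \<open>x\<close> is the pairing of \<open>h\<^sub>n\<close> with the fixed function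
  \<open>k' (x - y)\<close> of \<open>y\<close>; it tends to \<open>0\<close>, and uniformly bounded functions converge in the integral against the
  weight. The error \<open>(k - k') * h\<^sub>n\<close> is small in \<open>L\<^sub>r\<close>, uniformly in \<open>n\<close>.\<close>

lemma weak_null_conv_weighted:
  fixes k :: "'a::euclidean_space \<Rightarrow> complex"
  assumes k: "approximable q k" and h: "\<And>n. h n \<in> bLp p" and B: "\<And>n. Lp_pow p (h n) \<le> B"
    and null: "\<And>\<phi>. \<phi> \<in> bLp p' \<Longrightarrow> (\<lambda>n. LINT x|lborel. h n x * \<phi> x) \<longlonglongrightarrow> 0"
    and w: "integrable lborel w" "\<And>x. 0 < w x" "\<And>x. w x \<le> 1"
  shows "(\<lambda>n. LINT x|lborel. norm (conv k (h n) x) powr r * w x) \<longlonglongrightarrow> 0"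
    and "\<And>n. integrable lborel (\<lambda>x. norm (conv k (h n) x) powr r * w x)"
proof -
  have [measurable]: "h n \<in> borel_measurable borel" for n using h by (rule bLp_measurable)
  have [measurable]: "w \<in> borel_measurable borel" using borel_measurable_integrable[OF w(1)] by simp
  obtain A where A: "A > 0" "weak_Lq q A k" using k by (auto simp: approximable_def)
  note [measurable] = weak_Lq_measurable[OF A(2)]
  have B0: "B \<ge> 0" using B[of 0] Lp_pow_nonneg[of p "h 0"] by simp
  have wint: "integrable lborel (\<lambda>x. norm (g x) powr r * w x)" if "g \<in> bLp r" for g
  proof (rule Bochner_Integration.integrable_bound[OF bLp_integrable[OF that]])
    note [measurable] = bLp_measurable[OF that]
    show "(\<lambda>x. norm (g x) powr r * w x) \<in> borel_measurable lborel" by measurable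
    show "AE x in lborel. norm (norm (g x) powr r * w x) \<le> norm (norm (g x) powr r)"
      using w(2,3) by (intro AE_I2) (simp add: mult_left_le less_imp_le)
  qed
  have wle: "(LINT x|lborel. norm (g x) powr r * w x) \<le> Lp_pow r g" if "g \<in> bLp r" for g
    unfolding Lp_pow_def using w(2,3)
    by (intro integral_mono wint that bLp_integrable) (simp add: mult_left_le less_imp_le)
  show kint: "integrable lborel (\<lambda>x. norm (conv k (h n) x) powr r * w x)" for n
    by (rule wint[OF hls_conv(1)[OF A(2,1) h]])
  show "(\<lambda>n. LINT x|lborel. norm (conv k (h n) x) powr r * w x) \<longlonglongrightarrow> 0"
  proof (rule LIMSEQ_I)
    fix e :: real assume e: "e > 0"
    have "((\<lambda>\<epsilon>. 2 powr r * ((hls_const * \<epsilon> powr (1/q)) powr r * B powr (r/p))) \<longlongrightarrow>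
        2 powr r * ((hls_const * 0 powr (1/q)) powr r * B powr (r/p))) (at_right 0)"
      using hls_const_pos q_gt1 r_gt1 by (intro tendsto_intros tendsto_powr') (auto simp: eventually_at_filter)
    then have "\<forall>\<^sub>F \<epsilon> in at_right 0. 2 powr r * ((hls_const * \<epsilon> powr (1/q)) powr r * B powr (r/p)) < e/2"
      using e by (intro order_tendstoD(2)) auto
    moreover have "\<forall>\<^sub>F \<epsilon> in at_right (0::real). \<epsilon> > 0" by (auto simp: eventually_at_filter)
    ultimately have "\<forall>\<^sub>F \<epsilon> in at_right (0::real). \<epsilon> > 0 \<and> 2 powr r * ((hls_const * \<epsilon> powr (1/q)) powr r * B powr (r/p)) < e/2"
      by eventually_elim auto
    then obtain \<epsilon> :: real where eps: "\<epsilon> > 0" "2 powr r * ((hls_const * \<epsilon> powr (1/q)) powr r * B powr (r/p)) < e/2"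
      using eventually_happens'[OF trivial_limit_at_right_real] by blast
    obtain k' where k': "tame k'" "weak_Lq q \<epsilon> (\<lambda>x. k x - k' x)" using k eps(1) by (auto simp: approximable_def)
    define d where "d = (\<lambda>x. k x - k' x)"
    have d: "weak_Lq q \<epsilon> d" using k' by (simp add: d_def)
    obtain A' where A': "A' > 0" "weak_Lq q A' k'" using tame_weak_Lq[OF k'(1), of q] q_gt1 by auto
    note [measurable] = weak_Lq_measurable[OF A'(2)] weak_Lq_measurable[OF d]
    have dec: "AE x in lborel. conv k (h n) x = conv k' (h n) x + conv d (h n) x" for n
      using conv_decompose_AE[OF conv_integrable_AE[OF A'(2,1) h[of n]] conv_integrable_AE[OF d eps(1) h[of n]]]
      by (simp add: d_def)
    have k'b: "conv k' (h n) \<in> bLp r" for n by (rule hls_conv(1)[OF A'(2,1) h])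
    have db: "conv d (h n) \<in> bLp r" for n by (rule hls_conv(1)[OF d eps(1) h])
    have small: "2 powr r * Lp_pow r (conv d (h n)) < e/2" for n
    proof -
      have "Lp_pow r (conv d (h n)) \<le> (hls_const * \<epsilon> powr (1/q)) powr r * Lp_pow p (h n) powr (r/p)"
        by (rule hls_conv(2)[OF d eps(1) h])
      also have "\<dots> \<le> (hls_const * \<epsilon> powr (1/q)) powr r * B powr (r/p)"
        using B Lp_pow_nonneg p_gt1 r_gt1 by (intro mult_left_mono powr_mono2) auto
      finally have "2 powr r * Lp_pow r (conv d (h n)) \<le> 2 powr r * ((hls_const * \<epsilon> powr (1/q)) powr r * B powr (r/p))"
        by (intro mult_left_mono) auto
      then show ?thesis using eps(2) by (rule le_less_trans)
    qed
    define K where "K = Lp_pow p' k' powr (1/p') * B powr (1/p)"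
    have K: "norm (conv k' (h n) x) \<le> K" for n x
    proof -
      have "norm (conv k' (h n) x) \<le> Lp_pow p' k' powr (1/p') * Lp_pow p (h n) powr (1/p)"
        by (rule conv_tame_bound[OF k'(1) h p_gt1 p'_gt1 conj_p])
      also have "\<dots> \<le> K" unfolding K_def
        using B Lp_pow_nonneg p_gt1 by (intro mult_left_mono powr_mono2) auto
      finally show ?thesis .
    qed
    have "(\<lambda>n. LINT x|lborel. norm (conv k' (h n) x) powr r * w x) \<longlonglongrightarrow> (LINT x|(lborel :: 'a measure). 0)"
    proof (rule integral_dominated_convergence)
      show "integrable lborel (\<lambda>x. K powr r * w x)" using w(1) by simp
      show "AE x in lborel. (\<lambda>n. norm (conv k' (h n) x) powr r * w x) \<longlonglongrightarrow> 0"
      proof (intro AE_I2)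
        fix x
        have "(\<lambda>y. k' (x - y)) \<in> bLp p'" using bLp_reflect_shift tame_bLp[OF k'(1), of p'] p'_gt1 by auto
        from null[OF this] have "(\<lambda>n. conv k' (h n) x) \<longlonglongrightarrow> 0" by (simp add: conv_def mult.commute)
        then have "(\<lambda>n. norm (conv k' (h n) x) powr r * w x) \<longlonglongrightarrow> norm (0::complex) powr r * w x"
          using r_gt1 by (intro tendsto_intros tendsto_powr') auto
        then show "(\<lambda>n. norm (conv k' (h n) x) powr r * w x) \<longlonglongrightarrow> 0" by simp
      qed
      show "AE x in lborel. norm (norm (conv k' (h n) x) powr r * w x) \<le> K powr r * w x" for n
        using K w(2) r_gt1 by (intro AE_I2) (auto simp: abs_mult less_imp_le intro!: mult_right_mono powr_mono2)
    qed measurable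
    then have "(\<lambda>n. 2 powr r * (LINT x|lborel. norm (conv k' (h n) x) powr r * w x)) \<longlonglongrightarrow> 2 powr r * 0"
      by (intro tendsto_intros) simp
    then have "\<forall>\<^sub>F n in sequentially. 2 powr r * (LINT x|lborel. norm (conv k' (h n) x) powr r * w x) < e/2"
      by (rule order_tendstoD(2)) (use e in simp)
    then obtain N where N: "\<And>n. n \<ge> N \<Longrightarrow> 2 powr r * (LINT x|lborel. norm (conv k' (h n) x) powr r * w x) < e/2"
      by (auto simp: eventually_sequentially)
    show "\<exists>N. \<forall>n\<ge>N. norm ((LINT x|lborel. norm (conv k (h n) x) powr r * w x) - 0) < e"
    proof (intro exI allI impI)
      fix n assume n: "n \<ge> N"
      have "(LINT x|lborel. norm (conv k (h n) x) powr r * w x)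
         \<le> (LINT x|lborel. 2 powr r * (norm (conv k' (h n) x) powr r * w x) + 2 powr r * (norm (conv d (h n) x) powr r * w x))"
      proof (rule integral_mono_AE)
        show "AE x in lborel. norm (conv k (h n) x) powr r * w x \<le>
           2 powr r * (norm (conv k' (h n) x) powr r * w x) + 2 powr r * (norm (conv d (h n) x) powr r * w x)"
          using dec[of n]
        proof eventually_elim
          case (elim x)
          have "norm (conv k (h n) x) powr r \<le> 2 powr r * (norm (conv k' (h n) x) powr r + norm (conv d (h n) x) powr r)"
            unfolding elim using r_gt1 by (intro norm_add_powr_le) auto
          then have "norm (conv k (h n) x) powr r * w x \<le> 2 powr r * (norm (conv k' (h n) x) powr r + norm (conv d (h n) x) powr r) * w x"
            using w(2)[of x] by (intro mult_right_mono) auto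
          then show ?case by (simp add: algebra_simps)
        qed
      qed (intro kint Bochner_Integration.integrable_add integrable_mult_right wint k'b db)+
      also have "\<dots> = 2 powr r * (LINT x|lborel. norm (conv k' (h n) x) powr r * w x) + 2 powr r * (LINT x|lborel. norm (conv d (h n) x) powr r * w x)"
        by (simp add: wint k'b db)
      also have "(LINT x|lborel. norm (conv d (h n) x) powr r * w x) \<le> Lp_pow r (conv d (h n))" by (rule wle[OF db])
      finally have "(LINT x|lborel. norm (conv k (h n) x) powr r * w x) < e"
        using N[OF n] small[of n] by simp
      moreover have "0 \<le> (LINT x|lborel. norm (conv k (h n) x) powr r * w x)"
        using w(2) by (intro integral_nonneg_AE AE_I2 mult_nonneg_nonneg) (auto simp: less_imp_le)
      ultimately show "norm ((LINT x|lborel. norm (conv k (h n) x) powr r * w x) - 0) < e" by simp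
    qed
  qed
qed

lemma weak_null_conv_AE:
  fixes k :: "'a::euclidean_space \<Rightarrow> complex"
  assumes k: "approximable q k" and h: "\<And>n. h n \<in> bLp p" and B: "\<And>n. Lp_pow p (h n) \<le> B"
    and null: "\<And>\<phi>. \<phi> \<in> bLp p' \<Longrightarrow> (\<lambda>n. LINT x|lborel. h n x * \<phi> x) \<longlonglongrightarrow> 0"
  obtains \<sigma> :: "nat \<Rightarrow> nat" where "strict_mono \<sigma>" "AE x in lborel. (\<lambda>n. conv k (h (\<sigma> n)) x) \<longlonglongrightarrow> 0"
proof -
  obtain w :: "'a \<Rightarrow> real" where w: "integrable lborel w" "\<And>x. 0 < w x" "\<And>x. w x \<le> 1"
    using ex_integrable_weight by blast
  note W = weak_null_conv_weighted[OF k h B null w]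
  have "(\<lambda>n. LINT x|lborel. norm (norm (conv k (h n) x) powr r * w x)) \<longlonglongrightarrow> 0"
    using W(1) w(2) by (simp add: abs_mult less_imp_le)
  from tendsto_L1_AE_subseq[OF W(2) this]
  obtain \<sigma> where \<sigma>: "strict_mono \<sigma>" "AE x in lborel. (\<lambda>n. norm (conv k (h (\<sigma> n)) x) powr r * w x) \<longlonglongrightarrow> 0"
    by blast
  have "AE x in lborel. (\<lambda>n. conv k (h (\<sigma> n)) x) \<longlonglongrightarrow> 0"
    using \<sigma>(2)
  proof eventually_elim
    case (elim x)
    have "(\<lambda>n. ((norm (conv k (h (\<sigma> n)) x) powr r * w x) / w x) powr (1/r)) \<longlonglongrightarrow> (0 / w x) powr (1/r)"
      using w(2)[of x] r_gt1 by (intro tendsto_powr' tendsto_divide elim tendsto_const) auto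
    moreover have "((norm (conv k (h (\<sigma> n)) x) powr r * w x) / w x) powr (1/r) = norm (conv k (h (\<sigma> n)) x)" for n
      using w(2)[of x] r_gt1 by (simp add: powr_powr)
    ultimately have "(\<lambda>n. norm (conv k (h (\<sigma> n)) x)) \<longlonglongrightarrow> 0" using r_gt1 by simp
    then show ?case by (rule tendsto_norm_zero_cancel)
  qed
  with \<sigma>(1) show thesis by (rule that)
qed

lemma AE_lim_conv_AE:
  fixes k :: "'a::euclidean_space \<Rightarrow> complex"
  assumes k: "approximable q k" and f: "\<And>n. f n \<in> bLp p" and B: "\<And>n. Lp_pow p (f n) \<le> B"
    and g: "g \<in> bLp p" and lim: "AE x in lborel. (\<lambda>n. f n x) \<longlonglongrightarrow> g x"
  obtains \<sigma> :: "nat \<Rightarrow> nat" where "strict_mono \<sigma>" "AE x in lborel. (\<lambda>n. conv k (f (\<sigma> n)) x) \<longlonglongrightarrow> conv k g x"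
proof -
  have fg: "(\<lambda>x. f n x - g x) \<in> bLp p" for n using p_gt1 by (intro bLp_diff f g) auto
  have B': "Lp_pow p (\<lambda>x. f n x - g x) \<le> 2 powr p * (B + Lp_pow p g)" for n
  proof -
    have "Lp_pow p (\<lambda>x. f n x - g x) \<le> 2 powr p * (Lp_pow p (f n) + Lp_pow p g)"
      using p_gt1 by (intro Lp_pow_diff_le f g) auto
    also have "\<dots> \<le> 2 powr p * (B + Lp_pow p g)" by (intro mult_left_mono add_mono B) auto
    finally show ?thesis .
  qed
  have lim0: "AE x in lborel. (\<lambda>n. f n x - g x) \<longlonglongrightarrow> 0"
    using lim by eventually_elim (rule LIM_zero)
  obtain \<sigma> where \<sigma>: "strict_mono \<sigma>" "AE x in lborel. (\<lambda>n. conv k (\<lambda>x. f (\<sigma> n) x - g x) x) \<longlonglongrightarrow> 0"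
    by (rule weak_null_conv_AE[OF k fg B' AE_lim_imp_weak_null[OF fg _ p_gt1 p'_gt1 conj_p lim0 B']])
  obtain A where A: "A > 0" "weak_Lq q A k" using k by (auto simp: approximable_def)
  have "AE x in lborel. \<forall>n. conv k (\<lambda>x. f n x - g x) x = conv k (f n) x - conv k g x"
    unfolding AE_all_countable by (intro allI conv_diff_AE conv_integrable_AE[OF A(2,1)] f g)
  with \<sigma>(2) have "AE x in lborel. (\<lambda>n. conv k (f (\<sigma> n)) x) \<longlonglongrightarrow> conv k g x"
    by eventually_elim (simp add: LIM_zero_iff)
  with \<sigma>(1) show thesis by (rule that)
qed

text \<open>The limit function is not known in advance, so completeness has to be proved along the way. Differences
  \<open>f\<^sub>i - f\<^sub>j\<close> are weakly null, hence the images form a Cauchy sequence in the weighted \<open>L\<^sub>r\<close> space, and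
  a rapidly converging subsequence converges almost everywhere.\<close>

lemma weak_Cauchy_conv_AE:
  fixes k :: "'a::euclidean_space \<Rightarrow> complex"
  assumes k: "approximable q k" and f: "\<And>n. f n \<in> bLp p" and B: "\<And>n. Lp_pow p (f n) \<le> B"
    and conv: "\<And>\<phi>. \<phi> \<in> bLp p' \<Longrightarrow> convergent (\<lambda>n. LINT x|lborel. f n x * \<phi> x)"
  obtains \<sigma> :: "nat \<Rightarrow> nat" where "strict_mono \<sigma>" "AE x in lborel. convergent (\<lambda>n. conv k (f (\<sigma> n)) x)"
proof -
  obtain A where A: "A > 0" "weak_Lq q A k" using k by (auto simp: approximable_def)
  note [measurable] = weak_Lq_measurable[OF A(2)]
  have [measurable]: "f n \<in> borel_measurable borel" for n using f by (rule bLp_measurable)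
  obtain w :: "'a \<Rightarrow> real" where w: "integrable lborel w" "\<And>x. 0 < w x" "\<And>x. w x \<le> 1"
    using ex_integrable_weight by blast
  have [measurable]: "w \<in> borel_measurable borel" using borel_measurable_integrable[OF w(1)] by simp
  have ff: "(\<lambda>x. f i x - f j x) \<in> bLp p" for i j using p_gt1 by (intro bLp_diff f) auto
  have B': "Lp_pow p (\<lambda>x. f i x - f j x) \<le> 2 powr p * (B + B)" for i j
  proof -
    have "Lp_pow p (\<lambda>x. f i x - f j x) \<le> 2 powr p * (Lp_pow p (f i) + Lp_pow p (f j))"
      using p_gt1 by (intro Lp_pow_diff_le f) auto
    also have "\<dots> \<le> 2 powr p * (B + B)" by (intro mult_left_mono add_mono B) auto
    finally show ?thesis .
  qed
  have diff: "AE x in lborel. conv k (\<lambda>x. f i x - f j x) x = conv k (f i) x - conv k (f j) x" for i j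
    by (intro conv_diff_AE conv_integrable_AE[OF A(2,1)] f)
  define D where "D i j = (\<integral>\<^sup>+x. ennreal (norm (conv k (f i) x - conv k (f j) x) powr r * w x) \<partial>lborel)" for i j
  have Cauchy: "\<exists>N. \<forall>i\<ge>N. \<forall>j\<ge>N. D i j < ennreal e" if e: "e > 0" for e
  proof (rule ccontr)
    assume "\<not> ?thesis"
    then have "\<forall>N. \<exists>i j. i \<ge> N \<and> j \<ge> N \<and> \<not> D i j < ennreal e" by meson
    then obtain i j where ij: "\<And>N. i N \<ge> N" "\<And>N. j N \<ge> N" "\<And>N. \<not> D (i N) (j N) < ennreal e" by metis
    have ilim: "filterlim i at_top sequentially" "filterlim j at_top sequentially"
      using ij(1,2) by (auto intro: filterlim_at_top_mono[OF filterlim_ident])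
    define h where "h N = (\<lambda>x. f (i N) x - f (j N) x)" for N
    have hb: "h N \<in> bLp p" and hB: "Lp_pow p (h N) \<le> 2 powr p * (B + B)" for N using ff B' by (auto simp: h_def)
    have null: "(\<lambda>N. LINT x|lborel. h N x * \<phi> x) \<longlonglongrightarrow> 0" if phi: "\<phi> \<in> bLp p'" for \<phi>
    proof -
      obtain L where L: "(\<lambda>n. LINT x|lborel. f n x * \<phi> x) \<longlonglongrightarrow> L"
        using conv[OF phi] by (auto simp: convergent_def)
      have "(\<lambda>N. (LINT x|lborel. f (i N) x * \<phi> x) - (LINT x|lborel. f (j N) x * \<phi> x)) \<longlonglongrightarrow> L - L"
        using filterlim_compose[OF L ilim(1)] filterlim_compose[OF L ilim(2)] by (intro tendsto_diff)
      moreover have "(LINT x|lborel. f (i N) x * \<phi> x) - (LINT x|lborel. f (j N) x * \<phi> x) = (LINT x|lborel. h N x * \<phi> x)" for N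
        using bLp_Young_integrable(1)[OF f phi p_gt1 p'_gt1 conj_p]
        by (simp add: h_def left_diff_distrib)
      ultimately show ?thesis by simp
    qed
    note W = weak_null_conv_weighted[OF k hb hB null w]
    have eq: "D (i N) (j N) = ennreal (LINT x|lborel. norm (conv k (h N) x) powr r * w x)" for N
    proof -
      have "D (i N) (j N) = (\<integral>\<^sup>+x. ennreal (norm (conv k (h N) x) powr r * w x) \<partial>lborel)"
        unfolding D_def h_def using diff[of "i N" "j N"] by (intro nn_integral_cong_AE) auto
      also have "\<dots> = ennreal (LINT x|lborel. norm (conv k (h N) x) powr r * w x)"
        using w(2) by (intro nn_integral_eq_integral W(2)) (auto simp: less_imp_le)
      finally show ?thesis .
    qed
    have "\<forall>\<^sub>F N in sequentially. (LINT x|lborel. norm (conv k (h N) x) powr r * w x) < e"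
      using W(1) e by (intro order_tendstoD(2)) auto
    then obtain N where "(LINT x|lborel. norm (conv k (h N) x) powr r * w x) < e"
      by (auto simp: eventually_sequentially)
    then have "D (i N) (j N) < ennreal e" unfolding eq using e by (simp add: ennreal_lessI)
    with ij(3) show False by blast
  qed
  then have "\<forall>n. \<exists>N. \<forall>i\<ge>N. \<forall>j\<ge>N. D i j < ennreal ((1/4) ^ n)" by simp
  then obtain N where N: "\<And>n i j. i \<ge> N n \<Longrightarrow> j \<ge> N n \<Longrightarrow> D i j < ennreal ((1/4) ^ n)" by metis
  define \<sigma> where "\<sigma> = rec_nat (N 0) (\<lambda>n s. max (N (Suc n)) (Suc s))"
  have sSuc: "\<sigma> (Suc n) = max (N (Suc n)) (Suc (\<sigma> n))" for n by (simp add: \<sigma>_def)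
  have sN: "N n \<le> \<sigma> n" for n by (cases n) (auto simp: \<sigma>_def)
  have mono: "strict_mono \<sigma>" by (rule strict_monoI_Suc) (simp add: sSuc)
  have Dsmall: "D (\<sigma> (Suc n)) (\<sigma> n) < ennreal ((1/4) ^ n)" for n
    by (rule N) (use sN[of n] in \<open>auto simp: sSuc\<close>)
  define d where "d n x = norm (conv k (f (\<sigma> (Suc n))) x - conv k (f (\<sigma> n)) x)" for n x
  have [measurable]: "d n \<in> borel_measurable borel" for n unfolding d_def by measurable
  \<comment> \<open>the factor \<open>2\<^sup>n\<close> against \<open>4\<^bsup>-n\<^esup>\<close> leaves a convergent series and forces \<open>d n x\<close> to decay geometrically\<close>
  have "(\<integral>\<^sup>+x. (\<Sum>n. ennreal (2 ^ n) * ennreal (d n x powr r * w x)) \<partial>lborel)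
      = (\<Sum>n. \<integral>\<^sup>+x. ennreal (2 ^ n) * ennreal (d n x powr r * w x) \<partial>lborel)"
    by (rule nn_integral_suminf) measurable
  also have "\<dots> = (\<Sum>n. ennreal (2 ^ n) * D (\<sigma> (Suc n)) (\<sigma> n))"
    unfolding D_def d_def by (intro suminf_cong nn_integral_cmult) measurable
  also have "\<dots> \<le> (\<Sum>n. ennreal ((1/2) ^ n))"
  proof (intro suminf_le allI)
    fix n
    have "ennreal (2 ^ n) * D (\<sigma> (Suc n)) (\<sigma> n) \<le> ennreal (2 ^ n) * ennreal ((1/4) ^ n)"
      by (intro mult_left_mono less_imp_le[OF Dsmall]) auto
    also have "\<dots> = ennreal ((1/2) ^ n)"
      by (simp flip: ennreal_mult power_mult_distrib)
    finally show "ennreal (2 ^ n) * D (\<sigma> (Suc n)) (\<sigma> n) \<le> ennreal ((1/2) ^ n)" .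
  qed auto
  also have "\<dots> < \<infinity>"
    by (subst suminf_ennreal2) (auto simp: summable_geometric)
  finally have "AE x in lborel. (\<Sum>n. ennreal (2 ^ n) * ennreal (d n x powr r * w x)) \<noteq> \<infinity>"
    by (intro nn_integral_PInf_AE) auto
  then have "AE x in lborel. convergent (\<lambda>n. conv k (f (\<sigma> n)) x)"
  proof eventually_elim
    case (elim x)
    then obtain S where S: "0 \<le> S" "(\<Sum>n. ennreal (2 ^ n) * ennreal (d n x powr r * w x)) = ennreal S"
      by (cases "(\<Sum>n. ennreal (2 ^ n) * ennreal (d n x powr r * w x))") auto
    define \<rho> where "\<rho> = (1/2) powr (1/r)"
    have rho: "0 < \<rho>" "\<rho> < 1" using r_gt1 powr_less_mono2[of "1/r" "1/2" 1] by (auto simp: \<rho>_def)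
    have dle: "d n x \<le> (S / w x) powr (1/r) * \<rho> ^ n" for n
    proof -
      have "ennreal (2 ^ n * (d n x powr r * w x)) = ennreal (2 ^ n) * ennreal (d n x powr r * w x)"
        by (rule ennreal_mult') simp
      also have "\<dots> \<le> ennreal S"
        unfolding S(2)[symmetric] using sum_le_suminf[of "\<lambda>n. ennreal (2 ^ n) * ennreal (d n x powr r * w x)" "{n}"]
        by simp
      finally have "2 ^ n * (d n x powr r * w x) \<le> S" using S(1) by (simp add: ennreal_le_iff)
      then have "d n x powr r \<le> S / w x * (1/2) ^ n" using w(2)[of x] by (simp add: field_simps)
      then have "(d n x powr r) powr (1/r) \<le> (S / w x * (1/2) ^ n) powr (1/r)"
        using r_gt1 by (intro powr_mono2) auto
      also have "\<dots> = (S / w x) powr (1/r) * ((1/2) ^ n) powr (1/r)"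
        using S(1) w(2)[of x] by (subst powr_mult) auto
      also have "((1/2) ^ n) powr (1/r) = ((1/2::real) powr real n) powr (1/r)" by (simp add: powr_realpow)
      also have "\<dots> = ((1/2::real) powr (1/r)) powr real n" by (simp only: powr_powr mult.commute)
      also have "\<dots> = \<rho> ^ n" unfolding \<rho>_def[symmetric] using rho by (simp add: powr_realpow)
      finally show ?thesis using r_gt1 by (simp add: powr_powr d_def)
    qed
    have "summable (\<lambda>n. conv k (f (\<sigma> (Suc n))) x - conv k (f (\<sigma> n)) x)"
    proof (rule summable_comparison_test')
      show "summable (\<lambda>n. (S / w x) powr (1/r) * \<rho> ^ n)"
        using rho by (intro summable_mult summable_geometric) auto
      show "norm (conv k (f (\<sigma> (Suc n))) x - conv k (f (\<sigma> n)) x) \<le> (S / w x) powr (1/r) * \<rho> ^ n" if "n \<ge> 0" for n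
        using dle[of n] by (simp add: d_def)
    qed
    then have "convergent (\<lambda>n. \<Sum>i<n. conv k (f (\<sigma> (Suc i))) x - conv k (f (\<sigma> i)) x)"
      by (simp add: summable_iff_convergent)
    then have "convergent (\<lambda>n. conv k (f (\<sigma> n)) x - conv k (f (\<sigma> 0)) x)"
      by (simp add: sum_lessThan_telescope[of "\<lambda>n. conv k (f (\<sigma> n)) x"])
    then have "convergent (\<lambda>n. (conv k (f (\<sigma> n)) x - conv k (f (\<sigma> 0)) x) + conv k (f (\<sigma> 0)) x)"
      by (intro convergent_add convergent_const)
    then show ?case by simp
  qed
  with mono show thesis by (rule that)
qed

end

text \<open>A form of weak sequential compactness that needs no representation of functionals: a diagonal
  sequence makes the pairings with rational boxes converge, and density transfers this to all of \<open>L\<^bsub>p'\<^esub>\<close>.\<close>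

lemma weak_Cauchy_subseq:
  fixes f :: "nat \<Rightarrow> 'a::euclidean_space \<Rightarrow> complex"
  assumes f: "\<And>n. f n \<in> bLp p" and B: "\<And>n. Lp_pow p (f n) \<le> B" and p: "p > 1" "p' > 1" "1/p + 1/p' = 1"
  obtains \<sigma> :: "nat \<Rightarrow> nat" where "strict_mono \<sigma>"
    "\<And>\<phi>. \<phi> \<in> bLp p' \<Longrightarrow> convergent (\<lambda>n. LINT x|lborel. f (\<sigma> n) x * \<phi> x)"
proof -
  have B0: "B \<ge> 0" using B[of 0] Lp_pow_nonneg[of p "f 0"] by simp
  have box: "indicator S \<in> bLp p'" if "S \<in> ratbox" for S :: "'a set"
    using that by (intro bLp_indicator) (auto simp: ratbox_def emeasure_lborel_box_finite[simplified])
  have Hoelder: "norm (LINT x|lborel. f n x * \<phi> x) \<le> B powr (1/p) * Lp_pow p' \<phi> powr (1/p')" if "\<phi> \<in> bLp p'" for n \<phi>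
  proof -
    have "norm (LINT x|lborel. f n x * \<phi> x) \<le> Lp_pow p (f n) powr (1/p) * Lp_pow p' \<phi> powr (1/p')"
      by (rule bLp_Hoelder[OF f that p])
    also have "\<dots> \<le> B powr (1/p) * Lp_pow p' \<phi> powr (1/p')"
      using p B Lp_pow_nonneg by (intro mult_right_mono powr_mono2) auto
    finally show ?thesis .
  qed
  define c where "c S = Lp_pow p' (indicator S :: 'a \<Rightarrow> complex) powr (1/p') + 1" for S
  have c: "c S > 0" for S by (simp add: c_def add_nonneg_pos)
  define u where "u n S = (LINT x|lborel. f n x * indicator S x) / of_real (c S)" for n S
  have ub: "norm (u n S) \<le> B powr (1/p)" if "S \<in> ratbox" for n S
  proof -
    have "norm (LINT x|lborel. f n x * indicator S x) \<le> B powr (1/p) * c S"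
      by (rule order.trans[OF Hoelder[OF box[OF that]]]) (simp add: c_def mult_left_mono)
    then show ?thesis using c[of S] by (simp add: u_def norm_divide field_simps)
  qed
  obtain \<sigma> where \<sigma>: "strict_mono (\<sigma> :: nat \<Rightarrow> nat)" "\<And>S. S \<in> ratbox \<Longrightarrow> \<exists>l. (\<lambda>n. u (\<sigma> n) S) \<longlonglongrightarrow> l"
    using function_convergent_subsequence[OF countable_ratbox, of u "B powr (1/p)"] ub by blast
  have "convergent (\<lambda>n. LINT x|lborel. f (\<sigma> n) x * \<phi> x)" if phi: "\<phi> \<in> bLp p'" for \<phi>
    using phi
  proof (rule bLp_density_induct)
    show "p' > 0" using p by simp
    fix S :: "'a set" assume S: "S \<in> ratbox"
    then obtain l where "(\<lambda>n. u (\<sigma> n) S) \<longlonglongrightarrow> l" using \<sigma>(2) by blast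
    then have "(\<lambda>n. u (\<sigma> n) S * of_real (c S)) \<longlonglongrightarrow> l * of_real (c S)" by (intro tendsto_intros)
    then show "convergent (\<lambda>n. LINT x|lborel. f (\<sigma> n) x * indicator S x)"
      using c[of S] by (auto simp: u_def convergent_def)
  next
    fix a \<psi> assume "convergent (\<lambda>n. LINT x|lborel. f (\<sigma> n) x * \<psi> x)"
    then have "convergent (\<lambda>n. a * (LINT x|lborel. f (\<sigma> n) x * \<psi> x))"
      by (intro convergent_mult convergent_const)
    then show "convergent (\<lambda>n. LINT x|lborel. f (\<sigma> n) x * (a * \<psi> x))"
      by (simp add: mult.left_commute)
  next
    fix \<psi> \<eta> assume *: "\<psi> \<in> bLp p'" "\<eta> \<in> bLp p'" "convergent (\<lambda>n. LINT x|lborel. f (\<sigma> n) x * \<psi> x)"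
       "convergent (\<lambda>n. LINT x|lborel. f (\<sigma> n) x * \<eta> x)"
    have "(LINT x|lborel. f (\<sigma> n) x * (\<psi> x + \<eta> x)) = (LINT x|lborel. f (\<sigma> n) x * \<psi> x) + (LINT x|lborel. f (\<sigma> n) x * \<eta> x)" for n
      using bLp_Young_integrable(1)[OF f *(1) p] bLp_Young_integrable(1)[OF f *(2) p] by (simp add: distrib_left)
    then show "convergent (\<lambda>n. LINT x|lborel. f (\<sigma> n) x * (\<psi> x + \<eta> x))"
      using convergent_add[OF *(3,4)] by simp
  next
    fix \<psi> F assume F: "\<And>m. F m \<in> bLp p'" "\<And>m. convergent (\<lambda>n. LINT x|lborel. f (\<sigma> n) x * F m x)"
      and psi: "\<psi> \<in> bLp p'" and lim: "(\<lambda>m. Lp_pow p' (\<lambda>x. F m x - \<psi> x)) \<longlonglongrightarrow> 0"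
    have Fp: "(\<lambda>x. F m x - \<psi> x) \<in> bLp p'" for m using p by (intro bLp_diff F psi) auto
    have "(\<lambda>m. B powr (1/p) * Lp_pow p' (\<lambda>x. F m x - \<psi> x) powr (1/p')) \<longlonglongrightarrow> B powr (1/p) * 0 powr (1/p')"
      using p by (intro tendsto_intros tendsto_powr' lim) (auto simp: Lp_pow_nonneg)
    then have lim': "(\<lambda>m. B powr (1/p) * Lp_pow p' (\<lambda>x. F m x - \<psi> x) powr (1/p')) \<longlonglongrightarrow> 0" by simp
    have diff: "norm ((LINT x|lborel. f n x * F m x) - (LINT x|lborel. f n x * \<psi> x)) \<le> B powr (1/p) * Lp_pow p' (\<lambda>x. F m x - \<psi> x) powr (1/p')" for n m
    proof -
      have "(LINT x|lborel. f n x * F m x) - (LINT x|lborel. f n x * \<psi> x) = (LINT x|lborel. f n x * (F m x - \<psi> x))"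
        using bLp_Young_integrable(1)[OF f F(1) p] bLp_Young_integrable(1)[OF f psi p] by (simp add: right_diff_distrib)
      then show ?thesis using Hoelder[OF Fp] by simp
    qed
    show "convergent (\<lambda>n. LINT x|lborel. f (\<sigma> n) x * \<psi> x)"
      unfolding Cauchy_convergent_iff[symmetric]
    proof (rule metric_CauchyI)
      fix e :: real assume e: "e > 0"
      have "\<forall>\<^sub>F m in sequentially. B powr (1/p) * Lp_pow p' (\<lambda>x. F m x - \<psi> x) powr (1/p') < e/3"
        using lim' e by (intro order_tendstoD(2)) auto
      then obtain m where m: "B powr (1/p) * Lp_pow p' (\<lambda>x. F m x - \<psi> x) powr (1/p') < e/3"
        by (auto simp: eventually_sequentially)
      have close: "dist (LINT x|lborel. f n x * F m x) (LINT x|lborel. f n x * \<psi> x) < e/3" for n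
        using diff[of n m] m by (simp add: dist_norm)
      have "Cauchy (\<lambda>n. LINT x|lborel. f (\<sigma> n) x * F m x)" using F(2)[of m] by (simp add: Cauchy_convergent_iff)
      from metric_CauchyD[OF this, of "e/3"] e
      obtain N where N: "\<And>i j. i \<ge> N \<Longrightarrow> j \<ge> N \<Longrightarrow> dist (LINT x|lborel. f (\<sigma> i) x * F m x) (LINT x|lborel. f (\<sigma> j) x * F m x) < e/3"
        by auto
      show "\<exists>M. \<forall>i\<ge>M. \<forall>j\<ge>M. dist (LINT x|lborel. f (\<sigma> i) x * \<psi> x) (LINT x|lborel. f (\<sigma> j) x * \<psi> x) < e"
      proof (intro exI allI impI)
        fix i j assume "i \<ge> N" "j \<ge> N"
        then have "dist (LINT x|lborel. f (\<sigma> i) x * F m x) (LINT x|lborel. f (\<sigma> j) x * F m x) < e/3" by (rule N)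
        then show "dist (LINT x|lborel. f (\<sigma> i) x * \<psi> x) (LINT x|lborel. f (\<sigma> j) x * \<psi> x) < e"
          using close[of "\<sigma> i"] close[of "\<sigma> j"]
            dist_triangle3[of "LINT x|lborel. f (\<sigma> i) x * \<psi> x" "LINT x|lborel. f (\<sigma> j) x * F m x" "LINT x|lborel. f (\<sigma> i) x * F m x"]
            dist_triangle[of "LINT x|lborel. f (\<sigma> i) x * \<psi> x" "LINT x|lborel. f (\<sigma> j) x * \<psi> x" "LINT x|lborel. f (\<sigma> j) x * F m x"]
          by linarith
      qed
    qed
  qed
  with \<sigma>(1) show thesis by (rule that)
qed

section \<open>Existence of a maximizer for approximable kernels\<close>

lemma powr_superadditive:
  fixes x y \<theta> :: real
  assumes "0 < x" "0 < y" "1 < \<theta>"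
  shows "x powr \<theta> + y powr \<theta> < (x + y) powr \<theta>"
proof -
  have "x powr \<theta> = x * x powr (\<theta> - 1)" "y powr \<theta> = y * y powr (\<theta> - 1)"
    "(x + y) powr \<theta> = (x + y) * (x + y) powr (\<theta> - 1)"
    using assms by (simp_all add: powr_mult_base)
  moreover have "x * x powr (\<theta> - 1) < x * (x + y) powr (\<theta> - 1)"
    "y * y powr (\<theta> - 1) < y * (x + y) powr (\<theta> - 1)"
    using assms by (auto intro!: mult_strict_left_mono powr_less_mono2)
  ultimately show ?thesis by (simp add: distrib_right)
qed

context hls_exponents
begin

lemma hls_exponents_dual: "hls_exponents r' q p'"
proof
  show "1 < r'" by (rule r'_gt1)
  have "1/r < 1/p" using p_gt1 p_less_r by (simp add: field_simps)
  then have "1/p' < 1/r'" using conj_p inv_r' by linarith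
  then show "r' < p'" using p'_gt1 r'_gt1 by (simp add: field_simps)
  show "1/r' + 1/q = 1 + 1/p'" using conj_p inv_r' pqr by simp
qed

lemma expo_dual_p': "(p' - 1) * p = p'" using p_gt1 by (simp add: p'_def field_simps)

text \<open>The \<open>r\<close>-th power of the operator norm of the convolution with \<open>k\<close>.\<close>

definition conv_norm_pow :: "('a::euclidean_space \<Rightarrow> complex) \<Rightarrow> real" where
  "conv_norm_pow k = (SUP f\<in>{f \<in> bLp p. Lp_pow p f \<le> 1}. Lp_pow r (conv k f))"

text \<open>Formally this is the Euler-Lagrange map of the quotient of the two norms, without normalization.\<close>

definition dual_step :: "('a::euclidean_space \<Rightarrow> complex) \<Rightarrow> ('a \<Rightarrow> complex) \<Rightarrow> 'a \<Rightarrow> complex" where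
  "dual_step k f = (\<lambda>x. dual_map p' (conv (reflect k) (\<lambda>x. dual_map r (conv k f x)) x))"

lemma conv_norm_pow_bdd:
  fixes k :: "'a::euclidean_space \<Rightarrow> complex"
  assumes "weak_Lq q A k" "A > 0"
  shows "bdd_above ((\<lambda>f. Lp_pow r (conv k f)) ` {f \<in> bLp p. Lp_pow p f \<le> 1})"
proof (rule bdd_aboveI2)
  fix f :: "'a \<Rightarrow> complex" assume f: "f \<in> {f \<in> bLp p. Lp_pow p f \<le> 1}"
  have "Lp_pow r (conv k f) \<le> (hls_const * A powr (1/q)) powr r * Lp_pow p f powr (r/p)"
    by (rule hls_conv(2)) (use assms f in auto)
  also have "\<dots> \<le> (hls_const * A powr (1/q)) powr r * 1 powr (r/p)"
    using f Lp_pow_nonneg[of p f] p_gt1 r_gt1 by (intro mult_left_mono powr_mono2) auto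
  finally show "Lp_pow r (conv k f) \<le> (hls_const * A powr (1/q)) powr r * 1 powr (r/p)" .
qed

lemma conv_cmult: "conv k (\<lambda>x. c * f x) x = c * conv k f x"
  unfolding conv_def by (subst integral_mult_right_zero[symmetric]) (simp add: mult_ac)

lemma Lp_pow_zero_imp_AE:
  assumes "f \<in> bLp a" "Lp_pow a f = 0"
  shows "AE x in lborel. f x = 0"
proof -
  have "AE x in lborel. norm (f x) powr a = 0"
    using integral_nonneg_eq_0_iff_AE[OF bLp_integrable[OF assms(1)]] assms(2) by (simp add: Lp_pow_def)
  then show ?thesis by eventually_elim simp
qed

lemma normalize_Lp_pow:
  fixes f :: "'a::euclidean_space \<Rightarrow> complex"
  assumes f: "f \<in> bLp p" and pos: "Lp_pow p f > 0"
  defines "c \<equiv> of_real (Lp_pow p f powr (- 1/p)) :: complex"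
  shows "(\<lambda>x. c * f x) \<in> bLp p" "Lp_pow p (\<lambda>x. c * f x) = 1"
    "Lp_pow r (conv k (\<lambda>x. c * f x)) = Lp_pow r (conv k f) / Lp_pow p f powr (r/p)"
proof -
  show "(\<lambda>x. c * f x) \<in> bLp p" by (rule bLp_cmult[OF f])
  show "Lp_pow p (\<lambda>x. c * f x) = 1"
    unfolding Lp_pow_cmult c_def using pos p_gt1 by (simp add: norm_divide powr_divide powr_powr powr_minus field_simps)
  have "Lp_pow r (conv k (\<lambda>x. c * f x)) = norm c powr r * Lp_pow r (conv k f)"
    by (simp add: conv_cmult[abs_def] Lp_pow_cmult)
  also have "norm c powr r = inverse (Lp_pow p f powr (r/p))"
    using powr_minus[of "Lp_pow p f" "r/p"] by (simp add: c_def powr_powr)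
  finally show "Lp_pow r (conv k (\<lambda>x. c * f x)) = Lp_pow r (conv k f) / Lp_pow p f powr (r/p)"
    by (simp add: divide_inverse mult.commute)
qed

lemma conv_norm_pow_bound:
  fixes k :: "'a::euclidean_space \<Rightarrow> complex"
  assumes k: "weak_Lq q A k" "A > 0" and f: "f \<in> bLp p"
  shows "Lp_pow r (conv k f) \<le> conv_norm_pow k * Lp_pow p f powr (r/p)"
proof (cases "Lp_pow p f = 0")
  case True
  have "Lp_pow r (conv k f) \<le> (hls_const * A powr (1/q)) powr r * Lp_pow p f powr (r/p)"
    by (rule hls_conv(2)) (use k f in auto)
  then show ?thesis using True by simp
next
  case False
  then have pos: "Lp_pow p f > 0" using Lp_pow_nonneg[of p f] by simp
  note n = normalize_Lp_pow[OF f pos]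
  have "Lp_pow r (conv k f) / Lp_pow p f powr (r/p) \<le> conv_norm_pow k"
    unfolding n(3)[symmetric] conv_norm_pow_def
    by (rule cSUP_upper[OF _ conv_norm_pow_bdd[OF k]]) (use n in auto)
  then show ?thesis using pos by (simp add: field_simps)
qed

text \<open>Write \<open>g\<close> for the dual function of \<open>k * f\<close> and \<open>h\<close> for the image of \<open>g\<close> under the transposed operator; then
  \<open>F\<close> is the dual function of \<open>h\<close>. The pairing \<open>\<langle>f, h\<rangle> = \<langle>k * f, g\<rangle> = \<integral>|k * f|\<^sup>r\<close> bounds the norm of \<open>h\<close> from
  below by Hoelder's inequality, and \<open>\<langle>k * F, g\<rangle> = \<langle>F, h\<rangle> = \<integral>|h|\<^bsup>p'\<^esup>\<close> bounds the norm of \<open>k * F\<close> from below.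
  Together they say that the quotient for \<open>F\<close> is at least that for \<open>f\<close>, provided that the norm of \<open>f\<close> is
  at most \<open>1\<close>. The other two bounds keep the norm of \<open>F\<close> away from \<open>0\<close> and infinity.\<close>

lemma dual_step:
  fixes k :: "'a::euclidean_space \<Rightarrow> complex"
  assumes k: "weak_Lq q A k" "A > 0" and f: "f \<in> bLp p" "Lp_pow p f \<le> 1" and m: "Lp_pow r (conv k f) > 0"
  defines "F \<equiv> dual_step k f"
  shows "F \<in> bLp p"
    and "Lp_pow r (conv k f) powr p' \<le> Lp_pow p F"
    and "Lp_pow r (conv k f) * Lp_pow p F powr (r/p) \<le> Lp_pow r (conv k F)"
    and "Lp_pow p F \<le> (hls_exponents.hls_const r' q p' * A powr (1/q)) powr p' * Lp_pow r (conv k f) powr (p'/r')"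
proof -
  interpret d: hls_exponents r' q p' by (rule hls_exponents_dual)
  define g where "g = (\<lambda>x. dual_map r (conv k f x))"
  define h where "h = conv (reflect k) g"
  have Fh: "F = (\<lambda>x. dual_map p' (h x))" by (simp add: F_def dual_step_def h_def g_def)
  define M where "M = Lp_pow r (conv k f)"
  define a where "a = Lp_pow p F"
  define b where "b = Lp_pow r (conv k F)"
  have kf: "conv k f \<in> bLp r" by (rule hls_conv(1)[OF k f(1)])
  have g: "g \<in> bLp r'" "Lp_pow r' g = M"
    unfolding g_def M_def using bLp_dual_map[OF kf r_gt1 expo_dual] Lp_pow_dual_map[OF kf r_gt1 expo_dual] by auto
  have rk: "weak_Lq q A (reflect k)" using weak_Lq_reflect[OF k(1)] by (simp add: reflect_def[abs_def])
  have h: "h \<in> bLp p'" unfolding h_def by (rule d.hls_conv(1)[OF rk k(2) g(1)])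
  have F: "F \<in> bLp p" "Lp_pow p F = Lp_pow p' h"
    unfolding Fh using bLp_dual_map[OF h p'_gt1 expo_dual_p'] Lp_pow_dual_map[OF h p'_gt1 expo_dual_p'] by auto
  show "F \<in> bLp p" by fact
  have M0: "M > 0" using m by (simp add: M_def)
  have "of_real M = (LINT x|lborel. complex_of_real (norm (conv k f x) powr r))"
    by (simp add: M_def Lp_pow_def)
  also have "\<dots> = (LINT x|lborel. conv k f x * g x)" by (simp add: g_def mult_dual_map)
  also have "\<dots> = (LINT x|lborel. f x * h x)" unfolding h_def by (rule conv_pairing[OF k f(1) g(1)])
  finally have "norm (of_real M :: complex) \<le> Lp_pow p f powr (1/p) * Lp_pow p' h powr (1/p')"
    using bLp_Hoelder[OF f(1) h p_gt1 p'_gt1 conj_p] by simp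
  also have "\<dots> \<le> 1 * Lp_pow p' h powr (1/p')"
    using f Lp_pow_nonneg[of p f] p_gt1 by (intro mult_right_mono) (auto intro: powr_le1)
  finally have Ma: "M \<le> a powr (1/p')" using M0 F(2) by (simp add: a_def)
  then have "M powr p' \<le> (a powr (1/p')) powr p'" using M0 p'_gt1 by (intro powr_mono2) auto
  then show ap: "Lp_pow r (conv k f) powr p' \<le> Lp_pow p F"
    using p'_gt1 Lp_pow_nonneg[of p F] by (simp add: powr_powr a_def M_def)
  have a0: "a > 0" using ap M0 less_le_trans[of 0 "M powr p'" a] by (simp add: a_def M_def)
  have Fk: "conv k F \<in> bLp r" by (rule hls_conv(1)[OF k F(1)])
  have "of_real a = (LINT x|lborel. complex_of_real (norm (h x) powr p'))"
    unfolding a_def F(2) by (simp add: Lp_pow_def)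
  also have "\<dots> = (LINT x|lborel. F x * h x)" by (simp add: Fh mult_dual_map mult.commute)
  also have "\<dots> = (LINT x|lborel. conv k F x * g x)" unfolding h_def by (rule conv_pairing[OF k F(1) g(1), symmetric])
  finally have "norm (of_real a :: complex) \<le> b powr (1/r) * M powr (1/r')"
    using bLp_Hoelder[OF Fk g(1) r_gt1 r'_gt1 conj_r] g(2) by (simp add: b_def)
  then have "a \<le> b powr (1/r) * M powr (1/r')" using a0 by simp
  then have "a powr r \<le> (b powr (1/r) * M powr (1/r')) powr r" using a0 r_gt1 by (intro powr_mono2) auto
  also have "\<dots> = b * M powr (r/r')"
    using r_gt1 Lp_pow_nonneg[of r "conv k F"] by (simp add: powr_mult powr_powr b_def)
  also have "r/r' = r - 1" using r_gt1 by (simp add: r'_def)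
  finally have ab: "a powr r \<le> b * M powr (r - 1)" .
  have "a powr (r/p) * M powr r \<le> a powr (r/p) * (a powr (1/p')) powr r"
    using Ma M0 r_gt1 by (intro mult_left_mono powr_mono2) auto
  also have "\<dots> = a powr (r * (1/p + 1/p'))"
    using a0 by (simp add: powr_powr distrib_left flip: powr_add)
  also have "\<dots> = a powr r" by (simp add: conj_p)
  also note ab
  also have "M powr r = M * M powr (r - 1)" using M0 by (simp add: powr_mult_base)
  finally have "(M * a powr (r/p)) * M powr (r - 1) \<le> b * M powr (r - 1)" by (simp add: mult_ac)
  then have "M * a powr (r/p) \<le> b" using M0 by simp
  then show "Lp_pow r (conv k f) * Lp_pow p F powr (r/p) \<le> Lp_pow r (conv k F)" by (simp add: M_def a_def b_def)
  show "Lp_pow p F \<le> (hls_exponents.hls_const r' q p' * A powr (1/q)) powr p' * Lp_pow r (conv k f) powr (p'/r')"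
    using d.hls_conv(2)[OF rk k(2) g(1)] unfolding F(2) h_def g(2) by (simp add: M_def)
qed

text \<open>Interpolation between \<open>L\<^sub>s\<close> and \<open>L\<^sub>\<infinity>\<close> for some \<open>p < s < r\<close>: if \<open>|k' * f|\<close> were below \<open>\<delta>\<close> everywhere, then
  \<open>\<integral>|k' * f|\<^sup>r \<le> \<delta>\<^bsup>r-s\<^esup> \<integral>|k' * f|\<^sup>s\<close> would be too small. This is the step where \<open>p < r\<close> prevents the mass of a
  maximizing sequence from spreading out.\<close>

lemma tame_sup_lower_bound:
  fixes k' :: "'a::euclidean_space \<Rightarrow> complex"
  assumes k': "tame k'" and c: "c > 0"
  obtains \<delta> where "\<delta> > 0"
    "\<And>f. f \<in> bLp p \<Longrightarrow> Lp_pow p f \<le> B \<Longrightarrow> c \<le> Lp_pow r (conv k' f) \<Longrightarrow> \<exists>x. \<delta> \<le> norm (conv k' f x)"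
proof -
  define s where "s = (p + r) / 2"
  have s: "p < s" "s < r" using p_less_r by (auto simp: s_def)
  \<comment> \<open>the exponent for which the weak Young inequality maps \<open>L\<^sub>p\<close> to \<open>L\<^sub>s\<close>\<close>
  define a where "a = 1 / (1 + 1/s - 1/p)"
  have inva: "1/p + 1/a = 1 + 1/s" by (simp add: a_def)
  interpret e: hls_exponents p a s by standard (use p_gt1 s inva in auto)
  obtain A where A: "A > 0" "weak_Lq a A k'" using tame_weak_Lq[OF k', of a] e.q_gt1 by auto
  obtain A' where A': "A' > 0" "weak_Lq q A' k'" using tame_weak_Lq[OF k', of q] q_gt1 by auto
  define K where "K = (e.hls_const * A powr (1/a)) powr s * max B 0 powr (s/p) + 1"
  have K: "K > 0" by (simp add: K_def add_nonneg_pos)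
  define \<delta> where "\<delta> = (c / (2 * K)) powr (1/(r - s))"
  have delta: "\<delta> > 0" "\<delta> powr (r - s) = c / (2 * K)"
    using c K s by (auto simp: \<delta>_def powr_powr)
  show thesis
  proof (rule that[OF delta(1)])
    fix f :: "'a \<Rightarrow> complex" assume f: "f \<in> bLp p" "Lp_pow p f \<le> B" "c \<le> Lp_pow r (conv k' f)"
    show "\<exists>x. \<delta> \<le> norm (conv k' f x)"
    proof (rule ccontr)
      assume "\<not> ?thesis"
      then have less: "norm (conv k' f x) \<le> \<delta>" for x by (auto simp: not_le intro: less_imp_le)
      have ks: "conv k' f \<in> bLp s" "Lp_pow s (conv k' f) \<le> K"
      proof -
        show "conv k' f \<in> bLp s" by (rule e.hls_conv(1)[OF A(2,1) f(1)])
        have "Lp_pow s (conv k' f) \<le> (e.hls_const * A powr (1/a)) powr s * Lp_pow p f powr (s/p)"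
          by (rule e.hls_conv(2)[OF A(2,1) f(1)])
        also have "\<dots> \<le> (e.hls_const * A powr (1/a)) powr s * max B 0 powr (s/p)"
          using f Lp_pow_nonneg[of p f] p_gt1 s by (intro mult_left_mono powr_mono2) auto
        finally show "Lp_pow s (conv k' f) \<le> K" by (simp add: K_def)
      qed
      have "Lp_pow r (conv k' f) \<le> (LINT x|lborel. \<delta> powr (r - s) * norm (conv k' f x) powr s)"
        unfolding Lp_pow_def
      proof (intro integral_mono bLp_integrable hls_conv(1)[OF A'(2,1) f(1)] integrable_mult_right ks(1))
        fix x
        have "norm (conv k' f x) powr r = norm (conv k' f x) powr (r - s) * norm (conv k' f x) powr s"
          by (simp flip: powr_add)
        also have "\<dots> \<le> \<delta> powr (r - s) * norm (conv k' f x) powr s"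
          using less s by (intro mult_right_mono powr_mono2) auto
        finally show "norm (conv k' f x) powr r \<le> \<delta> powr (r - s) * norm (conv k' f x) powr s" .
      qed
      also have "\<dots> = c / (2 * K) * Lp_pow s (conv k' f)" by (simp add: delta(2) Lp_pow_def)
      also have "\<dots> \<le> c / (2 * K) * K" using ks c K by (intro mult_left_mono) auto
      also have "\<dots> < c" using c K by simp
      finally show False using f(3) by simp
    qed
  qed
qed

lemma dual_step_shift:
  assumes [measurable]: "k \<in> borel_measurable borel" "f \<in> borel_measurable borel"
  shows "dual_step k (\<lambda>x. f (x + z)) = (\<lambda>x. dual_step k f (x + z))"
proof -
  have [measurable]: "dual_map r \<in> borel_measurable borel" by (rule measurable_dual_map[OF r_gt1])
  have 1: "conv k (\<lambda>x. f (x + z)) = (\<lambda>x. conv k f (x + z))" by (intro ext conv_shift) auto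
  have [measurable]: "reflect k \<in> borel_measurable borel" unfolding reflect_def[abs_def] by measurable
  have m: "(\<lambda>x. dual_map r (conv k f x)) \<in> borel_measurable borel" by measurable
  have 2: "conv (reflect k) (\<lambda>x. dual_map r (conv k f (x + z))) = (\<lambda>x. conv (reflect k) (\<lambda>x. dual_map r (conv k f x)) (x + z))"
    by (intro ext conv_shift[OF _ m]) measurable
  show ?thesis unfolding dual_step_def 1 2 ..
qed

end

context hls_exponents
begin

text \<open>Apply the previous lemma to the dual steps \<open>F n\<close> of an arbitrary maximizing sequence and translate the
  point found there to the origin. Translating \<open>f n\<close> translates \<open>F n\<close> as well, because every map
  involved commutes with translations.\<close>

lemma nonvanishing_maximizing_sequence:
  fixes k :: "'a::euclidean_space \<Rightarrow> complex"
  assumes k: "approximable q k" and M: "conv_norm_pow k > 0"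
  obtains f k' \<delta> where "\<And>n. f n \<in> bLp p" "\<And>n. Lp_pow p (f n) \<le> 1"
    "\<And>n. conv_norm_pow k / 2 \<le> Lp_pow r (conv k (f n))"
    "(\<lambda>n. Lp_pow r (conv k (f n))) \<longlonglongrightarrow> conv_norm_pow k"
    "tame k'" "\<delta> > 0" "\<And>n::nat. \<delta> \<le> norm (conv k' (dual_step k (f n)) 0)"
proof -
  define M where "M = conv_norm_pow k"
  have M0: "M > 0" using M by (simp add: M_def)
  obtain A where A: "A > 0" "weak_Lq q A k" using k by (auto simp: approximable_def)
  note [measurable] = weak_Lq_measurable[OF A(2)]
  interpret d: hls_exponents r' q p' by (rule hls_exponents_dual)
  have "\<exists>f. f \<in> bLp p \<and> Lp_pow p f \<le> 1 \<and> M * (1 - 1 / real (n + 2)) < Lp_pow r (conv k f)" for n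
  proof -
    have "M * (1 - 1 / real (n + 2)) < M * 1" using M0 by (intro mult_strict_left_mono) auto
    then have "M * (1 - 1 / real (n + 2)) < (SUP f\<in>{f \<in> bLp p. Lp_pow p f \<le> 1}. Lp_pow r (conv k f))"
      by (simp add: M_def conv_norm_pow_def)
    moreover have "(\<lambda>x. 0) \<in> {f \<in> bLp p. Lp_pow p f \<le> 1}" by (simp add: bLp_zero Lp_pow_def)
    ultimately show ?thesis
      using less_cSUP_iff[OF _ conv_norm_pow_bdd[OF A(2,1)]] by blast
  qed
  then obtain f0 where f0: "\<And>n. f0 n \<in> bLp p" "\<And>n. Lp_pow p (f0 n) \<le> 1"
    "\<And>n. M * (1 - 1 / real (n + 2)) < Lp_pow r (conv k (f0 n))" by metis
  have half: "M / 2 \<le> Lp_pow r (conv k (f0 n))" for n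
  proof -
    have "1 / real (n + 2) \<le> 1 / 2" by (simp add: field_simps)
    then have "M * (1 / 2) \<le> M * (1 - 1 / real (n + 2))" using M0 by (intro mult_left_mono) linarith+
    then have "M * (1 / 2) < Lp_pow r (conv k (f0 n))" using f0(3)[of n] by (rule le_less_trans)
    then show ?thesis by simp
  qed
  have le: "Lp_pow r (conv k (f0 n)) \<le> M" for n
    unfolding M_def conv_norm_pow_def
    by (rule cSUP_upper[OF _ conv_norm_pow_bdd[OF A(2,1)]]) (use f0 in auto)
  have lim: "(\<lambda>n. Lp_pow r (conv k (f0 n))) \<longlonglongrightarrow> M"
  proof (rule tendsto_sandwich[OF _ _ _ tendsto_const])
    have "(\<lambda>n. 1 / real (n + 2)) \<longlonglongrightarrow> 0"
      using LIMSEQ_ignore_initial_segment[OF lim_1_over_n, of 2] by simp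
    then have "(\<lambda>n. M * (1 - 1 / real (n + 2))) \<longlonglongrightarrow> M * (1 - 0)" by (intro tendsto_intros)
    then show "(\<lambda>n. M * (1 - 1 / real (n + 2))) \<longlonglongrightarrow> M" by simp
    show "\<forall>\<^sub>F n in sequentially. M * (1 - 1 / real (n + 2)) \<le> Lp_pow r (conv k (f0 n))"
      by (intro always_eventually allI less_imp_le f0(3))
    show "\<forall>\<^sub>F n in sequentially. Lp_pow r (conv k (f0 n)) \<le> M"
      by (intro always_eventually allI le)
  qed
  have pos: "Lp_pow r (conv k (f0 n)) > 0" for n using half[of n] M0 by linarith
  define F where "F n = dual_step k (f0 n)" for n
  note S = dual_step[OF A(2,1) f0(1,2) pos]
  have F: "F n \<in> bLp p" for n unfolding F_def by (rule S(1))
  define a0 where "a0 = (M / 2) powr p'"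
  have a00: "a0 > 0" using M0 by (simp add: a0_def)
  have Flow: "a0 \<le> Lp_pow p (F n)" for n
  proof -
    have "a0 \<le> Lp_pow r (conv k (f0 n)) powr p'"
      unfolding a0_def using half M0 p'_gt1 by (intro powr_mono2) auto
    also have "\<dots> \<le> Lp_pow p (F n)" unfolding F_def by (rule S(2))
    finally show ?thesis .
  qed
  define B where "B = (d.hls_const * A powr (1/q)) powr p' * M powr (p'/r')"
  have Fup: "Lp_pow p (F n) \<le> B" for n
  proof -
    have "Lp_pow p (F n) \<le> (d.hls_const * A powr (1/q)) powr p' * Lp_pow r (conv k (f0 n)) powr (p'/r')"
      unfolding F_def by (rule S(4))
    also have "\<dots> \<le> B" unfolding B_def using le pos p'_gt1 r'_gt1
      by (intro mult_left_mono powr_mono2) (auto intro: less_imp_le)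
    finally show ?thesis .
  qed
  \<comment> \<open>chosen so that the error, including the factor \<open>2\<^sup>r\<close> of the triangle inequality, is at most half of the lower bound \<open>M/2\<close>\<close>
  define \<epsilon> where "\<epsilon> = ((M / (4 * 2 powr r)) powr (1/r) / hls_const) powr q"
  have eps: "\<epsilon> > 0" using M0 hls_const_pos by (simp add: \<epsilon>_def)
  have "hls_const * \<epsilon> powr (1/q) = (M / (4 * 2 powr r)) powr (1/r)"
    using q_gt1 hls_const_pos by (simp add: \<epsilon>_def powr_powr)
  then have eps': "(hls_const * \<epsilon> powr (1/q)) powr r = M / (4 * 2 powr r)"
    using r_gt1 M0 by (simp add: powr_powr)
  obtain k' where k': "tame k'" "weak_Lq q \<epsilon> (\<lambda>x. k x - k' x)" using k eps by (auto simp: approximable_def)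
  define e where "e = (\<lambda>x. k x - k' x)"
  have e: "weak_Lq q \<epsilon> e" using k' by (simp add: e_def)
  obtain A' where A': "A' > 0" "weak_Lq q A' k'" using tame_weak_Lq[OF k'(1), of q] q_gt1 by auto
  note [measurable] = weak_Lq_measurable[OF A'(2)]
  define c where "c = M / 4 * a0 powr (r/p) / 2 powr r"
  have c0: "c > 0" using M0 a00 by (simp add: c_def)
  have clow: "c \<le> Lp_pow r (conv k' (F n))" for n
  proof -
    have k'b: "conv k' (F n) \<in> bLp r" by (rule hls_conv(1)[OF A'(2,1) F])
    have eb: "conv e (F n) \<in> bLp r" by (rule hls_conv(1)[OF e eps F])
    have kb: "conv k (F n) \<in> bLp r" by (rule hls_conv(1)[OF A(2,1) F])
    have "AE x in lborel. conv k (F n) x = conv k' (F n) x + conv e (F n) x"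
      using conv_decompose_AE[OF conv_integrable_AE[OF A'(2,1) F] conv_integrable_AE[OF e eps F], of n]
      by (simp add: e_def)
    then have "Lp_pow r (conv k (F n)) = Lp_pow r (\<lambda>x. conv k' (F n) x + conv e (F n) x)"
      using bLp_measurable[OF kb] bLp_measurable[OF k'b] bLp_measurable[OF eb] by (intro Lp_pow_cong_AE) auto
    also have "\<dots> \<le> 2 powr r * (Lp_pow r (conv k' (F n)) + Lp_pow r (conv e (F n)))"
      using r_gt1 by (intro Lp_pow_add_le k'b eb) auto
    also have "Lp_pow r (conv e (F n)) \<le> M / (4 * 2 powr r) * Lp_pow p (F n) powr (r/p)"
      using hls_conv(2)[OF e eps F[of n]] by (simp add: eps')
    finally have 1: "Lp_pow r (conv k (F n)) \<le> 2 powr r * Lp_pow r (conv k' (F n)) + M / 4 * Lp_pow p (F n) powr (r/p)"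
      by (simp add: distrib_left)
    have "M / 2 * Lp_pow p (F n) powr (r/p) \<le> Lp_pow r (conv k (f0 n)) * Lp_pow p (F n) powr (r/p)"
      by (intro mult_right_mono half) auto
    also have "\<dots> \<le> Lp_pow r (conv k (F n))" unfolding F_def by (rule S(3))
    finally have "M / 4 * Lp_pow p (F n) powr (r/p) \<le> 2 powr r * Lp_pow r (conv k' (F n))" using 1 by simp
    moreover have "M / 4 * a0 powr (r/p) \<le> M / 4 * Lp_pow p (F n) powr (r/p)"
      using M0 a00 Flow p_gt1 r_gt1 by (intro mult_left_mono powr_mono2) auto
    ultimately show ?thesis by (simp add: c_def field_simps)
  qed
  obtain \<delta> where delta: "\<delta> > 0"
    "\<And>f. f \<in> bLp p \<Longrightarrow> Lp_pow p f \<le> B \<Longrightarrow> c \<le> Lp_pow r (conv k' f) \<Longrightarrow> \<exists>x. \<delta> \<le> norm (conv k' f x)"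
    using tame_sup_lower_bound[OF k'(1) c0] by blast
  have "\<forall>n. \<exists>x. \<delta> \<le> norm (conv k' (F n) x)" using delta(2)[OF F Fup clow] by blast
  then obtain z where z: "\<And>n. \<delta> \<le> norm (conv k' (F n) (z n))" by metis
  define f where "f n = (\<lambda>x. f0 n (x + z n))" for n
  have [measurable]: "f0 n \<in> borel_measurable borel" for n by (rule bLp_measurable[OF f0(1)])
  have kf: "conv k (f n) = (\<lambda>x. conv k (f0 n) (x + z n))" for n
    unfolding f_def by (intro ext conv_shift) measurable
  have kfp: "Lp_pow r (conv k (f n)) = Lp_pow r (conv k (f0 n))" for n
    unfolding kf by (rule Lp_pow_shift[OF hls_conv(1)[OF A(2,1) f0(1)]])
  have Ff: "dual_step k (f n) = (\<lambda>x. F n (x + z n))" for n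
    unfolding F_def f_def by (rule dual_step_shift) measurable
  show thesis
  proof (rule that[of f k' \<delta>])
    show "f n \<in> bLp p" "Lp_pow p (f n) \<le> 1" for n
      unfolding f_def using bLp_shift[OF f0(1)] Lp_pow_shift[OF f0(1)] f0(2) by auto
    show "conv_norm_pow k / 2 \<le> Lp_pow r (conv k (f n))" for n
      using half by (simp add: kfp M_def)
    show "(\<lambda>n. Lp_pow r (conv k (f n))) \<longlonglongrightarrow> conv_norm_pow k" using lim by (simp add: kfp M_def)
    show "tame k'" "\<delta> > 0" by fact+
    fix n
    have "conv k' (dual_step k (f n)) 0 = conv k' (F n) (0 + z n)"
      unfolding Ff by (rule conv_shift) (use bLp_measurable[OF F] in auto)
    then show "\<delta> \<le> norm (conv k' (dual_step k (f n)) 0)" using z by simp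
  qed
qed

text \<open>Successive subsequences make \<open>k * f\<^sub>n\<close>, then \<open>T\<^sup>t\<close> of its dual functions, then \<open>k * F\<^sub>n\<close>
  converge almost everywhere, and finally \<open>\<integral>|F\<^sub>n|\<^sup>p\<close> converge. The Brezis-Lieb lemma in \<open>L\<^sub>p\<close> and in \<open>L\<^sub>r\<close> and
  strict superadditivity of \<open>x\<^bsup>r/p\<^esup>\<close> then leave no room for a loss of mass.\<close>

lemma conv_has_maximizer_pos:
  fixes k :: "'a::euclidean_space \<Rightarrow> complex"
  assumes k: "approximable q k" and M: "conv_norm_pow k > 0"
  obtains F where "F \<in> bLp p" "Lp_pow p F > 0" "conv_norm_pow k * Lp_pow p F powr (r/p) \<le> Lp_pow r (conv k F)"
proof -
  define M where "M = conv_norm_pow k"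
  have M0: "M > 0" using M by (simp add: M_def)
  obtain A where A: "A > 0" "weak_Lq q A k" using k by (auto simp: approximable_def)
  note [measurable] = weak_Lq_measurable[OF A(2)]
  interpret d: hls_exponents r' q p' by (rule hls_exponents_dual)
  obtain f1 k' \<delta> where f1: "\<And>n. f1 n \<in> bLp p" "\<And>n. Lp_pow p (f1 n) \<le> 1"
    "\<And>n. M / 2 \<le> Lp_pow r (conv k (f1 n))" "(\<lambda>n. Lp_pow r (conv k (f1 n))) \<longlonglongrightarrow> M"
    and k': "tame k'" and delta: "\<delta> > 0" "\<And>n::nat. \<delta> \<le> norm (conv k' (dual_step k (f1 n)) 0)"
    using nonvanishing_maximizing_sequence[OF k M] unfolding M_def[symmetric] by blast
  obtain \<sigma>1 where s1: "strict_mono (\<sigma>1 :: nat \<Rightarrow> nat)" "\<And>\<phi>. \<phi> \<in> bLp p' \<Longrightarrow> convergent (\<lambda>n. LINT x|lborel. f1 (\<sigma>1 n) x * \<phi> x)"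
    using weak_Cauchy_subseq[of f1, OF f1(1,2) p_gt1 p'_gt1 conj_p] by blast
  obtain \<sigma>2 where s2: "strict_mono (\<sigma>2 :: nat \<Rightarrow> nat)" "AE x in lborel. convergent (\<lambda>n. conv k (f1 (\<sigma>1 (\<sigma>2 n))) x)"
    using weak_Cauchy_conv_AE[of k "\<lambda>n. f1 (\<sigma>1 n)", OF k f1(1,2) s1(2)] by blast
  define f2 where "f2 n = f1 (\<sigma>1 (\<sigma>2 n))" for n
  define g where "g n x = dual_map r (conv k (f2 n) x)" for n x
  \<comment> \<open>where the limit does not exist, \<open>lim\<close> has an unspecified value; this concerns a null set only\<close>
  define u where "u x = lim (\<lambda>n. conv k (f2 n) x)" for x
  define gl where "gl x = dual_map r (u x)" for x
  have [measurable]: "f2 n \<in> borel_measurable borel" for n unfolding f2_def by (rule bLp_measurable[OF f1(1)])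
  have um: "u \<in> borel_measurable borel" unfolding u_def by measurable
  have [measurable]: "dual_map r \<in> borel_measurable borel" by (rule measurable_dual_map[OF r_gt1])
  have glm: "gl \<in> borel_measurable borel" unfolding gl_def using um by measurable
  have glim: "AE x in lborel. (\<lambda>n. g n x) \<longlonglongrightarrow> gl x"
    using s2(2)
  proof eventually_elim
    case (elim x)
    then have "(\<lambda>n. conv k (f2 n) x) \<longlonglongrightarrow> u x" by (simp add: f2_def u_def convergent_LIMSEQ_iff)
    then show ?case unfolding g_def gl_def by (rule tendsto_dual_map[OF r_gt1])
  qed
  have m_le: "Lp_pow r (conv k (f1 n)) \<le> M" for n
    unfolding M_def conv_norm_pow_def
    by (rule cSUP_upper[OF _ conv_norm_pow_bdd[OF A(2,1)]]) (use f1 in auto)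
  have kf2: "conv k (f2 n) \<in> bLp r" for n unfolding f2_def by (rule hls_conv(1)[OF A(2,1) f1(1)])
  have gb: "g n \<in> bLp r'" "Lp_pow r' (g n) \<le> M" for n
    unfolding g_def using bLp_dual_map[OF kf2 r_gt1 expo_dual] Lp_pow_dual_map[OF kf2 r_gt1 expo_dual] m_le
    by (auto simp: f2_def)
  have glb: "gl \<in> bLp r'"
    by (rule bLp_Fatou(1)[OF gb(1) glm glim gb(2)]) (use r'_gt1 in simp)
  have rk: "approximable q (reflect k)" using approximable_reflect[OF k] by (simp add: reflect_def[abs_def])
  obtain \<sigma>3 where s3: "strict_mono (\<sigma>3 :: nat \<Rightarrow> nat)" "AE x in lborel. (\<lambda>n. conv (reflect k) (g (\<sigma>3 n)) x) \<longlonglongrightarrow> conv (reflect k) gl x"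
    using d.AE_lim_conv_AE[of "reflect k" g, OF rk gb(1,2) glb glim] by blast
  define f3 where "f3 n = f2 (\<sigma>3 n)" for n
  define F where "F x = dual_map p' (conv (reflect k) gl x)" for x
  have f3: "f3 n \<in> bLp p" "Lp_pow p (f3 n) \<le> 1" "M / 2 \<le> Lp_pow r (conv k (f3 n))" for n
    using f1 by (auto simp: f3_def f2_def)
  have f3pos: "0 < Lp_pow r (conv k (f3 n))" for n using f3(3)[of n] M0 by linarith
  note S = dual_step[OF A(2,1) f3(1,2) f3pos]
  define Fs where "Fs n = dual_step k (f3 n)" for n
  have Fs: "Fs n \<in> bLp p" for n unfolding Fs_def by (rule S(1))
  have Fslim: "AE x in lborel. (\<lambda>n. Fs n x) \<longlonglongrightarrow> F x"
    using s3(2)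
  proof eventually_elim
    case (elim x)
    have "Fs n x = dual_map p' (conv (reflect k) (g (\<sigma>3 n)) x)" for n
      by (simp add: Fs_def dual_step_def f3_def g_def[abs_def])
    then show ?case unfolding F_def using tendsto_dual_map[OF p'_gt1 elim] by simp
  qed
  obtain A2 where A2: "A2 > 0" "weak_Lq q A2 (reflect k)" using rk by (auto simp: approximable_def)
  have F: "F \<in> bLp p"
    unfolding F_def by (rule bLp_dual_map[OF d.hls_conv(1)[OF A2(2,1) glb] p'_gt1 expo_dual_p'])
  define B where "B = (d.hls_const * A powr (1/q)) powr p' * M powr (p'/r')"
  have Fup: "Lp_pow p (Fs n) \<le> B" for n
  proof -
    have "Lp_pow p (Fs n) \<le> (d.hls_const * A powr (1/q)) powr p' * Lp_pow r (conv k (f3 n)) powr (p'/r')"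
      unfolding Fs_def by (rule S(4))
    also have "\<dots> \<le> B" unfolding B_def using m_le f3pos p'_gt1 r'_gt1
      by (intro mult_left_mono powr_mono2) (auto intro: less_imp_le simp: f3_def f2_def)
    finally show ?thesis .
  qed
  obtain \<sigma>4 where s4: "strict_mono (\<sigma>4 :: nat \<Rightarrow> nat)" "AE x in lborel. (\<lambda>n. conv k (Fs (\<sigma>4 n)) x) \<longlonglongrightarrow> conv k F x"
    using AE_lim_conv_AE[of k Fs, OF k Fs Fup F Fslim] by blast
  have "bounded (range (\<lambda>n. Lp_pow p (Fs (\<sigma>4 n))))"
    using Fup by (intro boundedI[of _ B]) (auto simp: Lp_pow_nonneg)
  then obtain \<alpha> \<sigma>5 where s5: "strict_mono (\<sigma>5 :: nat \<Rightarrow> nat)" "((\<lambda>n. Lp_pow p (Fs (\<sigma>4 n))) \<circ> \<sigma>5) \<longlonglongrightarrow> \<alpha>"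
    using bounded_imp_convergent_subsequence by blast
  define \<tau> where "\<tau> n = \<sigma>4 (\<sigma>5 n)" for n
  have tau: "strict_mono \<tau>" using s4(1) s5(1) by (simp add: \<tau>_def strict_mono_def)
  define G where "G n = Fs (\<tau> n)" for n
  have G: "G n \<in> bLp p" "Lp_pow p (G n) \<le> B" for n using Fs Fup by (auto simp: G_def)
  have Glim: "AE x in lborel. (\<lambda>n. G n x) \<longlonglongrightarrow> F x"
    using Fslim by eventually_elim (use LIMSEQ_subseq_LIMSEQ[OF _ tau] in \<open>auto simp: G_def o_def\<close>)
  have kGlim: "AE x in lborel. (\<lambda>n. conv k (G n) x) \<longlonglongrightarrow> conv k F x"
    using s4(2) by eventually_elim (use LIMSEQ_subseq_LIMSEQ[OF _ s5(1)] in \<open>auto simp: G_def \<tau>_def o_def\<close>)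
  have alim: "(\<lambda>n. Lp_pow p (G n)) \<longlonglongrightarrow> \<alpha>" using s5(2) by (simp add: o_def G_def \<tau>_def)
  have \<theta>: "r/p > 1" using p_gt1 p_less_r by simp
  have GF: "(\<lambda>x. G n x - F x) \<in> bLp p" for n using p_gt1 by (intro bLp_diff G F) auto
  \<comment> \<open>pairing with the fixed function \<open>k' (0 - y)\<close> passes to the limit, so the lower bound \<open>\<delta>\<close> does too\<close>
  have ne: "Lp_pow p F > 0"
  proof (rule ccontr)
    assume "\<not> Lp_pow p F > 0"
    then have "Lp_pow p F = 0" using Lp_pow_nonneg[of p F] by simp
    then have F0: "AE x in lborel. F x = 0" by (rule Lp_pow_zero_imp_AE[OF F])
    have "AE x in lborel. (\<lambda>n. G n x) \<longlonglongrightarrow> 0" using Glim F0 by eventually_elim simp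
    moreover have "(\<lambda>y. k' (0 - y)) \<in> bLp p'" using p'_gt1 by (intro bLp_reflect_shift tame_bLp[OF k']) auto
    ultimately have "(\<lambda>n. LINT x|lborel. G n x * k' (0 - x)) \<longlonglongrightarrow> 0"
      by (intro AE_lim_imp_weak_null[OF G(1) _ p_gt1 p'_gt1 conj_p _ G(2)])
    then have "(\<lambda>n. conv k' (G n) 0) \<longlonglongrightarrow> 0" by (simp add: conv_def mult.commute)
    then have "(\<lambda>n. norm (conv k' (G n) 0)) \<longlonglongrightarrow> 0" by (rule tendsto_norm_zero)
    then have "\<delta> \<le> 0"
      by (rule tendsto_lowerbound) (use delta(2) in \<open>auto simp: G_def Fs_def f3_def f2_def\<close>)
    then show False using delta(1) by simp
  qed
  have ratio: "Lp_pow r (conv k (f3 (\<tau> n))) * Lp_pow p (G n) powr (r/p) \<le> Lp_pow r (conv k (G n))" for n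
    unfolding G_def Fs_def by (rule S(3))
  have kG: "conv k (G n) \<in> bLp r" and kF: "conv k F \<in> bLp r" for n
    by (rule hls_conv(1)[OF A(2,1) G(1)]) (rule hls_conv(1)[OF A(2,1) F])
  have f3lim: "(\<lambda>n. Lp_pow r (conv k (f3 (\<tau> n)))) \<longlonglongrightarrow> M"
  proof -
    have "strict_mono (\<lambda>n. \<sigma>1 (\<sigma>2 (\<sigma>3 (\<tau> n))))"
      using s1(1) s2(1) s3(1) tau by (simp add: strict_mono_def)
    from LIMSEQ_subseq_LIMSEQ[OF f1(4) this] show ?thesis by (simp add: o_def f3_def f2_def)
  qed
  have alpha_F: "(\<lambda>n. Lp_pow p (\<lambda>x. G n x - F x)) \<longlonglongrightarrow> \<alpha> - Lp_pow p F"
  proof -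
    have "(\<lambda>n. Lp_pow p (G n) - Lp_pow p (\<lambda>x. G n x - F x)) \<longlonglongrightarrow> Lp_pow p F"
      by (rule brezis_lieb[OF G(1) F _ Glim G(2)]) (use p_gt1 in simp)
    from tendsto_diff[OF alim this] show ?thesis by simp
  qed
  have alphaF: "Lp_pow p F \<le> \<alpha>"
    using tendsto_lowerbound[OF alpha_F, of 0] by (simp add: Lp_pow_nonneg)
  have kGB: "Lp_pow r (conv k (G n)) \<le> M * B powr (r/p)" for n
  proof -
    have "Lp_pow r (conv k (G n)) \<le> M * Lp_pow p (G n) powr (r/p)"
      unfolding M_def by (rule conv_norm_pow_bound[OF A(2,1) G(1)])
    also have "\<dots> \<le> M * B powr (r/p)"
      using M0 G(2) \<theta> Lp_pow_nonneg by (intro mult_left_mono powr_mono2) auto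
    finally show ?thesis .
  qed
  have kdiff: "Lp_pow r (\<lambda>x. conv k (G n) x - conv k F x) \<le> M * Lp_pow p (\<lambda>x. G n x - F x) powr (r/p)" for n
  proof -
    have "AE x in lborel. conv k (\<lambda>x. G n x - F x) x = conv k (G n) x - conv k F x"
      by (intro conv_diff_AE conv_integrable_AE[OF A(2,1)] G F)
    then have "Lp_pow r (\<lambda>x. conv k (G n) x - conv k F x) = Lp_pow r (conv k (\<lambda>x. G n x - F x))"
      using bLp_measurable[OF hls_conv(1)[OF A(2,1) GF]] bLp_measurable[OF kG] bLp_measurable[OF kF]
      by (intro Lp_pow_cong_AE) auto
    also have "\<dots> \<le> M * Lp_pow p (\<lambda>x. G n x - F x) powr (r/p)"
      unfolding M_def by (rule conv_norm_pow_bound[OF A(2,1) GF])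
    finally show ?thesis .
  qed
  have BLr: "(\<lambda>n. Lp_pow r (conv k (G n)) - Lp_pow r (\<lambda>x. conv k (G n) x - conv k F x)) \<longlonglongrightarrow> Lp_pow r (conv k F)"
    by (rule brezis_lieb[OF kG kF _ kGlim kGB]) (use r_gt1 in simp)
  have "(\<lambda>n. Lp_pow r (conv k (f3 (\<tau> n))) * Lp_pow p (G n) powr (r/p) - M * Lp_pow p (\<lambda>x. G n x - F x) powr (r/p))
     \<longlonglongrightarrow> M * \<alpha> powr (r/p) - M * (\<alpha> - Lp_pow p F) powr (r/p)"
    using \<theta> by (intro tendsto_intros tendsto_powr' f3lim alim alpha_F) (auto simp: Lp_pow_nonneg)
  \<comment> \<open>the left-hand sequence is below the Brezis-Lieb sequence of \<open>k * G n\<close>, term by term\<close>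
  from this BLr have main: "M * \<alpha> powr (r/p) - M * (\<alpha> - Lp_pow p F) powr (r/p) \<le> Lp_pow r (conv k F)"
    by (rule LIMSEQ_le) (intro exI[of _ 0] allI impI diff_mono ratio kdiff)
  have upper: "Lp_pow r (conv k F) \<le> M * Lp_pow p F powr (r/p)"
    unfolding M_def by (rule conv_norm_pow_bound[OF A(2,1) F])
  have "\<alpha> = Lp_pow p F"
  proof (rule ccontr)
    assume "\<alpha> \<noteq> Lp_pow p F"
    then have "0 < \<alpha> - Lp_pow p F" using alphaF by simp
    from powr_superadditive[OF ne this \<theta>]
    have "M * (Lp_pow p F powr (r/p) + (\<alpha> - Lp_pow p F) powr (r/p)) < M * \<alpha> powr (r/p)"
      using M0 by (intro mult_strict_left_mono) auto
    with main upper show False by (simp add: distrib_left)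
  qed
  with main have "M * Lp_pow p F powr (r/p) \<le> Lp_pow r (conv k F)" by simp
  with F ne show thesis by (intro that) (auto simp: M_def)
qed

text \<open>If the operator vanishes, every function of norm \<open>1\<close> is a maximizer; the unit cube provides one.\<close>

theorem conv_has_maximizer:
  fixes k :: "'a::euclidean_space \<Rightarrow> complex"
  assumes k: "approximable q k"
  obtains f where "f \<in> bLp p" "Lp_pow p f = 1"
    "\<And>g. g \<in> bLp p \<Longrightarrow> Lp_pow p g \<le> 1 \<Longrightarrow> Lp_pow r (conv k g) \<le> Lp_pow r (conv k f)"
proof -
  obtain A where A: "A > 0" "weak_Lq q A k" using k by (auto simp: approximable_def)
  have sup: "Lp_pow r (conv k g) \<le> conv_norm_pow k" if "g \<in> bLp p" "Lp_pow p g \<le> 1" for g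
    unfolding conv_norm_pow_def by (rule cSUP_upper[OF _ conv_norm_pow_bdd[OF A(2,1)]]) (use that in auto)
  have "\<exists>F::'a \<Rightarrow> complex. F \<in> bLp p \<and> Lp_pow p F > 0 \<and> conv_norm_pow k * Lp_pow p F powr (r/p) \<le> Lp_pow r (conv k F)"
  proof (cases "conv_norm_pow k > 0")
    case True
    then show ?thesis using conv_has_maximizer_pos[OF k] by metis
  next
    case False
    define S where "S = (box 0 One :: 'a set)"
    have S: "S \<in> sets borel" "emeasure lborel S = 1"
      by (auto simp: S_def emeasure_lborel_box_eq inner_Basis)
    have b: "indicator S \<in> bLp p" by (rule bLp_indicator) (use S in auto)
    have "Lp_pow p (indicator S :: 'a \<Rightarrow> complex) = (LINT x|lborel. indicat_real S x)"
      unfolding Lp_pow_def by (intro Bochner_Integration.integral_cong) (auto simp: indicator_def)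
    also have "\<dots> = 1" using S by (simp add: measure_def)
    finally have 1: "Lp_pow p (indicator S :: 'a \<Rightarrow> complex) = 1" .
    show ?thesis using False b 1 Lp_pow_nonneg[of r "conv k (indicator S)"]
      by (intro exI[of _ "indicator S"]) auto
  qed
  then obtain F :: "'a \<Rightarrow> complex" where F: "F \<in> bLp p" "Lp_pow p F > 0" "conv_norm_pow k * Lp_pow p F powr (r/p) \<le> Lp_pow r (conv k F)"
    by blast
  note n = normalize_Lp_pow[OF F(1,2)]
  have "conv_norm_pow k \<le> Lp_pow r (conv k (\<lambda>x. of_real (Lp_pow p F powr (- 1/p)) * F x))"
    unfolding n(3) using F(2,3) by (simp add: pos_le_divide_eq)
  then show thesis using n(1,2) sup by (intro that[of "\<lambda>x. of_real (Lp_pow p F powr (- 1/p)) * F x"]) (auto intro: order.trans)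
qed

end

section \<open>Kernels in Lorentz spaces are approximable\<close>

lemma lebesgue_ex_borel_complex:
  fixes f :: "'a::euclidean_space \<Rightarrow> complex"
  assumes f: "f \<in> borel_measurable lebesgue"
  obtains g where "g \<in> borel_measurable borel" "AE x in lborel. f x = g x"
proof -
  have "(\<lambda>x. Re (f x)) \<in> borel_measurable lebesgue" "(\<lambda>x. Im (f x)) \<in> borel_measurable lebesgue"
    using f by measurable
  from completion_ex_borel_measurable_real[OF this(1)] completion_ex_borel_measurable_real[OF this(2)]
  obtain a b where ab: "a \<in> borel_measurable lborel" "AE x in lborel. Re (f x) = a x"
    "b \<in> borel_measurable lborel" "AE x in lborel. Im (f x) = b x" by blast
  show thesis
  proof (rule that[of "\<lambda>x. of_real (a x) + \<i> * of_real (b x)"])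
    show "(\<lambda>x. of_real (a x) + \<i> * of_real (b x)) \<in> borel_measurable borel"
      using ab(1,3) by measurable
    show "AE x in lborel. f x = of_real (a x) + \<i> * of_real (b x)"
      using ab(2,4) by eventually_elim (simp add: complex_eq_iff)
  qed
qed

lemma emeasure_lebesgue_cong_AE:
  assumes "S \<in> sets lebesgue" "T \<in> sets borel" "AE x in lborel. x \<in> S \<longleftrightarrow> x \<in> T"
  shows "emeasure lebesgue S = emeasure lborel T"
proof -
  have "emeasure lebesgue S = emeasure lebesgue T"
    by (rule emeasure_eq_AE) (use assms in \<open>auto simp: AE_completion_iff\<close>)
  then show ?thesis using assms(2) by (simp del: emeasure_completion add: emeasure_completion)
qed

lemma distribution_fun_eq:
  assumes "f \<in> borel_measurable lebesgue" and [measurable]: "g \<in> borel_measurable borel" and ae: "AE x in lborel. f x = g x"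
  shows "distribution_fun f u = emeasure lborel {x. u < norm (g x)}"
  unfolding distribution_fun_def
proof (rule emeasure_lebesgue_cong_AE)
  have "{x \<in> space lebesgue. u < norm (f x)} \<in> sets lebesgue" using assms(1) by measurable
  then show "{x. u < norm (f x)} \<in> sets lebesgue" by simp
  show "AE x in lborel. (x \<in> {x. u < norm (f x)}) = (x \<in> {x. u < norm (g x)})" using ae by eventually_elim simp
qed measurable

lemma rearrangement_antimono: "t \<le> t' \<Longrightarrow> rearrangement f t' \<le> rearrangement f t"
  unfolding rearrangement_def
  by (intro Inf_superset_mono) (blast intro: order.trans ennreal_leI)

lemma rearrangement_measurable: "rearrangement f \<in> borel_measurable borel"
proof (rule borel_measurableI_greater)
  fix y
  have "is_interval {t. y < rearrangement f t}"
    unfolding is_interval_1 by (auto intro: less_le_trans rearrangement_antimono)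
  then show "{t \<in> space borel. y < rearrangement f t} \<in> sets borel"
    by (simp add: real_interval_borel_measurable)
qed

text \<open>Passing from the rearrangement to the distribution function: a level \<open>u\<close> that is exceeded on a set of
  measure more than \<open>t\<close> is a lower bound for \<open>f\<^sup>*(t)\<close>.\<close>

lemma rearrangement_ge:
  assumes f: "f \<in> borel_measurable lebesgue" and "ennreal t < distribution_fun f u"
  shows "ennreal u \<le> rearrangement f t"
  unfolding rearrangement_def
proof (rule Inf_greatest, safe)
  fix v :: real assume v: "v > 0" "distribution_fun f v \<le> ennreal t"
  have "u \<le> v"
  proof (rule ccontr)
    assume "\<not> u \<le> v"
    then have sub: "{x. u < norm (f x)} \<subseteq> {x. v < norm (f x)}" by auto
    have "{x \<in> space lebesgue. v < norm (f x)} \<in> sets lebesgue" using f by measurable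
    then have "distribution_fun f u \<le> distribution_fun f v"
      unfolding distribution_fun_def by (intro emeasure_mono sub) simp
    with assms v show False by simp
  qed
  then show "ennreal u \<le> ennreal v" by (rule ennreal_leI)
qed

lemma ennpowr_mono: "0 \<le> a \<Longrightarrow> x \<le> y \<Longrightarrow> ennpowr x a \<le> ennpowr y a"
  by (auto simp: ennpowr_def top_unique less_top intro!: ennreal_leI powr_mono2 enn2real_mono)

lemma ennpowr_ennreal: "0 \<le> x \<Longrightarrow> ennpowr (ennreal x) a = ennreal (x powr a)"
  by (simp add: ennpowr_def)

lemma ennpowr_measurable[measurable]: "(\<lambda>x. ennpowr x a) \<in> borel_measurable borel"
  unfolding ennpowr_def by measurable

definition lorentz_integrand :: "real \<Rightarrow> real \<Rightarrow> (real^'n \<Rightarrow> complex) \<Rightarrow> real \<Rightarrow> ennreal" where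
  "lorentz_integrand q s f t = ennpowr (ennreal (t powr (1/q)) * rearrangement f t) s * ennreal (1/t)"

lemma lorentz_integrand_measurable[measurable]: "lorentz_integrand q s f \<in> borel_measurable borel"
proof -
  note [measurable] = rearrangement_measurable[of f]
  show ?thesis unfolding lorentz_integrand_def[abs_def] by measurable
qed

text \<open>On \<open>{t/2..t}\<close> the rearrangement is at least \<open>u\<close>, so this piece of the Lorentz integral controls a power
  of \<open>t u\<^sup>q\<close>. The quantity \<open>t u\<^sup>q\<close> for \<open>t\<close> up to \<open>|{|f| > u}|\<close> is what enters the weak norm.\<close>

lemma dyadic_lorentz_bound:
  fixes f :: "real^'n \<Rightarrow> complex"
  assumes f: "f \<in> borel_measurable lebesgue" and t: "0 < t" "ennreal t < distribution_fun f u"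
    and u: "0 < u" and qs: "0 < q" "0 < s"
  shows "ennreal ((t * u powr q / 2) powr (s/q) / 2) \<le> (\<integral>\<^sup>+\<tau>\<in>{t/2..t}. lorentz_integrand q s f \<tau> \<partial>lborel)"
proof -
  define L where "L = (t * u powr q / 2) powr (s/q)"
  have L: "L = ((t/2) powr (1/q) * u) powr s"
    using qs u t by (simp add: L_def powr_mult powr_powr powr_divide)
  have "ennreal (L / 2) = ennreal (L / t) * emeasure lborel {t/2..t}"
    using t by (simp flip: ennreal_mult add: L_def)
  also have "\<dots> = (\<integral>\<^sup>+\<tau>. ennreal (L / t) * indicator {t/2..t} \<tau> \<partial>lborel)"
    by (simp add: nn_integral_cmult_indicator)
  also have "\<dots> \<le> (\<integral>\<^sup>+\<tau>\<in>{t/2..t}. lorentz_integrand q s f \<tau> \<partial>lborel)"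
  proof (intro nn_integral_mono)
    fix \<tau> :: real
    show "ennreal (L / t) * indicator {t/2..t} \<tau> \<le> lorentz_integrand q s f \<tau> * indicator {t/2..t} \<tau>"
    proof (cases "\<tau> \<in> {t/2..t}")
      case True
      have "ennreal u \<le> rearrangement f t" by (rule rearrangement_ge[OF f t(2)])
      also have "\<dots> \<le> rearrangement f \<tau>" using True by (intro rearrangement_antimono) auto
      finally have u': "ennreal u \<le> rearrangement f \<tau>" .
      have "ennreal ((t/2) powr (1/q) * u) = ennreal ((t/2) powr (1/q)) * ennreal u"
        using u by (simp add: ennreal_mult)
      also have "\<dots> \<le> ennreal (\<tau> powr (1/q)) * rearrangement f \<tau>"
        using True t qs by (intro mult_mono u' ennreal_leI powr_mono2) auto
      finally have "ennpowr (ennreal ((t/2) powr (1/q) * u)) s \<le> ennpowr (ennreal (\<tau> powr (1/q)) * rearrangement f \<tau>) s"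
        using qs by (intro ennpowr_mono) auto
      also have "ennpowr (ennreal ((t/2) powr (1/q) * u)) s = ennreal L"
        using u by (subst ennpowr_ennreal) (auto simp: L)
      finally have "ennreal L * ennreal (1/t) \<le> lorentz_integrand q s f \<tau>"
        unfolding lorentz_integrand_def using True t
        by (intro mult_mono ennreal_leI) (auto simp: field_simps)
      then show ?thesis using True t by (simp add: L_def flip: ennreal_mult)
    qed simp
  qed
  finally show ?thesis by (simp add: L_def)
qed

text \<open>The Lorentz integral defines a finite measure \<open>\<nu>\<close> on the half line. Bounding \<open>\<nu>\<close> of a dyadic interval by its
  total mass shows that \<open>k\<close> is in weak \<open>L\<^sub>q\<close>. For large \<open>u\<close> the measure \<open>t\<close> of the superlevel set is small, for
  small \<open>u\<close> either \<open>t\<close> is large or \<open>t u\<^sup>q\<close> is small trivially; as \<open>\<nu>\<close> has little mass near \<open>0\<close> and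
  near infinity, the weak norm of the part of \<open>k\<close> with \<open>|k| > U\<close> or \<open>|k| \<le> a\<close> is small.\<close>

lemma lorentz_approximable:
  fixes k :: "real^'n \<Rightarrow> complex"
  assumes k: "k \<in> lorentz q s" and qs: "0 < q" "0 < s"
    and kb[measurable]: "kb \<in> borel_measurable borel" and ae: "AE x in lborel. k x = kb x"
  shows "approximable q kb"
proof -
  have km: "k \<in> borel_measurable lebesgue" and fin: "lorentz_norm q s k < top" using k by (auto simp: lorentz_def)
  define g where "g = lorentz_integrand q s k"
  have [measurable]: "g \<in> borel_measurable borel" by (simp add: g_def)
  define \<nu> where "\<nu> = density lborel (\<lambda>t. g t * indicator {0<..} t)"
  define d where "d u = emeasure lborel {x. u < norm (kb x)}" for u
  have d: "distribution_fun k u = d u" for u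
    unfolding d_def by (rule distribution_fun_eq[OF km kb ae])
  have d_anti: "d v \<le> d u" if "u \<le> v" for u v
    unfolding d_def by (rule emeasure_mono) (use that in auto)
  have nu: "emeasure \<nu> S = (\<integral>\<^sup>+t\<in>S. g t * indicator {0<..} t \<partial>lborel)" if "S \<in> sets borel" for S
    unfolding \<nu>_def by (rule emeasure_density) (use that in auto)
  have nu_fin: "emeasure \<nu> UNIV < top"
  proof -
    have "emeasure \<nu> UNIV = (\<integral>\<^sup>+t\<in>{0<..}. ennpowr (ennreal (t powr (1/q)) * rearrangement k t) s * ennreal (1/t) \<partial>lborel)"
      by (simp add: nu g_def lorentz_integrand_def)
    also have "\<dots> < top" using fin by (auto simp: lorentz_norm_def ennpowr_def less_top split: if_splits)
    finally show ?thesis .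
  qed
  have nu_S: "emeasure \<nu> S \<noteq> \<infinity>" if "S \<in> sets borel" for S
  proof -
    have "emeasure \<nu> S \<le> emeasure \<nu> UNIV" using that by (intro emeasure_mono) (auto simp: \<nu>_def)
    with nu_fin show ?thesis by (auto simp: top_unique)
  qed
  have nu_lim: "(\<lambda>n. emeasure \<nu> (S n)) \<longlonglongrightarrow> 0"
    if S: "\<And>n. S n \<in> sets borel" "decseq S" "(\<Inter>n. S n) = {}" for S :: "nat \<Rightarrow> real set"
  proof -
    have "range S \<subseteq> sets \<nu>" using S(1) by (auto simp: \<nu>_def)
    from Lim_emeasure_decseq[OF this S(2) nu_S[OF S(1)]] show ?thesis unfolding S(3) by simp
  qed
  \<comment> \<open>if \<open>t u\<^sup>q\<close> exceeded \<open>\<epsilon>\<close>, then by \<open>dyadic_lorentz_bound\<close> the set \<open>S\<close> would have the mass excluded here\<close>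
  have weak: "t * u powr q \<le> \<epsilon>"
    if t: "0 < t" "ennreal t < d u" "0 < u" and eps: "\<epsilon> > 0"
      and S: "S \<in> sets borel" "{t/2..t} \<subseteq> S" "emeasure \<nu> S < ennreal ((\<epsilon> / 2) powr (s/q) / 2)" for t u \<epsilon> S
  proof -
    have "ennreal ((t * u powr q / 2) powr (s/q) / 2) \<le> (\<integral>\<^sup>+\<tau>\<in>{t/2..t}. g \<tau> \<partial>lborel)"
      unfolding g_def by (rule dyadic_lorentz_bound[OF km]) (use t qs d in auto)
    also have "\<dots> = emeasure \<nu> {t/2..t}"
      using t by (subst nu) (auto intro!: nn_integral_cong simp: indicator_def)
    also have "\<dots> \<le> emeasure \<nu> S" using S by (intro emeasure_mono) (auto simp: \<nu>_def)
    also have "\<dots> < ennreal ((\<epsilon> / 2) powr (s/q) / 2)" by fact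
    finally have less: "(t * u powr q / 2) powr (s/q) < (\<epsilon> / 2) powr (s/q)" by (simp add: ennreal_less_iff)
    show ?thesis
    proof (rule ccontr)
      assume "\<not> ?thesis"
      then have "(\<epsilon> / 2) powr (s/q) \<le> (t * u powr q / 2) powr (s/q)" using eps qs by (intro powr_mono2) auto
      with less show False by simp
    qed
  qed
  have d_le: "d u \<le> ennreal (\<epsilon> * u powr (-q))"
    if "0 < u" "\<epsilon> > 0" "\<And>t. 0 < t \<Longrightarrow> ennreal t < d u \<Longrightarrow> t * u powr q \<le> \<epsilon>" for u \<epsilon>
  proof (rule ccontr)
    assume "\<not> ?thesis"
    then have "ennreal (\<epsilon> * u powr (-q)) < d u" by simp
    then obtain y where y: "ennreal (\<epsilon> * u powr (-q)) < y" "y < d u" using dense by blast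
    then obtain t where t: "y = ennreal t" "0 \<le> t" by (cases y) auto
    have lt: "\<epsilon> * u powr (-q) < t" using y t that by (simp add: ennreal_less_iff)
    have "0 < \<epsilon> * u powr (-q)" using that by simp
    with lt have "0 < t" by linarith
    with that(3)[of t] y t have "t * u powr q \<le> \<epsilon>" by simp
    with lt that(1) show False by (simp add: powr_minus field_simps)
  qed
  obtain I where I: "emeasure \<nu> UNIV = ennreal I" "0 \<le> I" using nu_fin by (cases "emeasure \<nu> UNIV") auto
  define A where "A = 2 * (2 * (I + 1)) powr (q/s)"
  have A: "A > 0" using I by (simp add: A_def)
  have "(A / 2) powr (s/q) / 2 = I + 1" using I qs by (simp add: A_def powr_powr)
  then have "emeasure \<nu> UNIV < ennreal ((A / 2) powr (s/q) / 2)" using I by (simp add: ennreal_less_iff)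
  then have dA: "d u \<le> ennreal (A * u powr (-q))" if "u > 0" for u
    by (intro d_le weak[of _ u A UNIV] that A) auto
  have kA: "weak_Lq q A kb" using dA kb by (auto simp: weak_Lq_def d_def)
  have "\<exists>k'. tame k' \<and> weak_Lq q \<epsilon> (\<lambda>x. kb x - k' x)" if eps: "\<epsilon> > 0" for \<epsilon>
  proof -
    define \<epsilon>' where "\<epsilon>' = (\<epsilon> / 2) powr (s/q) / 2"
    have eps': "\<epsilon>' > 0" using eps by (simp add: \<epsilon>'_def)
    have "(\<lambda>n. emeasure \<nu> {0<..1 / real (Suc n)}) \<longlonglongrightarrow> 0"
    proof (rule nu_lim)
      show "decseq (\<lambda>n. {0<..1 / real (Suc n)})"
        unfolding decseq_Suc_iff
      proof
        fix n
        have "1 / real (Suc (Suc n)) \<le> 1 / real (Suc n)" by (intro divide_left_mono) auto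
        then show "{0<..1 / real (Suc (Suc n))} \<subseteq> {0<..1 / real (Suc n)}" by (intro subsetI) simp
      qed
      have "x \<notin> (\<Inter>n. {0<..1 / real (Suc n)})" for x :: real
      proof
        assume x: "x \<in> (\<Inter>n. {0<..1 / real (Suc n)})"
        then have "x > 0" by auto
        from reals_Archimedean[OF this] obtain n where "inverse (real (Suc n)) < x" ..
        moreover from x have "x \<in> {0<..1 / real (Suc n)}" by (rule INT_D) simp
        then have "x \<le> 1 / real (Suc n)" by simp
        ultimately show False by (simp add: inverse_eq_divide)
      qed
      then show "(\<Inter>n. {0<..1 / real (Suc n)}) = {}" by blast
    qed simp
    then have "\<forall>\<^sub>F n in sequentially. emeasure \<nu> {0<..1 / real (Suc n)} < ennreal \<epsilon>'"
      using eps' by (intro order_tendstoD(2)) auto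
    then obtain n1 where n1: "emeasure \<nu> {0<..1 / real (Suc n1)} < ennreal \<epsilon>'" by (auto simp: eventually_sequentially)
    define \<delta> where "\<delta> = 1 / real (Suc n1)"
    have delta: "\<delta> > 0" "emeasure \<nu> {0<..\<delta>} < ennreal \<epsilon>'" using n1 by (auto simp: \<delta>_def)
    have "(\<lambda>n. emeasure \<nu> {real n..}) \<longlonglongrightarrow> 0"
    proof (rule nu_lim)
      show "decseq (\<lambda>n. {real n..})" by (auto simp: decseq_def)
      have "x \<notin> (\<Inter>n. {real n..})" for x :: real
      proof
        assume x: "x \<in> (\<Inter>n. {real n..})"
        from reals_Archimedean2[of x] obtain n where "x < real n" ..
        moreover from x have "x \<in> {real n..}" by (rule INT_D) simp
        then have "real n \<le> x" by simp
        ultimately show False by simp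
      qed
      then show "(\<Inter>n. {real n..}) = {}" by blast
    qed simp
    then have "\<forall>\<^sub>F n in sequentially. emeasure \<nu> {real n..} < ennreal \<epsilon>'"
      using eps' by (intro order_tendstoD(2)) auto
    then obtain T where T: "emeasure \<nu> {real T..} < ennreal \<epsilon>'" by (auto simp: eventually_sequentially)
    define U where "U = (A / \<delta>) powr (1/q)"
    have U: "U > 0" using A delta by (simp add: U_def)
    have up: "d u \<le> ennreal (\<epsilon> * u powr (-q))" if u: "u \<ge> U" for u
    proof (rule d_le[OF _ eps])
      show u0: "0 < u" using u U by simp
      fix t assume t: "0 < t" "ennreal t < d u"
      have "ennreal t < ennreal (A * u powr (-q))" using t dA[OF u0] by simp
      then have "t < A * u powr (-q)" using t by (simp add: ennreal_less_iff)
      also have "\<dots> \<le> A * U powr (-q)" using A U u qs by (intro mult_left_mono powr_mono2') auto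
      also have "\<dots> = \<delta>" using A delta qs by (simp add: U_def powr_powr powr_minus)
      finally have "t < \<delta>" .
      then show "t * u powr q \<le> \<epsilon>"
        using t u0 delta by (intro weak[of t u \<epsilon> "{0<..\<delta>}"] eps) (auto simp: \<epsilon>'_def)
    qed
    \<comment> \<open>below this level the intervals \<open>{t/2..t}\<close> with \<open>t \<le> 2 (T + 1)\<close> need no estimate of \<open>\<nu>\<close>\<close>
    define a where "a = (\<epsilon> / (2 * (real T + 1))) powr (1/q)"
    have a: "a > 0" using eps by (simp add: a_def)
    have down: "d u \<le> ennreal (\<epsilon> * u powr (-q))" if u: "0 < u" "u \<le> a" for u
    proof (rule d_le[OF u(1) eps])
      fix t assume t: "0 < t" "ennreal t < d u"
      show "t * u powr q \<le> \<epsilon>"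
      proof (cases "t \<le> 2 * (real T + 1)")
        case True
        have "u powr q \<le> a powr q" using u qs by (intro powr_mono2) auto
        also have "\<dots> = \<epsilon> / (2 * (real T + 1))" using eps qs by (simp add: a_def powr_powr)
        finally have "t * u powr q \<le> (2 * (real T + 1)) * (\<epsilon> / (2 * (real T + 1)))"
          using True t by (intro mult_mono) auto
        then show ?thesis by simp
      next
        case False
        then show ?thesis
          using t u T by (intro weak[of t u \<epsilon> "{real T..}"] eps) (auto simp: \<epsilon>'_def)
      qed
    qed
    define k' where "k' x = (if a < norm (kb x) \<and> norm (kb x) \<le> U then kb x else 0)" for x
    have [measurable]: "k' \<in> borel_measurable borel" unfolding k'_def by measurable
    have "tame k'"
      unfolding tame_def
    proof (intro conjI exI[of _ U] allI)
      show "norm (k' x) \<le> U" for x using U by (simp add: k'_def)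
      have "emeasure lborel {x. k' x \<noteq> 0} \<le> d a"
        unfolding d_def by (rule emeasure_mono) (auto simp: k'_def)
      also have "\<dots> \<le> ennreal (A * a powr (-q))" by (rule dA[OF a])
      also have "\<dots> < \<infinity>" by simp
      finally show "emeasure lborel {x. k' x \<noteq> 0} < \<infinity>" .
    qed measurable
    moreover have "weak_Lq q \<epsilon> (\<lambda>x. kb x - k' x)"
      unfolding weak_Lq_def
    proof (intro conjI allI impI)
      fix u :: real assume u: "u > 0"
      show "emeasure lborel {x. u < norm (kb x - k' x)} \<le> ennreal (\<epsilon> * u powr (-q))"
      proof (cases "u < a")
        case True
        have "emeasure lborel {x. u < norm (kb x - k' x)} \<le> d u"
          unfolding d_def by (rule emeasure_mono) (use u in \<open>auto simp: k'_def split: if_splits\<close>)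
        also have "\<dots> \<le> ennreal (\<epsilon> * u powr (-q))" by (rule down) (use u True in auto)
        finally show ?thesis .
      next
        case False
        have "emeasure lborel {x. u < norm (kb x - k' x)} \<le> d (max u U)"
          unfolding d_def by (rule emeasure_mono) (use u False in \<open>auto simp: k'_def split: if_splits\<close>)
        also have "\<dots> \<le> ennreal (\<epsilon> * max u U powr (-q))" by (rule up) simp
        also have "\<dots> \<le> ennreal (\<epsilon> * u powr (-q))"
          using u qs eps by (intro ennreal_leI mult_left_mono powr_mono2') auto
        finally show ?thesis .
      qed
    qed measurable
    ultimately show ?thesis by blast
  qed
  with A kA show ?thesis by (auto simp: approximable_def)
qed

section \<open>Smooth functions of compact support\<close>

text \<open>The family is closed under differentiation up to linear combinations, which makes infinite
  differentiability a matter of bookkeeping; for \<open>k = 0\<close> and \<open>c\<close> tending to \<open>0\<close> it tends to the indicator of the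
  positive half line.\<close>

definition flat_fun :: "real \<Rightarrow> nat \<Rightarrow> real \<Rightarrow> real" where
  "flat_fun c k t = (if t > 0 then exp (- (c / t)) / t ^ k else 0)"

lemma flat_fun_tendsto_0:
  assumes c: "c > 0"
  shows "(flat_fun c k \<longlongrightarrow> 0) (at 0)"
proof -
  have "filterlim (\<lambda>t. c * inverse t) at_top (at_right 0)"
    by (rule filterlim_tendsto_pos_mult_at_top[OF tendsto_const c filterlim_inverse_at_top_right])
  from filterlim_compose[OF tendsto_power_div_exp_0 this, of k]
  have "((\<lambda>t. 1 / c ^ k * ((c * inverse t) ^ k / exp (c * inverse t))) \<longlongrightarrow> 1 / c ^ k * 0) (at_right 0)"
    by (intro tendsto_intros)
  then have "((\<lambda>t. 1 / c ^ k * ((c * inverse t) ^ k / exp (c * inverse t))) \<longlongrightarrow> 0) (at_right 0)" by simp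
  then have "(flat_fun c k \<longlongrightarrow> 0) (at_right 0)"
  proof (rule Lim_transform_eventually)
    show "\<forall>\<^sub>F t in at_right 0. 1 / c ^ k * ((c * inverse t) ^ k / exp (c * inverse t)) = flat_fun c k t"
      using c by (auto simp: eventually_at_filter flat_fun_def exp_minus power_mult_distrib divide_simps)
  qed
  moreover have "(flat_fun c k \<longlongrightarrow> 0) (at_left 0)"
    by (rule tendsto_eventually) (auto simp: eventually_at_filter flat_fun_def)
  ultimately show ?thesis by (simp add: filterlim_split_at)
qed

lemma DERIV_flat_fun:
  assumes c: "c > 0"
  shows "(flat_fun c k has_real_derivative c * flat_fun c (k + 2) t - real k * flat_fun c (k + 1) t) (at t)"
proof -
  consider "t > 0" | "t < 0" | "t = 0" by linarith
  then show ?thesis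
  proof cases
    case 1
    have "((\<lambda>t. exp (- (c / t)) / t ^ k) has_real_derivative c * flat_fun c (k + 2) t - real k * flat_fun c (k + 1) t) (at t)"
      using 1 by (auto intro!: derivative_eq_intros simp: flat_fun_def field_simps power2_eq_square)
        (cases k; simp add: field_simps power2_eq_square)
    then show ?thesis
      by (rule has_field_derivative_transform_within_open[of _ _ _ "{0<..}"]) (use 1 in \<open>auto simp: flat_fun_def\<close>)
  next
    case 2
    have "((\<lambda>t. 0) has_real_derivative 0) (at t)" by simp
    then have "(flat_fun c k has_real_derivative 0) (at t)"
      by (rule has_field_derivative_transform_within_open[of _ _ _ "{..<0}"]) (use 2 in \<open>auto simp: flat_fun_def\<close>)
    then show ?thesis using 2 by (simp add: flat_fun_def)
  next
    case 3
    \<comment> \<open>at \<open>0\<close> the difference quotient is the next function of the family\<close>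
    have "((\<lambda>h. (flat_fun c k (0 + h) - flat_fun c k 0) / h) \<longlongrightarrow> 0) (at 0)"
    proof (rule Lim_transform_eventually[OF flat_fun_tendsto_0[OF c, of "k + 1"]])
      show "\<forall>\<^sub>F h in at 0. flat_fun c (k + 1) h = (flat_fun c k (0 + h) - flat_fun c k 0) / h"
        by (auto simp: eventually_at_filter flat_fun_def)
    qed
    then show ?thesis using 3 by (simp add: DERIV_def flat_fun_def)
  qed
qed

text \<open>If \<open>a $ i < b $ i\<close> for all \<open>i\<close>, the factors are positive exactly on the box with corners \<open>a\<close> and \<open>b\<close>.\<close>

definition box_bump :: "real \<Rightarrow> ('n \<Rightarrow> nat) \<Rightarrow> real^'n \<Rightarrow> real^'n \<Rightarrow> real^'n \<Rightarrow> complex" where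
  "box_bump c \<kappa> a b x = of_real (\<Prod>i\<in>UNIV. flat_fun c (\<kappa> i) ((x $ i - a $ i) * (b $ i - x $ i)))"

text \<open>A class of functions that contains its own partial derivatives, vanishes outside bounded sets, and is
  therefore contained in the Schwartz space.\<close>

inductive smooth_bump :: "(real^'n \<Rightarrow> complex) \<Rightarrow> bool" where
  base: "c > 0 \<Longrightarrow> smooth_bump (box_bump c \<kappa> a b)"
| coord: "smooth_bump f \<Longrightarrow> smooth_bump (\<lambda>x. of_real (x $ i) * f x)"
| scale: "smooth_bump f \<Longrightarrow> smooth_bump (\<lambda>x. z * f x)"
| add: "smooth_bump f \<Longrightarrow> smooth_bump g \<Longrightarrow> smooth_bump (\<lambda>x. f x + g x)"

lemma has_derivative_vec_nth: "((\<lambda>x::real^'n. x $ i) has_derivative (\<lambda>h. h $ i)) F"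
  by (rule bounded_linear_imp_has_derivative) (rule bounded_linear_vec_nth)

text \<open>The partial derivatives are written out as combinations of bumps and of bumps multiplied by a
  coordinate, in the form in which \<open>smooth_bump\<close> generates them.\<close>

lemma box_bump_has_derivative:
  fixes a b x :: "real^'n" and \<kappa> :: "'n \<Rightarrow> nat"
  assumes c: "c > 0"
  defines "D \<equiv> \<lambda>j x. (of_real (c * (a $ j + b $ j)) * box_bump c (\<kappa>(j := \<kappa> j + 2)) a b x
      + of_real (- 2 * c) * (of_real (x $ j) * box_bump c (\<kappa>(j := \<kappa> j + 2)) a b x))
      + (of_real (- real (\<kappa> j) * (a $ j + b $ j)) * box_bump c (\<kappa>(j := \<kappa> j + 1)) a b x
      + of_real (2 * real (\<kappa> j)) * (of_real (x $ j) * box_bump c (\<kappa>(j := \<kappa> j + 1)) a b x))"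
  shows "(box_bump c \<kappa> a b has_derivative (\<lambda>h. \<Sum>j\<in>UNIV. of_real (h $ j) * D j x)) (at x)"
proof -
  define P where "P i x = (x $ i - a $ i) * (b $ i - x $ i)" for i and x :: "real^'n"
  define d where "d i x = (c * flat_fun c (\<kappa> i + 2) (P i x) - real (\<kappa> i) * flat_fun c (\<kappa> i + 1) (P i x)) * (a $ i + b $ i - 2 * x $ i)" for i x
  have 1: "((\<lambda>x. flat_fun c (\<kappa> i) (P i x)) has_derivative (\<lambda>h. d i x * h $ i)) (at x)" for i
  proof -
    have "(P i has_derivative (\<lambda>h. (x $ i - a $ i) * (0 - h $ i) + (h $ i - 0) * (b $ i - x $ i))) (at x)"
      unfolding P_def
      by (intro has_derivative_mult has_derivative_diff has_derivative_const has_derivative_vec_nth)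
    then have "(P i has_derivative (\<lambda>h. (a $ i + b $ i - 2 * x $ i) * h $ i)) (at x)"
      by (rule has_derivative_eq_rhs) (simp add: fun_eq_iff algebra_simps)
    from has_derivative_compose[OF this DERIV_flat_fun[OF c, of "\<kappa> i", unfolded has_field_derivative_def]]
    show ?thesis by (simp add: d_def mult_ac)
  qed
  have upd: "(\<Prod>i\<in>UNIV. flat_fun c ((\<kappa>(j := m)) i) (P i x)) = flat_fun c m (P j x) * (\<Prod>i\<in>UNIV - {j}. flat_fun c (\<kappa> i) (P i x))" for j m
    by (subst prod.remove[of UNIV j]) (auto intro!: arg_cong2[where f="(*)"] prod.cong)
  have "((\<lambda>x. \<Prod>i\<in>UNIV. flat_fun c (\<kappa> i) (P i x)) has_derivative
     (\<lambda>h. \<Sum>j\<in>UNIV. d j x * h $ j * (\<Prod>i\<in>UNIV - {j}. flat_fun c (\<kappa> i) (P i x)))) (at x)"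
    by (rule has_derivative_prod) (rule 1)
  then have "((\<lambda>x. complex_of_real (\<Prod>i\<in>UNIV. flat_fun c (\<kappa> i) (P i x))) has_derivative
     (\<lambda>h. of_real (\<Sum>j\<in>UNIV. d j x * h $ j * (\<Prod>i\<in>UNIV - {j}. flat_fun c (\<kappa> i) (P i x))))) (at x)"
    by (rule has_derivative_of_real)
  moreover have "of_real (\<Sum>j\<in>UNIV. d j x * h $ j * (\<Prod>i\<in>UNIV - {j}. flat_fun c (\<kappa> i) (P i x)))
     = (\<Sum>j\<in>UNIV. of_real (h $ j) * D j x)" for h :: "real^'n"
    unfolding of_real_sum
  proof (intro sum.cong refl)
    fix j
    have "d j x * h $ j * (\<Prod>i\<in>UNIV - {j}. flat_fun c (\<kappa> i) (P i x))
      = h $ j * ((c * (a $ j + b $ j)) * (\<Prod>i\<in>UNIV. flat_fun c ((\<kappa>(j := \<kappa> j + 2)) i) (P i x))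
      + (- 2 * c) * (x $ j * (\<Prod>i\<in>UNIV. flat_fun c ((\<kappa>(j := \<kappa> j + 2)) i) (P i x)))
      + ((- real (\<kappa> j) * (a $ j + b $ j)) * (\<Prod>i\<in>UNIV. flat_fun c ((\<kappa>(j := \<kappa> j + 1)) i) (P i x))
      + (2 * real (\<kappa> j)) * (x $ j * (\<Prod>i\<in>UNIV. flat_fun c ((\<kappa>(j := \<kappa> j + 1)) i) (P i x)))))"
      unfolding upd d_def by (simp add: algebra_simps)
    then show "of_real (d j x * h $ j * (\<Prod>i\<in>UNIV - {j}. flat_fun c (\<kappa> i) (P i x))) = of_real (h $ j) * D j x"
      unfolding D_def box_bump_def P_def[symmetric] by (simp only: of_real_mult of_real_add)
  qed
  ultimately show ?thesis by (simp add: box_bump_def[abs_def] P_def)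
qed

lemma smooth_bump_derivative:
  assumes "smooth_bump f"
  shows "\<exists>D. (\<forall>x. (f has_derivative (\<lambda>h. \<Sum>j\<in>UNIV. of_real (h $ j) * D j x)) (at x)) \<and> (\<forall>j. smooth_bump (D j))"
  using assms
proof induction
  case (base c \<kappa> a b)
  show ?case
    by (rule exI, rule conjI, rule allI, rule box_bump_has_derivative[OF base], rule allI)
      (intro smooth_bump.intros base)
next
  case (coord f i)
  then obtain D where D: "\<And>x. (f has_derivative (\<lambda>h. \<Sum>j\<in>UNIV. of_real (h $ j) * D j x)) (at x)" "\<And>j. smooth_bump (D j)" by blast
  define E where "E j = (\<lambda>x. of_real (x $ i) * D j x + (if j = i then 1 else 0) * f x)" for j
  have "((\<lambda>x. of_real (x $ i) * f x) has_derivative (\<lambda>h. \<Sum>j\<in>UNIV. of_real (h $ j) * E j x)) (at x)" for x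
  proof -
    have "((\<lambda>x. complex_of_real (x $ i)) has_derivative (\<lambda>h. of_real (h $ i))) (at x)"
      by (intro has_derivative_of_real has_derivative_vec_nth)
    from has_derivative_mult[OF this D(1)[of x]]
    have "((\<lambda>x. of_real (x $ i) * f x) has_derivative (\<lambda>h. of_real (x $ i) * (\<Sum>j\<in>UNIV. of_real (h $ j) * D j x) + of_real (h $ i) * f x)) (at x)" .
    moreover have "of_real (x $ i) * (\<Sum>j\<in>UNIV. of_real (h $ j) * D j x) + of_real (h $ i) * f x = (\<Sum>j\<in>UNIV. of_real (h $ j) * E j x)" for h
    proof -
      have "(\<Sum>j\<in>UNIV. of_real (h $ j) * E j x)
        = (\<Sum>j\<in>UNIV. of_real (x $ i) * (of_real (h $ j) * D j x) + (if j = i then of_real (h $ i) * f x else 0))"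
        unfolding E_def by (intro sum.cong) (auto simp: algebra_simps)
      then show ?thesis by (simp add: sum.distrib sum_distrib_left)
    qed
    ultimately show ?thesis by simp
  qed
  moreover have "smooth_bump (E j)" for j
    unfolding E_def by (intro smooth_bump.intros D coord)
  ultimately show ?case by blast
next
  case (scale f z)
  then obtain D where D: "\<And>x. (f has_derivative (\<lambda>h. \<Sum>j\<in>UNIV. of_real (h $ j) * D j x)) (at x)" "\<And>j. smooth_bump (D j)" by blast
  have "((\<lambda>x. z * f x) has_derivative (\<lambda>h. \<Sum>j\<in>UNIV. of_real (h $ j) * (z * D j x))) (at x)" for x
    using has_derivative_mult_right[OF D(1)[of x], of z] by (simp add: sum_distrib_left mult_ac)
  moreover have "smooth_bump (\<lambda>x. z * D j x)" for j by (intro smooth_bump.scale D)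
  ultimately show ?case by (intro exI[of _ "\<lambda>j x. z * D j x"]) auto
next
  case (add f g)
  then obtain D E where D: "\<And>x. (f has_derivative (\<lambda>h. \<Sum>j\<in>UNIV. of_real (h $ j) * D j x)) (at x)" "\<And>j. smooth_bump (D j)"
    and E: "\<And>x. (g has_derivative (\<lambda>h. \<Sum>j\<in>UNIV. of_real (h $ j) * E j x)) (at x)" "\<And>j. smooth_bump (E j)" by blast
  have "((\<lambda>x. f x + g x) has_derivative (\<lambda>h. \<Sum>j\<in>UNIV. of_real (h $ j) * (D j x + E j x))) (at x)" for x
    using has_derivative_add[OF D(1)[of x] E(1)[of x]] by (simp add: sum.distrib distrib_left)
  moreover have "smooth_bump (\<lambda>x. D j x + E j x)" for j by (intro smooth_bump.add D E)
  ultimately show ?case by (intro exI[of _ "\<lambda>j x. D j x + E j x"]) auto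
qed

lemma smooth_bump_partial_deriv:
  assumes "smooth_bump f"
  shows "smooth_bump (partial_deriv i f)"
proof -
  obtain D where D: "\<And>x. (f has_derivative (\<lambda>h. \<Sum>j\<in>UNIV. of_real (h $ j) * D j x)) (at x)" "\<And>j. smooth_bump (D j)"
    using smooth_bump_derivative[OF assms] by blast
  have "partial_deriv i f x = D i x" for x
  proof -
    have "partial_deriv i f x = (\<Sum>j\<in>UNIV. of_real (axis i 1 $ j) * D j x)"
      unfolding partial_deriv_def frechet_derivative_at[OF D(1)[of x], symmetric] ..
    also have "\<dots> = (\<Sum>j\<in>UNIV. if j = i then D i x else 0)" by (intro sum.cong) (auto simp: axis_def)
    finally show ?thesis by simp
  qed
  then have "partial_deriv i f = D i" by blast
  with D(2) show ?thesis by simp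
qed

lemma smooth_bump_partial_derivs: "smooth_bump f \<Longrightarrow> smooth_bump (partial_derivs is f)"
  by (induction "is") (auto simp: partial_derivs_def intro: smooth_bump_partial_deriv)

lemma smooth_bump_support:
  assumes "smooth_bump f"
  shows "\<exists>R. \<forall>x. f x \<noteq> 0 \<longrightarrow> norm x \<le> R"
  using assms
proof induction
  case (base c \<kappa> a b)
  show ?case
  proof (intro exI allI impI)
    fix x assume "box_bump c \<kappa> a b x \<noteq> 0"
    then have ne: "flat_fun c (\<kappa> i) ((x $ i - a $ i) * (b $ i - x $ i)) \<noteq> 0" for i
      by (auto simp: box_bump_def)
    have pos: "0 < (x $ i - a $ i) * (b $ i - x $ i)" for i
      using ne[of i] by (simp add: flat_fun_def split: if_splits)
    have "\<bar>x $ i\<bar> \<le> \<bar>a $ i\<bar> + \<bar>b $ i\<bar>" for i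
      using pos[of i] by (auto simp: zero_less_mult_iff)
    then have "norm x \<le> (\<Sum>i\<in>UNIV. \<bar>a $ i\<bar> + \<bar>b $ i\<bar>)"
      by (intro order.trans[OF norm_le_l1_cart] sum_mono)
    then show "norm x \<le> (\<Sum>i\<in>UNIV. \<bar>a $ i\<bar> + \<bar>b $ i\<bar>)" .
  qed
next
  case (add f g)
  then obtain R S where "\<forall>x. f x \<noteq> 0 \<longrightarrow> norm x \<le> R" "\<forall>x. g x \<noteq> 0 \<longrightarrow> norm x \<le> S" by blast
  then have "norm x \<le> max R S" if "f x + g x \<noteq> 0" for x using that by (cases "f x = 0") (auto simp: le_max_iff_disj)
  then show ?case by blast
qed auto

lemma smooth_bump_differentiable: "smooth_bump f \<Longrightarrow> f differentiable (at x)"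
  using smooth_bump_derivative[of f] by (auto simp: differentiable_def)

lemma smooth_bump_schwartz:
  assumes "smooth_bump f"
  shows "f \<in> schwartz"
  unfolding schwartz_def
proof (intro CollectI allI conjI)
  fix "is" :: "'a list" and x and m :: nat
  define g where "g = partial_derivs is f"
  have g: "smooth_bump g" unfolding g_def by (rule smooth_bump_partial_derivs[OF assms])
  show "partial_derivs is f differentiable at x"
    using smooth_bump_differentiable[OF g] by (simp add: g_def)
  obtain R where R: "\<And>x. g x \<noteq> 0 \<Longrightarrow> norm x \<le> R" using smooth_bump_support[OF g] by blast
  have "continuous_on UNIV g"
    using smooth_bump_differentiable[OF g] by (simp add: continuous_at_imp_continuous_on differentiable_imp_continuous_within)
  then have "compact ((\<lambda>x. norm x ^ m *\<^sub>R g x) ` cball 0 R)"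
    by (intro compact_continuous_image continuous_intros) (auto intro: continuous_on_subset)
  then have "bounded (insert 0 ((\<lambda>x. norm x ^ m *\<^sub>R g x) ` cball 0 R))" by (simp add: compact_imp_bounded)
  then have "bounded (range (\<lambda>x. norm x ^ m *\<^sub>R g x))"
  proof (rule bounded_subset)
    show "range (\<lambda>x. norm x ^ m *\<^sub>R g x) \<subseteq> insert 0 ((\<lambda>x. norm x ^ m *\<^sub>R g x) ` cball 0 R)"
    proof safe
      fix x assume "norm x ^ m *\<^sub>R g x \<notin> (\<lambda>x. norm x ^ m *\<^sub>R g x) ` cball 0 R"
      then have "x \<notin> cball 0 R" by blast
      then show "norm x ^ m *\<^sub>R g x = 0" using R[of x] by auto
    qed
  qed
  then show "bounded (range (\<lambda>x. norm x ^ m *\<^sub>R partial_derivs is f x))" by (simp add: g_def)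
qed

section \<open>Schwartz functions and tempered distributions\<close>

text \<open>The power \<open>2 n\<close> in dimension \<open>n\<close> makes the weight integrable, and a bound by the weight follows from two
  of the Schwartz seminorms, those with powers \<open>0\<close> and \<open>2 n\<close> of the norm.\<close>

definition decay_weight :: "real^'n \<Rightarrow> real" where
  "decay_weight x = 1 / (1 + norm x ^ (2 * CARD('n)))"

lemma decay_weight_pos: "0 < decay_weight x" and decay_weight_le: "decay_weight x \<le> 1"
  by (auto simp: decay_weight_def add_pos_nonneg)

text \<open>The set where the weight exceeds \<open>u\<close> lies in a ball of radius \<open>u\<^bsup>-1/(2n)\<^esup>\<close>, of volume proportional to \<open>u\<^bsup>-1/2\<^esup>\<close>,
  which is integrable on \<open>{0<..1}\<close>.\<close>

lemma integrable_decay_weight: "integrable lborel (decay_weight :: real^'n \<Rightarrow> real)"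
proof (rule integrableI_nonneg)
  show m[measurable]: "(decay_weight :: real^'n \<Rightarrow> real) \<in> borel_measurable lborel"
    unfolding decay_weight_def[abs_def] by measurable
  show "AE x in lborel. 0 \<le> decay_weight (x :: real^'n)" by (auto simp: less_imp_le decay_weight_pos)
  define V where "V = unit_ball_vol (real CARD('n))"
  have V: "V \<ge> 0" by (simp add: V_def)
  have "(\<integral>\<^sup>+x. ennreal (decay_weight (x :: real^'n)) \<partial>lborel)
     = (\<integral>\<^sup>+x. (\<integral>\<^sup>+u. indicator {0<..<decay_weight (x :: real^'n)} u \<partial>lborel) \<partial>lborel)"
    by (intro nn_integral_cong ennreal_layer_cake) (auto simp: less_imp_le decay_weight_pos)
  also have "\<dots> = (\<integral>\<^sup>+u. (\<integral>\<^sup>+x. indicator {0<..<decay_weight (x :: real^'n)} u \<partial>lborel) \<partial>lborel)"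
    by (rule lborel_pair.Fubini') measurable
  also have "\<dots> \<le> (\<integral>\<^sup>+u. ennreal V * (ennreal (u powr (-1/2)) * indicator {0<..1} u) \<partial>lborel)"
  proof (intro nn_integral_mono)
    fix u :: real
    show "(\<integral>\<^sup>+x. indicator {0<..<decay_weight (x :: real^'n)} u \<partial>lborel) \<le> ennreal V * (ennreal (u powr (-1/2)) * indicator {0<..1} u)"
    proof (cases "0 < u \<and> u \<le> 1")
      case True
      define \<rho> where "\<rho> = u powr (- 1 / real (2 * CARD('n)))"
      have pow: "\<rho> ^ m = u powr (- (real m / real (2 * CARD('n))))" for m
        using True by (simp add: \<rho>_def powr_powr flip: powr_realpow)
      have rho: "\<rho> \<ge> 0" "\<rho> ^ CARD('n) = u powr (-1/2)" "\<rho> ^ (2 * CARD('n)) = 1 / u"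
        using pow[of "CARD('n)"] pow[of "2 * CARD('n)"] True by (auto simp: \<rho>_def powr_minus_divide)
      have "norm x \<le> \<rho>" if "u < decay_weight x" for x :: "real^'n"
      proof -
        have pos: "1 + norm x ^ (2 * CARD('n)) > 0" by (simp add: add_pos_nonneg)
        have "u * (1 + norm x ^ (2 * CARD('n))) < 1" using that pos by (simp add: decay_weight_def field_simps)
        then have "u * norm x ^ (2 * CARD('n)) < 1" using True by (simp add: distrib_left)
        then have "norm x ^ (2 * CARD('n)) < \<rho> ^ (2 * CARD('n))" unfolding rho(3) using True by (simp add: pos_less_divide_eq mult.commute)
        then have "norm x < \<rho>" by (rule power_less_imp_less_base) (rule rho(1))
        then show ?thesis by simp
      qed
      then have "(\<integral>\<^sup>+x. indicator {0<..<decay_weight (x :: real^'n)} u \<partial>lborel) \<le> (\<integral>\<^sup>+x. indicator (cball (0 :: real^'n) \<rho>) x \<partial>lborel)"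
        by (intro nn_integral_mono) (auto simp: indicator_def)
      also have "\<dots> = emeasure lborel (cball (0 :: real^'n) \<rho>)" by simp
      also have "\<dots> = ennreal (V * \<rho> ^ CARD('n))"
        using emeasure_cball[OF rho(1), of "0 :: real^'n"] by (simp add: V_def)
      also have "\<dots> = ennreal V * (ennreal (u powr (-1/2)) * indicator {0<..1} u)"
        using True V by (simp add: rho(2) ennreal_mult)
      finally show ?thesis .
    next
      case False
      then have "indicator {0<..<decay_weight (x :: real^'n)} u = (0 :: ennreal)" for x
        using decay_weight_le[of x] by (auto simp: indicator_def)
      then show ?thesis by simp
    qed
  qed
  also have "\<dots> = ennreal V * ennreal (1 powr (- 1/2 + 1) / (- 1/2 + 1))"
    by (subst nn_integral_cmult, measurable, subst nn_integral_powr_from_0) auto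
  also have "\<dots> < \<infinity>" by (simp add: ennreal_mult_less_top)
  finally show "(\<integral>\<^sup>+x. ennreal (decay_weight (x :: real^'n)) \<partial>lborel) < \<infinity>" .
qed

lemma schwartz_continuous: "\<phi> \<in> schwartz \<Longrightarrow> continuous_on UNIV \<phi>"
proof -
  assume "\<phi> \<in> schwartz"
  then have "\<forall>x. partial_derivs [] \<phi> differentiable (at x)" by (simp add: schwartz_def)
  then have "\<phi> differentiable (at x)" for x by (simp add: partial_derivs_def)
  then show ?thesis by (simp add: continuous_at_imp_continuous_on differentiable_imp_continuous_within)
qed

lemma schwartz_measurable: "\<phi> \<in> schwartz \<Longrightarrow> \<phi> \<in> borel_measurable borel"
  by (rule borel_measurable_continuous_onI[OF schwartz_continuous])

lemma decay_weight_boundI: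
  fixes x :: "real^'n"
  assumes "norm y \<le> C" "norm x ^ (2 * CARD('n)) * norm y \<le> C"
  shows "norm y \<le> 2 * C * decay_weight x"
proof -
  have "norm y * (1 + norm x ^ (2 * CARD('n))) \<le> 2 * C" using assms by (simp add: algebra_simps)
  moreover have "1 + norm x ^ (2 * CARD('n)) > 0" by (simp add: add_pos_nonneg)
  ultimately show ?thesis by (simp add: decay_weight_def field_simps)
qed

lemma schwartz_decay:
  fixes \<phi> :: "real^'n \<Rightarrow> complex"
  assumes "\<phi> \<in> schwartz"
  obtains C where "C > 0" "\<And>x. norm (\<phi> x) \<le> C * decay_weight x"
proof -
  have "bounded (range (\<lambda>x. norm x ^ m *\<^sub>R partial_derivs [] \<phi> x))" for m
    using assms unfolding schwartz_def by blast
  then have b: "bounded (range (\<lambda>x. norm x ^ m *\<^sub>R \<phi> x))" for m by (simp add: partial_derivs_def)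
  obtain C0 where C0: "\<And>x. norm (norm x ^ 0 *\<^sub>R \<phi> x) \<le> C0" using b[of 0] by (auto simp: bounded_iff)
  obtain C1 where C1: "\<And>x. norm (norm x ^ (2 * CARD('n)) *\<^sub>R \<phi> x) \<le> C1"
    using b[of "2 * CARD('n)"] by (auto simp: bounded_iff)
  define C where "C = max (max C0 C1) 1"
  have "norm (\<phi> x) \<le> 2 * C * decay_weight x" for x
    using C0[of x] C1[of x] by (intro decay_weight_boundI) (auto simp: C_def)
  then show thesis by (intro that[of "2 * C"]) (auto simp: C_def)
qed

lemma schwartz_bLp:
  fixes \<phi> :: "real^'n \<Rightarrow> complex"
  assumes "\<phi> \<in> schwartz" "p \<ge> 1"
  shows "\<phi> \<in> bLp p"
proof -
  obtain C where C: "C > 0" "\<And>x. norm (\<phi> x) \<le> C * decay_weight x"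
    using schwartz_decay[OF assms(1)] by blast
  show ?thesis
  proof (rule bLp_dominated(1)[OF schwartz_measurable[OF assms(1)]])
    show "integrable lborel (\<lambda>x. C powr p * decay_weight (x :: real^'n))"
      by (intro integrable_mult_right integrable_decay_weight)
    show "AE x in lborel. norm (\<phi> x) powr p \<le> C powr p * decay_weight x"
    proof (intro AE_I2)
      fix x
      have "norm (\<phi> x) powr p \<le> (C * decay_weight x) powr p" using C assms by (intro powr_mono2) auto
      also have "\<dots> = C powr p * decay_weight x powr p" using C decay_weight_pos[of x] by (simp add: powr_mult)
      also have "decay_weight x powr p \<le> decay_weight x powr 1"
        using decay_weight_pos[of x] decay_weight_le[of x] assms by (intro powr_mono') auto
      finally show "norm (\<phi> x) powr p \<le> C powr p * decay_weight x"
        using decay_weight_pos[of x] by (simp add: mult_left_mono)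
    qed
  qed
qed

text \<open>By density of step functions only indicators of boxes matter. They are pointwise limits, from below, of the bumps with
  \<open>c = 1 / (m + 1)\<close> and \<open>\<kappa> = 0\<close>.\<close>

lemma smooth_bump_dense:
  fixes f :: "real^'n \<Rightarrow> complex"
  assumes f: "f \<in> bLp p" and p: "p \<ge> 1" and e: "\<epsilon> > 0"
  shows "\<exists>\<phi>. smooth_bump \<phi> \<and> Lp_pow p (\<lambda>x. \<phi> x - f x) < \<epsilon>"
proof -
  have b: "\<phi> \<in> bLp p" if "smooth_bump \<phi>" for \<phi> :: "real^'n \<Rightarrow> complex"
    by (rule schwartz_bLp[OF smooth_bump_schwartz[OF that] p])
  have "\<forall>\<epsilon>>0. \<exists>\<phi>. smooth_bump \<phi> \<and> Lp_pow p (\<lambda>x. \<phi> x - f x) < \<epsilon>"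
    using f
  proof (rule bLp_density_induct)
    show "p > 0" using p by simp
    fix B :: "(real^'n) set" assume B: "B \<in> ratbox"
    then obtain l u where lu: "B = box l u" by (auto simp: ratbox_def)
    show "\<forall>\<epsilon>>0. \<exists>\<phi>. smooth_bump \<phi> \<and> Lp_pow p (\<lambda>x. \<phi> x - indicator B x) < \<epsilon>"
    proof (cases "B = {}")
      case True
      have "smooth_bump (\<lambda>x. 0 * box_bump 1 (\<lambda>_. 0) l u x)" by (intro smooth_bump.intros) simp
      then have "smooth_bump (\<lambda>x :: real^'n. 0 :: complex)" by simp
      then show ?thesis using True by (intro allI impI exI[of _ "\<lambda>x. 0"]) (auto simp: Lp_pow_def)
    next
      case False
      then obtain y where y: "y \<in> box l u" unfolding lu by blast
      have lt: "l $ i < u $ i" for i using y by (auto simp: mem_box_cart intro: less_trans)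
      have pos: "0 < (x $ i - l $ i) * (u $ i - x $ i) \<longleftrightarrow> l $ i < x $ i \<and> x $ i < u $ i" for x i
        using lt[of i] by (auto simp: zero_less_mult_iff)
      define \<phi> where "\<phi> m = box_bump (1 / real (Suc m)) (\<lambda>_. 0) l u" for m
      have \<phi>: "smooth_bump (\<phi> m)" for m unfolding \<phi>_def by (intro smooth_bump.base) simp
      have bnd: "norm (\<phi> m x) \<le> norm (indicator B x :: complex)" for m x
      proof (cases "x \<in> B")
        case True
        have "0 \<le> flat_fun (1 / real (Suc m)) 0 t \<and> flat_fun (1 / real (Suc m)) 0 t \<le> 1" for t
          by (auto simp: flat_fun_def)
        then have "\<bar>\<Prod>i\<in>UNIV. flat_fun (1 / real (Suc m)) 0 ((x $ i - l $ i) * (u $ i - x $ i))\<bar> \<le> 1"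
          by (auto simp: abs_prod intro!: prod_le_1)
        then show ?thesis unfolding \<phi>_def box_bump_def norm_of_real using True by simp
      next
        case False
        then obtain i where "\<not> (l $ i < x $ i \<and> x $ i < u $ i)" by (auto simp: lu mem_box_cart)
        then have "flat_fun (1 / real (Suc m)) 0 ((x $ i - l $ i) * (u $ i - x $ i)) = 0"
          using pos[of x i] by (simp add: flat_fun_def)
        then show ?thesis using False by (auto simp: \<phi>_def box_bump_def intro!: bexI[of _ i])
      qed
      have lim: "(\<lambda>m. \<phi> m x) \<longlonglongrightarrow> indicator B x" for x
      proof (cases "x \<in> B")
        case True
        have "(\<lambda>m. flat_fun (1 / real (Suc m)) 0 ((x $ i - l $ i) * (u $ i - x $ i))) \<longlonglongrightarrow> 1" for i
        proof -
          define t where "t = (x $ i - l $ i) * (u $ i - x $ i)"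
          have t: "t > 0" using True pos[of x i] by (auto simp: t_def lu mem_box_cart)
          have "(\<lambda>m. exp (- (1 / real (Suc m) / t))) \<longlonglongrightarrow> exp (- (0 / t))"
            using t by (intro tendsto_intros LIMSEQ_Suc lim_1_over_n) auto
          then show ?thesis using t by (simp add: flat_fun_def t_def[symmetric])
        qed
        then have "(\<lambda>m. of_real (\<Prod>i\<in>UNIV. flat_fun (1 / real (Suc m)) 0 ((x $ i - l $ i) * (u $ i - x $ i)))) \<longlonglongrightarrow> (of_real (\<Prod>i\<in>(UNIV :: 'n set). 1) :: complex)"
          by (intro tendsto_of_real tendsto_prod)
        then show ?thesis using True by (simp add: \<phi>_def box_bump_def)
      next
        case False
        then have "\<phi> m x = 0" for m using bnd[of m x] by simp
        then show ?thesis using False by simp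
      qed
      have ib: "indicator B \<in> bLp p"
        unfolding lu using emeasure_lborel_box_finite[of l u] by (intro bLp_indicator) auto
      have "(\<lambda>m. Lp_pow p (\<lambda>x. \<phi> m x - indicator B x)) \<longlonglongrightarrow> 0"
        by (rule Lp_pow_dominated_convergence[OF bLp_measurable[OF b[OF \<phi>]] bLp_measurable[OF ib] ib bnd lim])
          (use p in simp)
      then have "\<forall>\<^sub>F m in sequentially. Lp_pow p (\<lambda>x. \<phi> m x - indicator B x) < \<epsilon>" if "\<epsilon> > 0" for \<epsilon>
        using that by (intro order_tendstoD(2)) auto
      then show ?thesis using \<phi> by (auto simp: eventually_sequentially) blast
    qed
  next
    fix z and g :: "real^'n \<Rightarrow> complex"
    assume g: "\<forall>\<epsilon>>0. \<exists>\<phi>. smooth_bump \<phi> \<and> Lp_pow p (\<lambda>x. \<phi> x - g x) < \<epsilon>"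
    show "\<forall>\<epsilon>>0. \<exists>\<phi>. smooth_bump \<phi> \<and> Lp_pow p (\<lambda>x. \<phi> x - z * g x) < \<epsilon>"
    proof (intro allI impI)
      fix \<epsilon> :: real assume e: "\<epsilon> > 0"
      have pos: "norm z powr p + 1 > 0" by (simp add: add_nonneg_pos)
      obtain \<phi> where \<phi>: "smooth_bump \<phi>" "Lp_pow p (\<lambda>x. \<phi> x - g x) < \<epsilon> / (norm z powr p + 1)"
        using g e pos by (meson divide_pos_pos)
      have "Lp_pow p (\<lambda>x. z * \<phi> x - z * g x) = norm z powr p * Lp_pow p (\<lambda>x. \<phi> x - g x)"
        unfolding right_diff_distrib[symmetric] by (rule Lp_pow_cmult)
      also have "\<dots> \<le> (norm z powr p + 1) * Lp_pow p (\<lambda>x. \<phi> x - g x)" by (simp add: distrib_right Lp_pow_nonneg)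
      also have "\<dots> < \<epsilon>" using \<phi>(2) pos by (simp add: field_simps)
      finally show "\<exists>\<phi>. smooth_bump \<phi> \<and> Lp_pow p (\<lambda>x. \<phi> x - z * g x) < \<epsilon>"
        using smooth_bump.scale[OF \<phi>(1), of z] by blast
    qed
  next
    fix g h :: "real^'n \<Rightarrow> complex"
    assume gh: "g \<in> bLp p" "h \<in> bLp p" "\<forall>\<epsilon>>0. \<exists>\<phi>. smooth_bump \<phi> \<and> Lp_pow p (\<lambda>x. \<phi> x - g x) < \<epsilon>"
      "\<forall>\<epsilon>>0. \<exists>\<phi>. smooth_bump \<phi> \<and> Lp_pow p (\<lambda>x. \<phi> x - h x) < \<epsilon>"
    show "\<forall>\<epsilon>>0. \<exists>\<phi>. smooth_bump \<phi> \<and> Lp_pow p (\<lambda>x. \<phi> x - (g x + h x)) < \<epsilon>"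
    proof (intro allI impI)
      fix \<epsilon> :: real assume e: "\<epsilon> > 0"
      define \<eta> where "\<eta> = \<epsilon> / (2 * 2 powr p)"
      have eta: "\<eta> > 0" using e by (simp add: \<eta>_def)
      obtain \<phi> where \<phi>: "smooth_bump \<phi>" "Lp_pow p (\<lambda>x. \<phi> x - g x) < \<eta>" using gh(3) eta by blast
      obtain \<psi> where \<psi>: "smooth_bump \<psi>" "Lp_pow p (\<lambda>x. \<psi> x - h x) < \<eta>" using gh(4) eta by blast
      have "Lp_pow p (\<lambda>x. (\<phi> x + \<psi> x) - (g x + h x)) = Lp_pow p (\<lambda>x. (\<phi> x - g x) + (\<psi> x - h x))"
        by (simp add: algebra_simps)
      also have "\<dots> \<le> 2 powr p * (Lp_pow p (\<lambda>x. \<phi> x - g x) + Lp_pow p (\<lambda>x. \<psi> x - h x))"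
        using p by (intro Lp_pow_add_le bLp_diff b \<phi> \<psi> gh) auto
      also have "\<dots> < 2 powr p * (\<eta> + \<eta>)" using \<phi>(2) \<psi>(2) by (intro mult_strict_left_mono) auto
      also have "\<dots> = \<epsilon>" by (simp add: \<eta>_def)
      finally show "\<exists>\<phi>. smooth_bump \<phi> \<and> Lp_pow p (\<lambda>x. \<phi> x - (g x + h x)) < \<epsilon>"
        using smooth_bump.add[OF \<phi>(1) \<psi>(1)] by blast
    qed
  next
    fix g and F :: "nat \<Rightarrow> real^'n \<Rightarrow> complex"
    assume F: "\<And>n. F n \<in> bLp p" "\<And>n. \<forall>\<epsilon>>0. \<exists>\<phi>. smooth_bump \<phi> \<and> Lp_pow p (\<lambda>x. \<phi> x - F n x) < \<epsilon>"
      and g: "g \<in> bLp p" and lim: "(\<lambda>n. Lp_pow p (\<lambda>x. F n x - g x)) \<longlonglongrightarrow> 0"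
    show "\<forall>\<epsilon>>0. \<exists>\<phi>. smooth_bump \<phi> \<and> Lp_pow p (\<lambda>x. \<phi> x - g x) < \<epsilon>"
    proof (intro allI impI)
      fix \<epsilon> :: real assume e: "\<epsilon> > 0"
      define \<eta> where "\<eta> = \<epsilon> / (2 * 2 powr p)"
      have eta: "\<eta> > 0" using e by (simp add: \<eta>_def)
      have "\<forall>\<^sub>F n in sequentially. Lp_pow p (\<lambda>x. F n x - g x) < \<eta>" using lim eta by (intro order_tendstoD(2)) auto
      then obtain n where n: "Lp_pow p (\<lambda>x. F n x - g x) < \<eta>" by (auto simp: eventually_sequentially)
      obtain \<phi> where \<phi>: "smooth_bump \<phi>" "Lp_pow p (\<lambda>x. \<phi> x - F n x) < \<eta>" using F(2) eta by blast
      have "Lp_pow p (\<lambda>x. \<phi> x - g x) = Lp_pow p (\<lambda>x. (\<phi> x - F n x) + (F n x - g x))" by simp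
      also have "\<dots> \<le> 2 powr p * (Lp_pow p (\<lambda>x. \<phi> x - F n x) + Lp_pow p (\<lambda>x. F n x - g x))"
        using p by (intro Lp_pow_add_le bLp_diff b \<phi> F g) auto
      also have "\<dots> < 2 powr p * (\<eta> + \<eta>)" using \<phi>(2) n by (intro mult_strict_left_mono) auto
      also have "\<dots> = \<epsilon>" by (simp add: \<eta>_def)
      finally show "\<exists>\<phi>. smooth_bump \<phi> \<and> Lp_pow p (\<lambda>x. \<phi> x - g x) < \<epsilon>" using \<phi>(1) by blast
    qed
  qed
  with e show ?thesis by blast
qed

section \<open>Lebesgue measurable functions and the extended operator\<close>

lemma borel_measurable_lebesgue_AE:
  fixes f :: "'a::euclidean_space \<Rightarrow> complex"
  assumes [measurable]: "g \<in> borel_measurable borel" and ae: "AE x in lborel. f x = g x"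
  shows "f \<in> borel_measurable lebesgue"
proof (rule measurableI)
  fix S :: "complex set" assume [measurable]: "S \<in> sets borel"
  have a: "g -` S \<in> sets lebesgue" using measurable_sets[OF assms(1), of S] by simp
  have b: "AE x in lebesgue. x \<in> g -` S \<longleftrightarrow> x \<in> f -` S"
    unfolding AE_completion_iff using ae by eventually_elim simp
  have "f -` S \<in> sets lebesgue"
    by (rule complete_measure.in_sets_AE[OF completion.complete_measure_axioms b a]) simp
  then show "f -` S \<inter> space lebesgue \<in> sets lebesgue" by simp
qed simp

lemma AE_lborel_reflect:
  fixes x :: "'a::euclidean_space"
  assumes "AE y in lborel. P y"
  shows "AE y in lborel. P (x - y)"
proof -
  obtain N where N: "{y. \<not> P y} \<subseteq> N" "N \<in> sets borel" "emeasure lborel N = 0"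
    using AE_E[OF assms] by auto
  note [measurable] = N(2)
  have "emeasure lborel {y. x - y \<in> N} = (\<integral>\<^sup>+y. indicator N (x - y) \<partial>lborel)"
    by (subst nn_integral_indicator[symmetric]) (auto intro!: nn_integral_cong simp: indicator_def simp del: nn_integral_indicator)
  also have "\<dots> = 0" using N by (subst nn_integral_lborel_reflect) auto
  finally show ?thesis using N(1) by (intro AE_I[of _ _ "{y. x - y \<in> N}"]) auto
qed

lemma integral_lborel_reflect:
  fixes F :: "'a::euclidean_space \<Rightarrow> complex"
  assumes [measurable]: "F \<in> borel_measurable borel"
  shows "(LINT y|lborel. F (x - y)) = (LINT y|lborel. F y)"
  by (subst (2) distr_lborel_reflect[of x, symmetric]) (simp add: integral_distr)

lemma distr_of_fun_eq:
  fixes k :: "real^'n \<Rightarrow> complex"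
  assumes [measurable]: "kb \<in> borel_measurable borel" "fb \<in> borel_measurable borel"
    and ae: "AE x in lborel. k x = kb x" "AE x in lborel. f x = fb x"
  shows "distr_of_fun k f = (LINT y|lborel. kb y * fb y)"
proof -
  have e: "AE y in lborel. k y * f y = kb y * fb y" using ae by eventually_elim simp
  have m: "(\<lambda>y. kb y * fb y) \<in> borel_measurable borel" by measurable
  have "distr_of_fun k f = (LINT y|lebesgue. kb y * fb y)"
    unfolding distr_of_fun_def
    by (rule integral_cong_AE[OF borel_measurable_lebesgue_AE[OF m e]])
      (use e m in \<open>auto simp: AE_completion_iff measurable_completion\<close>)
  also have "\<dots> = (LINT y|lborel. kb y * fb y)" by (rule integral_completion) (use m in simp)
  finally show ?thesis .
qed

lemma distr_conv_eq:
  fixes k :: "real^'n \<Rightarrow> complex"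
  assumes [measurable]: "kb \<in> borel_measurable borel" "fb \<in> borel_measurable borel"
    and ae: "AE x in lborel. k x = kb x" "AE x in lborel. f x = fb x"
  shows "distr_conv (distr_of_fun k) f = conv kb fb"
proof
  fix x
  have "distr_conv (distr_of_fun k) f x = (LINT y|lborel. kb y * fb (x - y))"
    unfolding distr_conv_def by (rule distr_of_fun_eq[OF _ _ ae(1) AE_lborel_reflect[OF ae(2)]]) measurable
  also have "\<dots> = (LINT y|lborel. kb (x - y) * fb y)"
    using integral_lborel_reflect[of "\<lambda>y. kb (x - y) * fb y" x] by simp
  finally show "distr_conv (distr_of_fun k) f x = conv kb fb x" by (simp add: conv_def)
qed

lemma bLp_imp_Lp:
  fixes f :: "real^'n \<Rightarrow> complex"
  assumes f: "f \<in> bLp p"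
  shows "f \<in> Lp p" "Lp_norm p f = Lp_pow p f powr (1/p)"
proof -
  note [measurable] = bLp_measurable[OF f]
  have m: "(\<lambda>x. norm (f x) powr p) \<in> borel_measurable lborel" by measurable
  show "f \<in> Lp p" using bLp_integrable[OF f] bLp_measurable[OF f]
    by (auto simp: Lp_def integrable_completion[OF m] measurable_completion)
  show "Lp_norm p f = Lp_pow p f powr (1/p)" by (simp add: Lp_norm_def Lp_pow_def integral_completion[OF m])
qed

lemma Lp_norm_cong_AE:
  assumes "f \<in> borel_measurable lebesgue" "g \<in> borel_measurable lebesgue" "AE x in lborel. f x = g x"
  shows "Lp_norm p f = Lp_norm p g"
proof -
  have "(LINT x|lebesgue. norm (f x) powr p) = (LINT x|lebesgue. norm (g x) powr p)"
    by (rule integral_cong_AE) (use assms in \<open>auto simp: AE_completion_iff\<close>)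
  then show ?thesis by (simp add: Lp_norm_def)
qed

lemma Lp_cong_AE:
  assumes "f \<in> Lp p" "g \<in> borel_measurable lebesgue" "AE x in lborel. f x = g x"
  shows "g \<in> Lp p"
proof -
  have "integrable lebesgue (\<lambda>x. norm (f x) powr p) \<longleftrightarrow> integrable lebesgue (\<lambda>x. norm (g x) powr p)"
    by (rule integrable_cong_AE) (use assms in \<open>auto simp: AE_completion_iff Lp_def\<close>)
  with assms show ?thesis by (simp add: Lp_def)
qed

lemma Lp_borel_representative:
  fixes f :: "real^'n \<Rightarrow> complex"
  assumes f: "f \<in> Lp p"
  obtains g where "g \<in> bLp p" "AE x in lborel. f x = g x" "Lp_norm p f = Lp_pow p g powr (1/p)"
proof -
  have fm: "f \<in> borel_measurable lebesgue" using f by (simp add: Lp_def)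
  obtain g where g: "g \<in> borel_measurable borel" "AE x in lborel. f x = g x"
    using lebesgue_ex_borel_complex[OF fm] by blast
  have gm: "g \<in> borel_measurable lebesgue" using g(1) by (simp add: measurable_completion)
  have gL: "g \<in> Lp p" by (rule Lp_cong_AE[OF f gm g(2)])
  have m: "(\<lambda>x. norm (g x) powr p) \<in> borel_measurable lborel" using g(1) by measurable
  have gb: "g \<in> bLp p" using gL g(1) by (simp add: Lp_def bLp_def integrable_completion[OF m])
  show thesis
    by (rule that[OF gb g(2)]) (simp add: Lp_norm_cong_AE[OF fm gm g(2)] bLp_imp_Lp(2)[OF gb])
qed

lemma Lp_norm_diff_representative:
  fixes f g :: "real^'n \<Rightarrow> complex"
  assumes "fb \<in> bLp p" "gb \<in> bLp p" "AE x in lborel. f x = fb x" "AE x in lborel. g x = gb x" "0 \<le> p"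
  shows "Lp_norm p (\<lambda>x. f x - g x) = Lp_pow p (\<lambda>x. fb x - gb x) powr (1/p)"
proof -
  have d: "(\<lambda>x. fb x - gb x) \<in> bLp p" by (rule bLp_diff[OF assms(1,2,5)])
  have e: "AE x in lborel. f x - g x = fb x - gb x" using assms(3,4) by eventually_elim simp
  have "Lp_norm p (\<lambda>x. f x - g x) = Lp_norm p (\<lambda>x. fb x - gb x)"
    by (rule Lp_norm_cong_AE[OF borel_measurable_lebesgue_AE[OF bLp_measurable[OF d] e] _ e])
      (use bLp_measurable[OF d] in \<open>simp add: measurable_completion\<close>)
  then show ?thesis by (simp add: bLp_imp_Lp(2)[OF d])
qed

text \<open>Where \<open>|k| > 1\<close> the kernel is integrable, because \<open>q > 1\<close>, and \<open>\<phi>\<close> is bounded by \<open>C\<close>; elsewhere \<open>|k| \<le> 1\<close> and the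
  weight is integrable.\<close>

lemma weak_Lq_mult_decay:
  fixes k :: "real^'n \<Rightarrow> complex"
  assumes k: "weak_Lq q A k" "A > 0" "q > 1"
  obtains L where "L \<ge> 0"
    "\<And>\<phi> C. \<phi> \<in> borel_measurable borel \<Longrightarrow> (\<And>x. norm (\<phi> x) \<le> C * decay_weight x) \<Longrightarrow>
       integrable lborel (\<lambda>x. k x * \<phi> x) \<and> norm (LINT x|lborel. k x * \<phi> x) \<le> C * L"
proof -
  note [measurable] = weak_Lq_measurable[OF k(1)]
  define E where "E = {x. 1 < norm (k x)}"
  have E[measurable]: "E \<in> sets borel" unfolding E_def by measurable
  define h where "h x = norm (k x) * indicator E x" for x
  have hi: "integrable lborel h"
  proof (rule integrableI_nonneg)
    show "h \<in> borel_measurable lborel" unfolding h_def by measurable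
    have "(\<integral>\<^sup>+x. ennreal (h x) \<partial>lborel) = (\<integral>\<^sup>+x. ennreal (norm (k x)) * indicator E x \<partial>lborel)"
      by (intro nn_integral_cong) (auto simp: h_def indicator_def)
    also have "\<dots> \<le> ennreal (q/(q-1) * A powr (1/q) * A powr (1 - 1/q))"
    proof (rule weak_Lq_nn_integral_set_le[OF k E])
      have "emeasure lborel {x. 1 < norm (k x)} \<le> ennreal (A * 1 powr (-q))"
        using k(1) unfolding weak_Lq_def by (metis zero_less_one)
      then show "emeasure lborel E \<le> ennreal A" by (simp add: E_def)
    qed (use k in simp)
    also have "\<dots> < \<infinity>" by simp
    finally show "(\<integral>\<^sup>+x. ennreal (h x) \<partial>lborel) < \<infinity>" .
  qed (simp add: h_def)
  define L where "L = (LINT x|lborel. h x + decay_weight x)"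
  have Li: "integrable lborel (\<lambda>x. h x + decay_weight x)"
    by (intro Bochner_Integration.integrable_add hi integrable_decay_weight)
  show thesis
  proof (rule that[of L])
    show "L \<ge> 0" unfolding L_def
      by (intro integral_nonneg_AE AE_I2) (auto simp: h_def less_imp_le[OF decay_weight_pos])
    fix \<phi> :: "real^'n \<Rightarrow> complex" and C
    assume [measurable]: "\<phi> \<in> borel_measurable borel" and C: "\<And>x. norm (\<phi> x) \<le> C * decay_weight x"
    have le: "norm (k x * \<phi> x) \<le> C * (h x + decay_weight x)" for x
    proof -
      have C0: "0 \<le> C" using order.trans[OF norm_ge_zero C[of x]] decay_weight_pos[of x] by (simp add: zero_le_mult_iff)
      have C1: "norm (\<phi> x) \<le> C"
        using C[of x] mult_left_le[OF decay_weight_le[of x] C0] by (simp add: mult.commute)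
      show ?thesis
      proof (cases "x \<in> E")
        case True
        have "norm (k x * \<phi> x) \<le> norm (k x) * C" unfolding norm_mult by (intro mult_left_mono C1) simp
        also have "\<dots> \<le> C * (h x + decay_weight x)"
          using True C0 decay_weight_pos[of x] by (simp add: h_def distrib_left mult.commute)
        finally show ?thesis .
      next
        case False
        have "norm (k x * \<phi> x) \<le> 1 * (C * decay_weight x)"
          unfolding norm_mult using False by (intro mult_mono C) (auto simp: E_def)
        then show ?thesis using False by (simp add: h_def)
      qed
    qed
    have i: "integrable lborel (\<lambda>x. k x * \<phi> x)"
      by (rule Bochner_Integration.integrable_bound[OF integrable_mult_right[OF Li, of C]])
        (use le in \<open>auto intro: order.trans[OF _ abs_ge_self]\<close>)
    have "norm (LINT x|lborel. k x * \<phi> x) \<le> (LINT x|lborel. norm (k x * \<phi> x))" by (rule integral_norm_bound)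
    also have "\<dots> \<le> (LINT x|lborel. C * (h x + decay_weight x))"
      by (intro integral_mono integrable_norm i integrable_mult_right Li le)
    also have "\<dots> = C * L" by (simp add: L_def)
    finally show "integrable lborel (\<lambda>x. k x * \<phi> x) \<and> norm (LINT x|lborel. k x * \<phi> x) \<le> C * L" using i by blast
  qed
qed

lemma tempered_distribution_weak_Lq:
  fixes k :: "real^'n \<Rightarrow> complex"
  assumes kb: "weak_Lq q A kb" "A > 0" "q > 1" and ae: "AE x in lborel. k x = kb x"
  shows "tempered_distribution (distr_of_fun k)"
proof -
  note [measurable] = weak_Lq_measurable[OF kb(1)]
  obtain L where L: "L \<ge> 0" "\<And>\<phi> C. \<phi> \<in> borel_measurable borel \<Longrightarrow> (\<And>x. norm (\<phi> x) \<le> C * decay_weight x) \<Longrightarrow>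
       integrable lborel (\<lambda>x. kb x * \<phi> x) \<and> norm (LINT x|lborel. kb x * \<phi> x) \<le> C * L"
    using weak_Lq_mult_decay[OF kb] by blast
  have eq: "distr_of_fun k \<phi> = (LINT y|lborel. kb y * \<phi> y)" if "\<phi> \<in> borel_measurable borel" for \<phi>
    by (rule distr_of_fun_eq) (use that ae in auto)
  have int: "integrable lborel (\<lambda>x. kb x * \<phi> x)" if phi: "\<phi> \<in> schwartz" for \<phi>
  proof -
    obtain C where "C > 0" "\<And>x. norm (\<phi> x) \<le> C * decay_weight x" using schwartz_decay[OF phi] by blast
    then show ?thesis using L(2)[OF schwartz_measurable[OF phi]] by blast
  qed
  show ?thesis
    unfolding tempered_distribution_def
  proof (intro conjI ballI allI impI)
    fix \<phi> \<psi> :: "real^'n \<Rightarrow> complex" and a b assume ps: "\<phi> \<in> schwartz" "\<psi> \<in> schwartz"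
    note [measurable] = schwartz_measurable[OF ps(1)] schwartz_measurable[OF ps(2)]
    have "distr_of_fun k (\<lambda>x. a * \<phi> x + b * \<psi> x) = (LINT y|lborel. a * (kb y * \<phi> y) + b * (kb y * \<psi> y))"
      by (subst eq) (measurable, simp add: algebra_simps)
    also have "\<dots> = a * distr_of_fun k \<phi> + b * distr_of_fun k \<psi>"
      using int[OF ps(1)] int[OF ps(2)] by (simp add: eq)
    finally show "distr_of_fun k (\<lambda>x. a * \<phi> x + b * \<psi> x) = a * distr_of_fun k \<phi> + b * distr_of_fun k \<psi>" .
  next
    fix \<phi> :: "nat \<Rightarrow> real^'n \<Rightarrow> complex"
    assume phi: "(\<forall>j. \<phi> j \<in> schwartz) \<and> schwartz_tendsto_zero \<phi>"
    have ul: "uniform_limit UNIV (\<lambda>j x. norm x ^ m *\<^sub>R \<phi> j x) (\<lambda>x. 0) sequentially" for m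
    proof -
      have "uniform_limit UNIV (\<lambda>j x. norm x ^ m *\<^sub>R partial_derivs [] (\<phi> j) x) (\<lambda>x. 0) sequentially"
        using phi unfolding schwartz_tendsto_zero_def by blast
      then show ?thesis by (simp add: partial_derivs_def)
    qed
    have m: "\<phi> j \<in> borel_measurable borel" for j using phi schwartz_measurable by blast
    show "(\<lambda>j. distr_of_fun k (\<phi> j)) \<longlonglongrightarrow> 0"
    proof (rule tendstoI)
      fix e :: real assume e: "e > 0"
      define \<eta> where "\<eta> = e / (2 * (L + 1))"
      have eta: "\<eta> > 0" using e L by (simp add: \<eta>_def)
      have "\<forall>\<^sub>F j in sequentially. \<forall>x\<in>UNIV. dist (norm x ^ 0 *\<^sub>R \<phi> j x) 0 < \<eta>"
        "\<forall>\<^sub>F j in sequentially. \<forall>x\<in>UNIV. dist (norm x ^ (2 * CARD('n)) *\<^sub>R \<phi> j x) 0 < \<eta>"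
        using uniform_limitD[OF ul[of 0] eta] uniform_limitD[OF ul[of "2 * CARD('n)"] eta] by auto
      then show "\<forall>\<^sub>F j in sequentially. dist (distr_of_fun k (\<phi> j)) 0 < e"
      proof eventually_elim
        case (elim j)
        have "norm (\<phi> j x) \<le> 2 * \<eta> * decay_weight x" for x
          using bspec[OF elim(1), of x] bspec[OF elim(2), of x] by (intro decay_weight_boundI) auto
        then have "norm (LINT x|lborel. kb x * \<phi> j x) \<le> 2 * \<eta> * L" using L(2)[OF m] by blast
        also have "\<dots> < 2 * \<eta> * (L + 1)" using eta by simp
        also have "\<dots> = e" using L(1) by (simp add: \<eta>_def field_simps)
        finally show ?case by (simp add: eq[OF m])
      qed
    qed
  qed
qed

context hls_exponents
begin

context
  fixes k kb :: "real^'n \<Rightarrow> complex" and A :: real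
  assumes kb: "weak_Lq q A kb" and A: "A > 0" and ae: "AE x in lborel. k x = kb x"
begin

lemma Lp_conv:
  assumes f: "fb \<in> bLp p" "AE x in lborel. f x = fb x"
  shows "distr_conv (distr_of_fun k) f = conv kb fb"
  by (rule distr_conv_eq[OF weak_Lq_measurable[OF kb] bLp_measurable[OF f(1)] ae f(2)])

lemma distr_conv_Lp_bound:
  assumes f: "f \<in> Lp p"
  shows "distr_conv (distr_of_fun k) f \<in> Lp r"
    and "Lp_norm r (distr_conv (distr_of_fun k) f) \<le> hls_const * A powr (1/q) * Lp_norm p f"
proof -
  obtain g where g: "g \<in> bLp p" "AE x in lborel. f x = g x" "Lp_norm p f = Lp_pow p g powr (1/p)"
    by (rule Lp_borel_representative[OF f])
  note c = hls_conv[OF kb A g(1)]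
  show "distr_conv (distr_of_fun k) f \<in> Lp r"
    unfolding Lp_conv[OF g(1,2)] by (rule bLp_imp_Lp(1)[OF c(1)])
  have "Lp_norm r (distr_conv (distr_of_fun k) f) = Lp_pow r (conv kb g) powr (1/r)"
    unfolding Lp_conv[OF g(1,2)] by (rule bLp_imp_Lp(2)[OF c(1)])
  also have "\<dots> \<le> ((hls_const * A powr (1/q)) powr r * Lp_pow p g powr (r/p)) powr (1/r)"
    using c(2) r_gt1 Lp_pow_nonneg by (intro powr_mono2) auto
  also have "\<dots> = hls_const * A powr (1/q) * Lp_pow p g powr (1/p)"
    using r_gt1 hls_const_pos by (simp add: powr_mult powr_powr)
  finally show "Lp_norm r (distr_conv (distr_of_fun k) f) \<le> hls_const * A powr (1/q) * Lp_norm p f"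
    by (simp add: g(3))
qed

lemma distr_of_fun_Cnv: "distr_of_fun k \<in> Cnv p r"
  unfolding Cnv_def
proof (intro CollectI conjI exI ballI)
  show "tempered_distribution (distr_of_fun k)"
    by (rule tempered_distribution_weak_Lq[OF kb A q_gt1 ae])
  fix f :: "real^'n \<Rightarrow> complex" assume "f \<in> schwartz"
  then have "f \<in> Lp p" using p_gt1 by (intro bLp_imp_Lp schwartz_bLp) auto
  then show "distr_conv (distr_of_fun k) f \<in> Lp r"
    "Lp_norm r (distr_conv (distr_of_fun k) f) \<le> hls_const * A powr (1/q) * Lp_norm p f"
    by (rule distr_conv_Lp_bound)+
qed

lemma distr_conv_diff_bound:
  assumes f: "f \<in> Lp p" "g \<in> Lp p"
  shows "Lp_norm r (\<lambda>x. distr_conv (distr_of_fun k) g x - distr_conv (distr_of_fun k) f x)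
    \<le> hls_const * A powr (1/q) * Lp_norm p (\<lambda>x. g x - f x)"
proof -
  obtain fb where fb: "fb \<in> bLp p" "AE x in lborel. f x = fb x" by (rule Lp_borel_representative[OF f(1)])
  obtain gb where gb: "gb \<in> bLp p" "AE x in lborel. g x = gb x" by (rule Lp_borel_representative[OF f(2)])
  have d: "(\<lambda>x. gb x - fb x) \<in> bLp p" using p_gt1 by (intro bLp_diff gb fb) auto
  have de: "AE x in lborel. g x - f x = gb x - fb x" using gb(2) fb(2) by eventually_elim simp
  have dL: "(\<lambda>x. g x - f x) \<in> Lp p"
    by (rule Lp_cong_AE[OF bLp_imp_Lp(1)[OF d] borel_measurable_lebesgue_AE[OF bLp_measurable[OF d] de]])
      (use de in auto)
  have "AE x in lborel. conv kb gb x - conv kb fb x = conv kb (\<lambda>x. gb x - fb x) x"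
    using conv_diff_AE[OF conv_integrable_AE[OF kb A gb(1)] conv_integrable_AE[OF kb A fb(1)]] by eventually_elim simp
  then have "Lp_norm r (\<lambda>x. conv kb gb x - conv kb fb x) = Lp_norm r (conv kb (\<lambda>x. gb x - fb x))"
    using bLp_measurable[OF hls_conv(1)[OF kb A gb(1)]] bLp_measurable[OF hls_conv(1)[OF kb A fb(1)]]
      bLp_measurable[OF hls_conv(1)[OF kb A d]]
    by (intro Lp_norm_cong_AE) (auto simp: measurable_completion)
  also have "conv kb (\<lambda>x. gb x - fb x) = distr_conv (distr_of_fun k) (\<lambda>x. g x - f x)"
    by (rule Lp_conv[OF d de, symmetric])
  also have "Lp_norm r \<dots> \<le> hls_const * A powr (1/q) * Lp_norm p (\<lambda>x. g x - f x)"
    by (rule distr_conv_Lp_bound(2)[OF dL])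
  finally show ?thesis unfolding Lp_conv[OF fb] Lp_conv[OF gb] .
qed

lemma distr_conv_continuous: "continuous_Lp p r (distr_conv (distr_of_fun k))"
  unfolding continuous_Lp_def
proof (intro conjI ballI allI impI)
  fix f :: "real^'n \<Rightarrow> complex" and e :: real assume f: "f \<in> Lp p" and e: "e > 0"
  define C where "C = hls_const * A powr (1/q)"
  have C: "C > 0" using hls_const_pos A by (simp add: C_def)
  show "\<exists>d>0. \<forall>g\<in>Lp p. Lp_norm p (\<lambda>x. g x - f x) < d \<longrightarrow>
     Lp_norm r (\<lambda>x. distr_conv (distr_of_fun k) g x - distr_conv (distr_of_fun k) f x) < e"
  proof (intro exI[of _ "e / C"] conjI ballI impI)
    show "e / C > 0" using e C by simp
    fix g assume g: "g \<in> Lp p" "Lp_norm p (\<lambda>x. g x - f x) < e / C"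
    have "Lp_norm r (\<lambda>x. distr_conv (distr_of_fun k) g x - distr_conv (distr_of_fun k) f x) \<le> C * Lp_norm p (\<lambda>x. g x - f x)"
      unfolding C_def by (rule distr_conv_diff_bound[OF f g(1)])
    also have "\<dots> < e" using g(2) C by (simp add: field_simps)
    finally show "Lp_norm r (\<lambda>x. distr_conv (distr_of_fun k) g x - distr_conv (distr_of_fun k) f x) < e" .
  qed
qed (rule distr_conv_Lp_bound)

lemma conv_op_spec:
  shows "continuous_Lp p r (conv_op p r (distr_of_fun k))"
    and "\<phi> \<in> schwartz \<Longrightarrow> AE x in lborel. conv_op p r (distr_of_fun k) \<phi> x = distr_conv (distr_of_fun k) \<phi> x"
proof -
  have "continuous_Lp p r (conv_op p r (distr_of_fun k)) \<and>
     (\<forall>f\<in>schwartz. AE x in lebesgue. conv_op p r (distr_of_fun k) f x = distr_conv (distr_of_fun k) f x)"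
    unfolding conv_op_def by (rule someI[of _ "distr_conv (distr_of_fun k)"]) (simp add: distr_conv_continuous)
  then show "continuous_Lp p r (conv_op p r (distr_of_fun k))"
    "\<phi> \<in> schwartz \<Longrightarrow> AE x in lborel. conv_op p r (distr_of_fun k) \<phi> x = distr_conv (distr_of_fun k) \<phi> x"
    by (auto simp: AE_completion_iff)
qed

text \<open>The extension is only known to be continuous and to agree with the convolution integral on Schwartz
  functions; linearity is not available. So both operators are compared at \<open>f\<close> with their common value at
  one smooth function close to \<open>f\<close>, where closeness is measured by the moduli of continuity of both at \<open>f\<close>.\<close>

lemma Lp_norm_conv_op:
  assumes f: "f \<in> Lp p"
  shows "Lp_norm r (conv_op p r (distr_of_fun k) f) = Lp_norm r (distr_conv (distr_of_fun k) f)"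
proof -
  define K where "K = conv_op p r (distr_of_fun k)"
  define K0 where "K0 = distr_conv (distr_of_fun k)"
  have cK: "continuous_Lp p r K" and cK0: "continuous_Lp p r K0"
    unfolding K_def K0_def by (rule conv_op_spec(1), rule distr_conv_continuous)
  obtain fb where fb: "fb \<in> bLp p" "AE x in lborel. f x = fb x" by (rule Lp_borel_representative[OF f])
  have KL: "K g \<in> Lp r" "K0 g \<in> Lp r" if "g \<in> Lp p" for g using cK cK0 that by (auto simp: continuous_Lp_def)
  obtain u where u: "u \<in> bLp r" "AE x in lborel. K f x = u x" by (rule Lp_borel_representative[OF KL(1)[OF f]])
  obtain u0 where u0: "u0 \<in> bLp r" "AE x in lborel. K0 f x = u0 x" by (rule Lp_borel_representative[OF KL(2)[OF f]])
  have small: "Lp_pow r (\<lambda>x. u x - u0 x) \<le> 2 powr r * (2 * e powr r)" if e: "e > 0" for e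
  proof -
    obtain d1 where d1: "d1 > 0" "\<And>g. g \<in> Lp p \<Longrightarrow> Lp_norm p (\<lambda>x. g x - f x) < d1 \<Longrightarrow> Lp_norm r (\<lambda>x. K g x - K f x) < e"
      using cK f e unfolding continuous_Lp_def by blast
    obtain d2 where d2: "d2 > 0" "\<And>g. g \<in> Lp p \<Longrightarrow> Lp_norm p (\<lambda>x. g x - f x) < d2 \<Longrightarrow> Lp_norm r (\<lambda>x. K0 g x - K0 f x) < e"
      using cK0 f e unfolding continuous_Lp_def by blast
    define d where "d = min d1 d2"
    have d: "d > 0" using d1 d2 by (simp add: d_def)
    obtain \<phi> where \<phi>: "smooth_bump \<phi>" "Lp_pow p (\<lambda>x. \<phi> x - fb x) < d powr p"
      using smooth_bump_dense[OF fb(1), of "d powr p"] d p_gt1 by auto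
    have phis: "\<phi> \<in> schwartz" by (rule smooth_bump_schwartz[OF \<phi>(1)])
    have phib: "\<phi> \<in> bLp p" using p_gt1 by (intro schwartz_bLp phis) simp
    have phiL: "\<phi> \<in> Lp p" by (rule bLp_imp_Lp(1)[OF phib])
    have "Lp_norm p (\<lambda>x. \<phi> x - f x) = Lp_pow p (\<lambda>x. \<phi> x - fb x) powr (1/p)"
      by (rule Lp_norm_diff_representative[OF phib fb(1) _ fb(2)]) (use p_gt1 in auto)
    also have "\<dots> < (d powr p) powr (1/p)" using \<phi>(2) p_gt1 Lp_pow_nonneg by (intro powr_less_mono2) auto
    also have "\<dots> = d" using d p_gt1 by (simp add: powr_powr)
    finally have near: "Lp_norm p (\<lambda>x. \<phi> x - f x) < d" .
    obtain v where v: "v \<in> bLp r" "AE x in lborel. K \<phi> x = v x" by (rule Lp_borel_representative[OF KL(1)[OF phiL]])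
    have v0: "AE x in lborel. K0 \<phi> x = v x"
      using conv_op_spec(2)[OF phis] v(2) unfolding K_def K0_def by eventually_elim simp
    have *: "Lp_pow r (\<lambda>x. v x - w x) \<le> e powr r" if "Lp_norm r g < e" "Lp_norm r g = Lp_pow r (\<lambda>x. v x - w x) powr (1/r)" for g w :: "real^'n \<Rightarrow> complex"
    proof -
      have "(Lp_pow r (\<lambda>x. v x - w x) powr (1/r)) powr r \<le> e powr r" using that r_gt1 by (intro powr_mono2) auto
      then show ?thesis using r_gt1 by (simp add: powr_powr Lp_pow_nonneg)
    qed
    have 1: "Lp_pow r (\<lambda>x. v x - u x) \<le> e powr r"
      by (rule *[of "\<lambda>x. K \<phi> x - K f x"], rule d1(2)[OF phiL], use near in \<open>simp add: d_def\<close>,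
        rule Lp_norm_diff_representative[OF v(1) u(1) v(2) u(2)], use r_gt1 in simp)
    have 2: "Lp_pow r (\<lambda>x. v x - u0 x) \<le> e powr r"
      by (rule *[of "\<lambda>x. K0 \<phi> x - K0 f x"], rule d2(2)[OF phiL], use near in \<open>simp add: d_def\<close>,
        rule Lp_norm_diff_representative[OF v(1) u0(1) v0 u0(2)], use r_gt1 in simp)
    have "Lp_pow r (\<lambda>x. u x - u0 x) = Lp_pow r (\<lambda>x. (v x - u0 x) - (v x - u x))" by simp
    also have "\<dots> \<le> 2 powr r * (Lp_pow r (\<lambda>x. v x - u0 x) + Lp_pow r (\<lambda>x. v x - u x))"
      using r_gt1 by (intro Lp_pow_diff_le bLp_diff v u u0) auto
    also have "\<dots> \<le> 2 powr r * (2 * e powr r)" using 1 2 by (intro mult_left_mono) auto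
    finally show ?thesis .
  qed
  have "((\<lambda>e. 2 powr r * (2 * e powr r)) \<longlongrightarrow> 2 powr r * (2 * 0 powr r)) (at_right 0)"
    using r_gt1 by (intro tendsto_intros tendsto_powr') (auto simp: eventually_at_filter)
  then have "Lp_pow r (\<lambda>x. u x - u0 x) \<le> 2 powr r * (2 * 0 powr r)"
    by (rule tendsto_lowerbound) (use small in \<open>auto simp: eventually_at_filter\<close>)
  then have z: "Lp_pow r (\<lambda>x. u x - u0 x) = 0" using Lp_pow_nonneg[of r "\<lambda>x. u x - u0 x"] by simp
  have "(\<lambda>x. u x - u0 x) \<in> bLp r" using r_gt1 by (intro bLp_diff u u0) auto
  from Lp_pow_zero_imp_AE[OF this z] u(2) u0(2) have "AE x in lborel. K f x = K0 f x"
    by eventually_elim simp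
  then have "Lp_norm r (K f) = Lp_norm r (K0 f)"
    using KL[OF f] by (intro Lp_norm_cong_AE) (auto simp: Lp_def)
  then show ?thesis by (simp add: K_def K0_def)
qed

end

end

theorem theorem3:
  fixes k :: "real^'n \<Rightarrow> complex" and p q r s :: real
  assumes "1 < p" and "p < r"
    and "1/p + 1/q = 1 + 1/r"
    and "q \<le> s"
    and "k \<in> lorentz q s"
  shows "\<exists>f. is_maximizer p r (distr_of_fun k) f"
proof -
  interpret hls_exponents p q r by standard fact+
  have km: "k \<in> borel_measurable lebesgue" using assms(5) by (simp add: lorentz_def)
  obtain kb where kb: "kb \<in> borel_measurable borel" "AE x in lborel. k x = kb x"
    using lebesgue_ex_borel_complex[OF km] by blast
  have approximable: "approximable q kb" by (rule lorentz_approximable[OF assms(5) _ _ kb]) (use q_gt1 assms(4) in auto)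
  then obtain A where A: "A > 0" "weak_Lq q A kb" by (auto simp: approximable_def)
  note ctx = A(2,1) kb(2)
  obtain f where f: "f \<in> bLp p" "Lp_pow p f = 1"
    "\<And>g. g \<in> bLp p \<Longrightarrow> Lp_pow p g \<le> 1 \<Longrightarrow> Lp_pow r (conv kb g) \<le> Lp_pow r (conv kb f)"
    using conv_has_maximizer[OF approximable] by blast
  have fL: "f \<in> Lp p" "Lp_norm p f = 1" using bLp_imp_Lp[OF f(1)] f(2) by auto
  have norm_K: "Lp_norm r (conv_op p r (distr_of_fun k) g) = Lp_pow r (conv kb gb) powr (1/r)"
    if "g \<in> Lp p" "gb \<in> bLp p" "AE x in lborel. g x = gb x" for g gb
    unfolding Lp_norm_conv_op[OF ctx that(1)] Lp_conv[OF ctx that(2,3)]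
    by (rule bLp_imp_Lp(2)[OF hls_conv(1)[OF A(2,1) that(2)]])
  have "op_norm p r (conv_op p r (distr_of_fun k)) = Lp_norm r (conv_op p r (distr_of_fun k) f)"
    unfolding op_norm_def
  proof (rule cSup_eq_maximum)
    show "Lp_norm r (conv_op p r (distr_of_fun k) f)
      \<in> (\<lambda>f. Lp_norm r (conv_op p r (distr_of_fun k) f)) ` {f \<in> Lp p. Lp_norm p f \<le> 1}"
      using fL by auto
    fix y assume "y \<in> (\<lambda>f. Lp_norm r (conv_op p r (distr_of_fun k) f)) ` {f \<in> Lp p. Lp_norm p f \<le> 1}"
    then obtain g where g: "g \<in> Lp p" "Lp_norm p g \<le> 1" "y = Lp_norm r (conv_op p r (distr_of_fun k) g)" by auto
    obtain gb where gb: "gb \<in> bLp p" "AE x in lborel. g x = gb x" "Lp_norm p g = Lp_pow p gb powr (1/p)"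
      by (rule Lp_borel_representative[OF g(1)])
    have "(Lp_pow p gb powr (1/p)) powr p \<le> 1 powr p" using gb(3) g(2) p_gt1 by (intro powr_mono2) auto
    then have "Lp_pow p gb \<le> 1" using p_gt1 by (simp add: powr_powr Lp_pow_nonneg)
    then have "Lp_pow r (conv kb gb) powr (1/r) \<le> Lp_pow r (conv kb f) powr (1/r)"
      using f(3)[OF gb(1)] r_gt1 Lp_pow_nonneg by (intro powr_mono2) auto
    then show "y \<le> Lp_norm r (conv_op p r (distr_of_fun k) f)"
      unfolding g(3) norm_K[OF g(1) gb(1,2)] using norm_K[OF fL(1) f(1)] by simp
  qed
  then have "is_maximizer p r (distr_of_fun k) f"
    unfolding is_maximizer_def using fL distr_of_fun_Cnv[OF ctx] by simp
  then show ?thesis by blast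
qed

end
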